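(* For every $K\in\mathrm{InSy}(\infty)$ one has $\mathrm{Law}(K)\in\mathrm{erg}(\mathtt{ErInPr})$, and the map $\mathrm{InSy}(\infty)\to\mathrm{erg}(\mathtt{ErInPr})$, $K\mapsto\mathrm{Law}(K)$, is a homeomorphism. Moreover, let $(I,\eta)=(I_n,\eta_n)_{n\in\mathbb{N}}$ be an erased-interval process. Then $n^{-1}I_n$ converges almost surely in $(\mathrm{InSy}(\infty),d_{\mathrm{haus}})$ as $n\to\infty$ towards some $\mathrm{InSy}(\infty)$-valued random variable $I_\infty$. Let $U=(U_i)_{i\in\mathbb{N}}$ be the $U$-process corresponding to $\eta$. Then $I_\infty$ and $U$ are independent and one has the equality of processes $$(I_n,\eta_n)_{n\in\mathbb{N}}=\Big(\phi^{\infty}_n(I_\infty,U_{1:n},\dots,U_{n:n}),\eta_n\Big)_{n\in\mathbb{N}}\quad\text{almost surely.}$$ In particular, for every erased-interval process $(I,\eta)$ the conditional law of $(I,\eta)$ given the terminal $\sigma$-field $\mathcal{F}_\infty=\bigcap_{n}\sigma(I_m,\eta_m:m\ge n)$ is almost surely equal to $\mathrm{Law}(I_\infty)$, and $I_\infty$ generates $\mathcal{F}_\infty$ almost surely (i.e. up to null events).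
   Context: Interval systems: an interval system on $[n]=\{1,\dots,n\}$ is a set $\mathtt{I}$ of subsets of $[n]$ with $\emptyset\in\mathtt{I}$, $\{j\}\in\mathtt{I}$ for all $j\in[n]$, and such that every non-empty element is of the form $[a,b]:=\{i\in[n]:a\le i\le b\}$ with $1\le a\le b\le n$. $\mathrm{InSy}(n)$ is the finite set of all interval systems on $[n]$. For $[a,b]\subseteq[n+1]$ and $k\in[n+1]$ let $[a,b]-\{k\}\subseteq[n]$ be $[a-1,b-1]$ if $k<a$; $[a,b-1]$ if $a\le k\le b$ (empty if $a=b$); $[a,b]$ if $b<k$. For $\mathtt{I}\in\mathrm{InSy}(n+1)$ let $\phi^{n+1}_n(\mathtt{I},k):=\{[a,b]-\{k\}:[a,b]\in\mathtt{I}\}\cup\{\emptyset\}\in\mathrm{InSy}(n)$. Erased-interval process (EIP): a stochastic process $(I_n,\eta_n)_{n\in\mathbb{N}}$ such that for all $n$: (i) $(I_n,\eta_n)\in\mathrm{InSy}(n)\times[n+1]$ a.s.; (ii) $\eta_n$ is uniform on $[n+1]$ and independent of $\mathcal{F}_{n+1}$, where $\mathcal{F}_n:=\sigma(I_m,\eta_m:m\ge n)$; (iii) $I_n=\phi^{n+1}_n(I_{n+1},\eta_n)$ a.s. $\mathtt{ErInPr}$ is the set of laws of EIPs, with the topology of weak convergence of Borel probability measures on the product space $\prod_n\mathrm{InSy}(n)\times[n+1]$. $\mathrm{erg}(\mathtt{ErInPr})$ is the subset of laws of EIPs whose terminal $\sigma$-field $\mathcal{F}_\infty=\bigcap_n\mathcal{F}_n$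 is a.s. trivial. Limit space: let $\mathrm{InSy}(\infty)$ be the set of compact $K\subseteq\{(x,y)\in\mathbb{R}^2:0\le x\le y\le1\}$ containing the diagonal $\Delta:=\{(x,x):0\le x\le1\}$, with the Hausdorff distance $d_{\mathrm{haus}}$ induced by the $\ell^1$-metric on $\mathbb{R}^2$. For $\mathtt{I}\in\mathrm{InSy}(n)$ let $n^{-1}\mathtt{I}:=\{(\frac{a-1}{n},\frac bn):\emptyset\ne[a,b]\in\mathtt{I}\}\cup\Delta\in\mathrm{InSy}(\infty)$. For $K\in\mathrm{InSy}(\infty)$ and $0\le u_1<\dots<u_k\le1$ put $u_0:=-1$, $u_{k+1}:=2$ and let $\phi^\infty_k(K,u_1,\dots,u_k)\in\mathrm{InSy}(k)$ consist of $\emptyset$, all singletons $\{j\}$, $j\in[k]$, and all $[a,b]$ with $1\le a<b\le k$ for which there is $(x,y)\in K$ with $u_{a-1}<x<u_a\le u_b<y<u_{b+1}$. Corresponding processes: a $U$-process is an i.i.d. sequence $(U_i)_{i\in\mathbb{N}}$ of uniform random variables on $[0,1]$; $U_{1:n}<\dots<U_{n:n}$ denote the order statistics of $U_1,\dots,U_n$. An eraser process is a sequence $(\eta_n)$ of independent random variables with $\eta_n$ uniform on $[n+1]$. Given an eraser process $\eta$, let $S_1$ be the permutation of $[1]$ and let $S_{n+1}$ be the random permutation of $[n+1]$ whose one-line notation is obtained from that of $S_n$ by inserting $n+1$ so that it stands at position $\eta_n$; then $U_i:=\lim_n S_n^{-1}(i)/n$ exists a.s. and $U=(U_i)$ is a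 $U$-process, the $U$-process corresponding to $\eta$. Conversely the eraser process corresponding to a $U$-process is $\eta_k=\#\{i\in[k+1]:U_i\le U_{k+1}\}$; these operations are a.s. mutually inverse. For $K\in\mathrm{InSy}(\infty)$, $\mathrm{Law}(K)$ denotes the law of $(\phi^\infty_n(K,U_{1:n},\dots,U_{n:n}),\eta_n)_{n\in\mathbb{N}}$, where $U$ is a $U$-process and $\eta$ its corresponding eraser process. *)

theory Defs
  imports "HOL-Probability.Probability"
begin

section \<open>Topological and measure-theoretic vocabulary\<close>

definition borel_of :: "'a topology \<Rightarrow> 'a measure" where
  "borel_of X = sigma (topspace X) {U. openin X U}"

text \<open>The topology of weak convergence on the Borel probability measures of \<open>X\<close>: the coarsest
  topology making \<open>P \<mapsto> \<integral>f dP\<close> continuous for every bounded continuous \<open>f\<close>.\<close>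

definition weak_topology :: "'a topology \<Rightarrow> 'a measure topology" where
  "weak_topology X = topology_generated_by
     {{P \<in> space (prob_algebra (borel_of X)). (\<integral>x. f x \<partial>P) \<in> V} | f V.
        continuous_map X euclideanreal f \<and> bounded (f ` topspace X) \<and> open V}"

text \<open>\<open>\<kappa>\<close> is a (regular) conditional law of the \<open>N\<close>-valued random element \<open>X\<close> given the
  sub-\<open>\<sigma>\<close>-field \<open>F\<close>.\<close>

definition conditional_law ::
    "'a measure \<Rightarrow> 'a measure \<Rightarrow> 'b measure \<Rightarrow> ('a \<Rightarrow> 'b) \<Rightarrow> ('a \<Rightarrow> 'b measure) \<Rightarrow> bool" where
  "conditional_law M F N X \<kappa> \<longleftrightarrow>
     \<kappa> \<in> F \<rightarrow>\<^sub>M prob_algebra N \<and>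
     (\<forall>A\<in>sets N. AE \<omega> in M.
        real_cond_exp M F (indicator (X -` A \<inter> space M)) \<omega> = measure (\<kappa> \<omega>) A)"

definition equal_mod_null :: "'a measure \<Rightarrow> 'a set set \<Rightarrow> 'a set set \<Rightarrow> bool" where
  "equal_mod_null M \<A> \<B> \<longleftrightarrow>
     (\<forall>A\<in>\<A>. \<exists>B\<in>\<B>. sym_diff A B \<in> null_sets M) \<and>
     (\<forall>B\<in>\<B>. \<exists>A\<in>\<A>. sym_diff A B \<in> null_sets M)"

section \<open>Interval systems\<close>

definition InSy :: "nat \<Rightarrow> nat set set set" where
  "InSy n = {I. {} \<in> I \<and> (\<forall>j\<in>{1..n}. {j} \<in> I) \<and>
     (\<forall>A\<in>I. A \<noteq> {} \<longrightarrow> (\<exists>a b. 1 \<le> a \<and> a \<le> b \<and> b \<le> n \<and> A = {a..b}))}"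

text \<open>The interval \<open>[a,b] - {k}\<close>, for \<open>1 \<le> a \<le> b\<close>; for \<open>k = a = b\<close> the middle case is empty.\<close>

definition interval_erase :: "nat \<Rightarrow> nat \<Rightarrow> nat \<Rightarrow> nat set" where
  "interval_erase a b k =
     (if k < a then {a - 1..b - 1} else if k \<le> b then {a..b - 1} else {a..b})"

text \<open>The map \<open>\<phi>\<^sup>n\<^sup>+\<^sup>1\<^sub>n\<close>; its defining formula does not involve \<open>n\<close>.\<close>

definition phi :: "nat set set \<Rightarrow> nat \<Rightarrow> nat set set" where
  "phi I k = {interval_erase a b k | a b. 1 \<le> a \<and> a \<le> b \<and> {a..b} \<in> I} \<union> {{}}"

section \<open>Erased-interval processes and their laws\<close>

text \<open>All processes are indexed by \<open>n \<ge> 1\<close>; a value at index \<open>0\<close> is never used.\<close>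

type_synonym path = "nat \<Rightarrow> nat set set \<times> nat"

definition path_topology :: "path topology" where
  "path_topology = product_topology (\<lambda>n. discrete_topology (InSy n \<times> {1..n + 1})) {1..}"

abbreviation path_space :: "path measure" where
  "path_space \<equiv> borel_of path_topology"

definition process_path ::
    "(nat \<Rightarrow> 'a \<Rightarrow> nat set set) \<Rightarrow> (nat \<Rightarrow> 'a \<Rightarrow> nat) \<Rightarrow> 'a \<Rightarrow> path" where
  "process_path I \<eta> \<omega> = (\<lambda>n\<in>{1..}. (I n \<omega>, \<eta> n \<omega>))"

definition future_field ::
    "'a measure \<Rightarrow> (nat \<Rightarrow> 'a \<Rightarrow> nat set set) \<Rightarrow> (nat \<Rightarrow> 'a \<Rightarrow> nat) \<Rightarrow> nat \<Rightarrow> 'a measure" where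
  "future_field M I \<eta> n = sigma (space M)
     (\<Union>m\<in>{n..}. sets (vimage_algebra (space M) (\<lambda>\<omega>. (I m \<omega>, \<eta> m \<omega>)) (count_space UNIV)))"

definition terminal_field ::
    "'a measure \<Rightarrow> (nat \<Rightarrow> 'a \<Rightarrow> nat set set) \<Rightarrow> (nat \<Rightarrow> 'a \<Rightarrow> nat) \<Rightarrow> 'a measure" where
  "terminal_field M I \<eta> = sigma (space M) (\<Inter>n\<in>{1..}. sets (future_field M I \<eta> n))"

definition erased_interval_process ::
    "'a measure \<Rightarrow> (nat \<Rightarrow> 'a \<Rightarrow> nat set set) \<Rightarrow> (nat \<Rightarrow> 'a \<Rightarrow> nat) \<Rightarrow> bool" where
  "erased_interval_process M I \<eta> \<longleftrightarrow> prob_space M \<and> (\<forall>n\<ge>1.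
     I n \<in> M \<rightarrow>\<^sub>M count_space UNIV \<and> \<eta> n \<in> M \<rightarrow>\<^sub>M count_space UNIV \<and>
     (AE \<omega> in M. (I n \<omega>, \<eta> n \<omega>) \<in> InSy n \<times> {1..n + 1}) \<and>
     distr M (count_space UNIV) (\<eta> n) = measure_pmf (pmf_of_set {1..n + 1}) \<and>
     prob_space.indep_set M (sets (vimage_algebra (space M) (\<eta> n) (count_space UNIV)))
       (sets (future_field M I \<eta> (n + 1))) \<and>
     (AE \<omega> in M. I n \<omega> = phi (I (n + 1) \<omega>) (\<eta> n \<omega>)))"

text \<open>The path may leave \<open>space path_space\<close> on a null event. Preimages of measurable sets of paths
  are measurable all the same, so that \<^const>\<open>distr\<close> still is the law of the process.\<close>

definition process_law ::
    "'a measure \<Rightarrow> (nat \<Rightarrow> 'a \<Rightarrow> nat set set) \<Rightarrow> (nat \<Rightarrow> 'a \<Rightarrow> nat) \<Rightarrow> path measure" where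
  "process_law M I \<eta> = distr M path_space (process_path I \<eta>)"

text \<open>The sample spaces in the next two definitions have type \<^typ>\<open>path\<close>. No law is lost this way:
  an erased-interval process on any sample space has the same law as the coordinate process under
  its law, and the latter is again an erased-interval process; triviality of the terminal
  \<open>\<sigma>\<close>-field also depends on the law only.\<close>

definition ErInPr :: "path measure set" where
  "ErInPr = {process_law M I \<eta> | (M :: path measure) I \<eta>. erased_interval_process M I \<eta>}"

definition erg_ErInPr :: "path measure set" where
  "erg_ErInPr = {process_law M I \<eta> | (M :: path measure) I \<eta>. erased_interval_process M I \<eta> \<and>
     (\<forall>A\<in>sets (terminal_field M I \<eta>). measure M A = 0 \<or> measure M A = 1)}"

section \<open>The limit space\<close>

definition diag :: "(real \<times> real) set" where
  "diag = {(x, x) | x. 0 \<le> x \<and> x \<le> 1}"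

definition InSy_inf :: "(real \<times> real) set set" where
  "InSy_inf = {K. compact K \<and> K \<subseteq> {(x, y). 0 \<le> x \<and> x \<le> y \<and> y \<le> 1} \<and> diag \<subseteq> K}"

definition l1_dist :: "real \<times> real \<Rightarrow> real \<times> real \<Rightarrow> real" where
  "l1_dist p q = \<bar>fst p - fst q\<bar> + \<bar>snd p - snd q\<bar>"

text \<open>Outside \<open>InSy_inf\<close> the value is fixed to \<open>0\<close>, as \<^const>\<open>Metric_space\<close> demands a globally
  non-negative distance while suprema of empty or unbounded sets of reals are unspecified.\<close>

definition d_haus :: "(real \<times> real) set \<Rightarrow> (real \<times> real) set \<Rightarrow> real" where
  "d_haus K L = (if K \<in> InSy_inf \<and> L \<in> InSy_inf
     then max (SUP p\<in>K. INF q\<in>L. l1_dist p q) (SUP q\<in>L. INF p\<in>K. l1_dist p q) else 0)"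

lemma l1_dist_nonneg: "0 \<le> l1_dist p q"
  and l1_dist_sym: "l1_dist p q = l1_dist q p"
  and l1_dist_triangle: "l1_dist p r \<le> l1_dist p q + l1_dist q r"
  and l1_dist_eq_0: "l1_dist p q = 0 \<longleftrightarrow> p = q"
  by (auto simp: l1_dist_def prod_eq_iff)

lemma l1_dist_le_2:
  assumes "K \<in> InSy_inf" "L \<in> InSy_inf" "p \<in> K" "q \<in> L"
  shows "l1_dist p q \<le> 2"
proof -
  have "p \<in> {(x, y). 0 \<le> x \<and> x \<le> y \<and> y \<le> 1}" "q \<in> {(x, y). 0 \<le> x \<and> x \<le> y \<and> y \<le> 1}"
    using assms by (auto simp: InSy_inf_def)
  then show ?thesis by (auto simp: l1_dist_def)
qed

lemma InSy_inf_nonempty: "K \<in> InSy_inf \<Longrightarrow> K \<noteq> {}"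
proof -
  assume "K \<in> InSy_inf"
  then have "(0, 0) \<in> K" by (auto simp: InSy_inf_def diag_def)
  then show ?thesis by auto
qed

lemma INF_l1_dist_attained:
  assumes "L \<in> InSy_inf"
  obtains q where "q \<in> L" "(INF r\<in>L. l1_dist p r) = l1_dist p q"
    "\<And>r. r \<in> L \<Longrightarrow> l1_dist p q \<le> l1_dist p r"
proof -
  have "continuous_on L (l1_dist p)"
    unfolding l1_dist_def by (intro continuous_intros)
  then obtain q where q: "q \<in> L" "\<And>r. r \<in> L \<Longrightarrow> l1_dist p q \<le> l1_dist p r"
    using continuous_attains_inf[of L "l1_dist p"] InSy_inf_nonempty[OF assms] assms
    by (auto simp: InSy_inf_def)
  have "(INF r\<in>L. l1_dist p r) = l1_dist p q"
    using q by (intro cInf_eq_minimum) auto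
  with q that show ?thesis by blast
qed

lemma d_haus_sym: "d_haus K L = d_haus L K"
  by (simp add: d_haus_def max.commute l1_dist_sym conj_commute)

lemma d_haus_near:
  assumes KL: "K \<in> InSy_inf" "L \<in> InSy_inf" and p: "p \<in> K"
  obtains q where "q \<in> L" "l1_dist p q \<le> d_haus K L"
proof -
  have "(INF q\<in>L. l1_dist r q) \<le> 2" if "r \<in> K" for r
  proof -
    obtain q where "q \<in> L" "(INF q\<in>L. l1_dist r q) = l1_dist r q"
      using INF_l1_dist_attained[OF KL(2)] by metis
    then show ?thesis using l1_dist_le_2[OF KL that] by simp
  qed
  then have "bdd_above ((\<lambda>r. INF q\<in>L. l1_dist r q) ` K)" by (auto intro!: bdd_aboveI)
  then have "(INF q\<in>L. l1_dist p q) \<le> (SUP r\<in>K. INF q\<in>L. l1_dist r q)"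
    by (intro cSUP_upper p)
  then have *: "(INF q\<in>L. l1_dist p q) \<le> d_haus K L" using KL by (simp add: d_haus_def)
  obtain q where "q \<in> L" "(INF q\<in>L. l1_dist p q) = l1_dist p q"
    using INF_l1_dist_attained[OF KL(2)] by metis
  with * show ?thesis by (intro that) auto
qed

lemma d_haus_leI:
  assumes KL: "K \<in> InSy_inf" "L \<in> InSy_inf"
    and 1: "\<And>p. p \<in> K \<Longrightarrow> \<exists>q\<in>L. l1_dist p q \<le> c"
    and 2: "\<And>q. q \<in> L \<Longrightarrow> \<exists>p\<in>K. l1_dist q p \<le> c"
  shows "d_haus K L \<le> c"
proof -
  have INF_le: "(INF q\<in>N. l1_dist p q) \<le> c"
    if N: "N \<in> InSy_inf" and q: "\<exists>q\<in>N. l1_dist p q \<le> c" for N p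
  proof -
    obtain r where r: "(INF q\<in>N. l1_dist p q) = l1_dist p r"
      "\<And>q. q \<in> N \<Longrightarrow> l1_dist p r \<le> l1_dist p q"
      using INF_l1_dist_attained[OF N, of p] by blast
    from q obtain q where "q \<in> N" "l1_dist p q \<le> c" by blast
    then show ?thesis using r(1) r(2)[of q] by linarith
  qed
  have "(INF q\<in>L. l1_dist p q) \<le> c" if "p \<in> K" for p
    by (rule INF_le[OF KL(2) 1[OF that]])
  moreover have "(INF p\<in>K. l1_dist p q) \<le> c" if "q \<in> L" for q
    using INF_le[OF KL(1) 2[OF that]] by (simp add: l1_dist_sym)
  ultimately show ?thesis
    using KL InSy_inf_nonempty[OF KL(1)] InSy_inf_nonempty[OF KL(2)]
    by (auto simp: d_haus_def intro!: cSUP_least)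
qed

lemma Metric_space_d_haus: "Metric_space InSy_inf d_haus"
proof
  have nonneg: "0 \<le> d_haus K L" if KL: "K \<in> InSy_inf" "L \<in> InSy_inf" for K L
  proof -
    obtain p where "p \<in> K" using InSy_inf_nonempty[OF KL(1)] by blast
    then obtain q where "l1_dist p q \<le> d_haus K L" using d_haus_near[OF KL] by metis
    then show ?thesis using l1_dist_nonneg[of p q] by linarith
  qed
  then show "0 \<le> d_haus K L" for K L by (cases "K \<in> InSy_inf \<and> L \<in> InSy_inf") (auto simp: d_haus_def)
  show "d_haus K L = d_haus L K" for K L by (rule d_haus_sym)
  have sub: "K \<subseteq> L" if KL: "K \<in> InSy_inf" "L \<in> InSy_inf" and 0: "d_haus K L = 0" for K L
  proof
    fix p assume "p \<in> K"
    then obtain q where "q \<in> L" "l1_dist p q \<le> d_haus K L" by (rule d_haus_near[OF KL])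
    then have "l1_dist p q = 0" using 0 l1_dist_nonneg[of p q] by linarith
    then show "p \<in> L" using \<open>q \<in> L\<close> by (simp add: l1_dist_eq_0)
  qed
  show "d_haus K L = 0 \<longleftrightarrow> K = L" if KL: "K \<in> InSy_inf" "L \<in> InSy_inf" for K L
  proof
    assume "d_haus K L = 0"
    then show "K = L" using sub[OF KL] sub[OF KL(2,1)] d_haus_sym[of K L] by simp
  next
    assume "K = L"
    moreover have "l1_dist p p \<le> 0" for p by (simp add: l1_dist_def)
    ultimately have "d_haus K L \<le> 0" using KL by (intro d_haus_leI) blast+
    then show "d_haus K L = 0" using nonneg[OF KL] by simp
  qed
  have near: "\<exists>r\<in>N. l1_dist p r \<le> d_haus K L + d_haus L N"
    if KLN: "K \<in> InSy_inf" "L \<in> InSy_inf" "N \<in> InSy_inf" and p: "p \<in> K" for K L N p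
  proof -
    obtain q where q: "q \<in> L" "l1_dist p q \<le> d_haus K L" by (rule d_haus_near[OF KLN(1,2) p])
    obtain r where "r \<in> N" "l1_dist q r \<le> d_haus L N" by (rule d_haus_near[OF KLN(2,3) q(1)])
    then show ?thesis using q l1_dist_triangle[of p r q] by force
  qed
  show "d_haus K N \<le> d_haus K L + d_haus L N"
    if "K \<in> InSy_inf" "L \<in> InSy_inf" "N \<in> InSy_inf" for K L N
  proof (rule d_haus_leI[OF that(1,3)])
    fix p assume "p \<in> K"
    then show "\<exists>q\<in>N. l1_dist p q \<le> d_haus K L + d_haus L N" by (rule near[OF that])
  next
    fix q assume "q \<in> N"
    then show "\<exists>p\<in>K. l1_dist q p \<le> d_haus K L + d_haus L N"
      using near[OF that(3,2,1)] by (simp add: d_haus_sym add.commute)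
  qed
qed

abbreviation InSy_inf_topology :: "(real \<times> real) set topology" where
  "InSy_inf_topology \<equiv> Metric_space.mtopology InSy_inf d_haus"

text \<open>\<open>n\<^sup>-\<^sup>1 I\<close>\<close>

definition rescale :: "nat \<Rightarrow> nat set set \<Rightarrow> (real \<times> real) set" where
  "rescale n I =
     {((real a - 1) / real n, real b / real n) | a b. 1 \<le> a \<and> a \<le> b \<and> {a..b} \<in> I} \<union> diag"

text \<open>\<open>pad k u\<close> is \<open>u\<^sub>1, \<dots>, u\<^sub>k\<close> extended by \<open>u\<^sub>0 = -1\<close> and \<open>u\<^sub>k\<^sub>+\<^sub>1 = 2\<close>.\<close>

definition pad :: "nat \<Rightarrow> (nat \<Rightarrow> real) \<Rightarrow> nat \<Rightarrow> real" where
  "pad k u i = (if i = 0 then -1 else if i \<le> k then u i else 2)"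

text \<open>\<open>phi_inf k K u\<close> is \<open>\<phi>\<^sup>\<infinity>\<^sub>k(K, u\<^sub>1, \<dots>, u\<^sub>k)\<close>.\<close>

definition phi_inf :: "nat \<Rightarrow> (real \<times> real) set \<Rightarrow> (nat \<Rightarrow> real) \<Rightarrow> nat set set" where
  "phi_inf k K u = {{}} \<union> {{j} | j. j \<in> {1..k}} \<union>
     {{a..b} | a b. 1 \<le> a \<and> a < b \<and> b \<le> k \<and>
        (\<exists>(x, y)\<in>K. pad k u (a - 1) < x \<and> x < pad k u a \<and> pad k u a \<le> pad k u b \<and>
                    pad k u b < y \<and> y < pad k u (b + 1))}"

section \<open>Corresponding eraser and \<open>U\<close>-processes\<close>

text \<open>\<open>order_stat u n i\<close> is \<open>u\<^sub>i\<^sub>:\<^sub>n\<close>, for \<open>1 \<le> i \<le> n\<close>.\<close>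

definition order_stat :: "(nat \<Rightarrow> real) \<Rightarrow> nat \<Rightarrow> nat \<Rightarrow> real" where
  "order_stat u n i = sort (map u [1..<Suc n]) ! (i - 1)"

text \<open>One-line notation of the permutation \<open>S\<^sub>n\<close>. The recursion starts from the empty permutation;
  its first step yields \<open>[1]\<close> whatever the value \<open>\<eta>\<^sub>0\<close> is.\<close>

primrec eraser_perm :: "(nat \<Rightarrow> nat) \<Rightarrow> nat \<Rightarrow> nat list" where
  "eraser_perm \<eta> 0 = []"
| "eraser_perm \<eta> (Suc n) =
     take (\<eta> n - 1) (eraser_perm \<eta> n) @ [Suc n] @ drop (\<eta> n - 1) (eraser_perm \<eta> n)"

text \<open>\<open>S\<^sub>n\<^sup>-\<^sup>1(i)\<close>, for \<open>1 \<le> i \<le> n\<close>\<close>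

definition eraser_perm_inv :: "(nat \<Rightarrow> nat) \<Rightarrow> nat \<Rightarrow> nat \<Rightarrow> nat" where
  "eraser_perm_inv \<eta> n i = (THE j. j \<in> {1..n} \<and> eraser_perm \<eta> n ! (j - 1) = i)"

definition U_of_eraser :: "(nat \<Rightarrow> nat) \<Rightarrow> nat \<Rightarrow> real" where
  "U_of_eraser \<eta> i = lim (\<lambda>n. real (eraser_perm_inv \<eta> n i) / real n)"

definition eraser_of_U :: "(nat \<Rightarrow> real) \<Rightarrow> nat \<Rightarrow> nat" where
  "eraser_of_U u k = card {i \<in> {1..k + 1}. u i \<le> u (k + 1)}"

text \<open>The law of a \<open>U\<close>-process\<close>

definition U_measure :: "(nat \<Rightarrow> real) measure" where
  "U_measure = (\<Pi>\<^sub>M i\<in>{1..}. uniform_measure lborel {0..1})"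

definition Law :: "(real \<times> real) set \<Rightarrow> path measure" where
  "Law K = process_law U_measure
     (\<lambda>n u. phi_inf n K (order_stat u n)) (\<lambda>n u. eraser_of_U u n)"

end

(* A point (x, y) of K is seen at level n through the counts of the first n uniform points to the
   left of x and of y. Along a path with equidistributed points, rescaled interval systems of two levels
   are therefore within twice the sum of the discrepancies, so they form a Cauchy sequence, and the limit
   K determines every level as soon as each closed cell of sample points hit by K is also hit in its
   interior; for fixed K a one-coordinate Fubini argument shows that this holds almost surely. The limit is measurable
   for the terminal field, which is independent of the erasers, so Fubini on the joint law yields the
   conditional law. Concentration of the discrepancy is uniform in K, which makes the inverse of
   K |-> Law K continuous without any appeal to compactness. *)
theory Submission
  imports Defs
begin

section \<open>Deterministic analysis along one fixed sequence of points\<close>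

section \<open>Counting functions and cuts\<close>

text \<open>An interval [a,b] is handled through the two gaps that bound it, the cuts c = a - 1 and
  d = b. The three cases of \<open>interval_erase\<close> then become one map applied to each cut
  separately, and rescaling sends the interval to (c/n, d/n). A real number marks a cut at every
  level at once, namely its count, and this ties all levels together without composing erasures. The
  obstacle is the boundary of the cells. \<open>phi_inf\<close> demands strict inequalities, which
  survive neither limits nor the removal of a sample point that coincides with a coordinate of a
  point of K; goodness repairs both defects. An abstract process comes without points, so they are
  rebuilt from its eraser sequence. Whatever holds almost surely for eraser sequences is proved on
  the space of uniform points and transferred through equality in law. Independence is stated
  against the whole terminal field and not only against the limit. Hence a terminal event can be
  compared with its own conditional probability, and this shows that the limit generates the
  field.\<close>

definition cnt :: "(nat \<Rightarrow> real) \<Rightarrow> nat \<Rightarrow> real \<Rightarrow> nat" where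
  "cnt u n x = card {j \<in> {1..n}. u j \<le> x}"

text \<open>The effect on gap labels of removing point \<open>k\<close> from a row: the gaps
  \<open>k - 1\<close> and \<open>k\<close> merge, and larger labels drop by one.\<close>

definition squeeze :: "nat \<Rightarrow> nat \<Rightarrow> nat" where
  "squeeze k z = (if k \<le> z then z - 1 else z)"

lemma cnt_mono: "x \<le> y \<Longrightarrow> cnt u n x \<le> cnt u n y"
  unfolding cnt_def by (rule card_mono) auto

lemma cnt_le: "cnt u n x \<le> n"
proof -
  have "cnt u n x \<le> card {1..n}"
    unfolding cnt_def by (rule card_mono) auto
  then show ?thesis by simp
qed

lemma cnt_Suc: "cnt u (Suc n) x = cnt u n x + (if u (Suc n) \<le> x then 1 else 0)"
proof -
  have "{j \<in> {1..Suc n}. u j \<le> x} = {j \<in> {1..n}. u j \<le> x} \<union> (if u (Suc n) \<le> x then {Suc n} else {})"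
    by (auto simp: le_Suc_eq)
  then show ?thesis
    unfolding cnt_def by (simp add: card_insert_if)
qed

lemma cnt_0 [simp]: "cnt u 0 x = 0"
  by (simp add: cnt_def)

lemma cnt_strict:
  assumes "x < u j" "u j \<le> y" "j \<in> {1..n}"
  shows "cnt u n x < cnt u n y"
proof -
  have "j \<notin> {j \<in> {1..n}. u j \<le> x}" "j \<in> {j \<in> {1..n}. u j \<le> y}"
    "{j \<in> {1..n}. u j \<le> x} \<subseteq> {j \<in> {1..n}. u j \<le> y}"
    using assms by auto
  then have "{j \<in> {1..n}. u j \<le> x} \<subset> {j \<in> {1..n}. u j \<le> y}" by blast
  then show ?thesis
    unfolding cnt_def by (intro psubset_card_mono) auto
qed

text \<open>No point with index up to \<open>m\<close> separates \<open>v\<close> from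
  \<open>w\<close>, so none with index up to \<open>n\<close> does.\<close>

lemma cnt_eq_restrict:
  assumes "cnt u m v = cnt u m w" "n \<le> m"
  shows "cnt u n v = cnt u n w"
proof -
  have *: "cnt u n v = cnt u n w" if "v \<le> w" "cnt u m v = cnt u m w" for v w
  proof (rule ccontr)
    assume "cnt u n v \<noteq> cnt u n w"
    then have "{j \<in> {1..n}. u j \<le> v} \<noteq> {j \<in> {1..n}. u j \<le> w}"
      unfolding cnt_def by metis
    then obtain j where "j \<in> {1..n}" "v < u j" "u j \<le> w"
      using \<open>v \<le> w\<close> by force
    then have "cnt u m v < cnt u m w"
      using \<open>n \<le> m\<close> by (intro cnt_strict[where j=j]) auto
    with that show False by simp
  qed
  show ?thesis
    by (metis * assms(1) linear)
qed

lemma squeeze_mono: "c \<le> d \<Longrightarrow> squeeze k c \<le> squeeze k d"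
  by (auto simp: squeeze_def)

lemma eraser_of_U_eq: "eraser_of_U u n = cnt u (Suc n) (u (Suc n))"
  by (simp add: eraser_of_U_def cnt_def)

lemma eraser_of_U_range: "eraser_of_U u n \<in> {1..Suc n}"
proof -
  have "Suc n \<in> {j \<in> {1..Suc n}. u j \<le> u (Suc n)}" by auto
  then have "cnt u (Suc n) (u (Suc n)) > 0"
    unfolding cnt_def card_gt_0_iff by auto
  then show ?thesis
    using cnt_le[of u "Suc n" "u (Suc n)"] by (simp add: eraser_of_U_eq)
qed

text \<open>\<open>eraser_of_U u n\<close> is the rank of point \<open>n + 1\<close> among the first
  \<open>n + 1\<close>. The count at \<open>x\<close> reaches this rank exactly when that point does
  not exceed \<open>x\<close>, and then it loses one on removal.\<close>

lemma cnt_squeeze: "cnt u n x = squeeze (eraser_of_U u n) (cnt u (Suc n) x)"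
proof (cases "u (Suc n) \<le> x")
  case True
  then have "eraser_of_U u n \<le> cnt u (Suc n) x"
    by (simp add: eraser_of_U_eq cnt_mono)
  then show ?thesis using True by (simp add: squeeze_def cnt_Suc)
next
  case False
  then have "cnt u (Suc n) x < eraser_of_U u n"
    unfolding eraser_of_U_eq by (intro cnt_strict[where j="Suc n"]) auto
  then show ?thesis using False by (simp add: squeeze_def cnt_Suc)
qed

lemma atLeastAtMost_Suc_eq_iff:
  assumes "c < d" "{Suc c..d} = {Suc c'..d'}"
  shows "c' = c" "d' = d"
  using assms by (auto simp: Icc_eq_Icc)

lemma interval_erase_squeeze:
  assumes "1 \<le> k" "c < d"
  shows "interval_erase (Suc c) d k = {Suc (squeeze k c)..squeeze k d}"
  using assms by (auto simp: interval_erase_def squeeze_def)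

text \<open>The cuts \<open>c\<close> and \<open>d\<close> range over all naturals. Pairs with
  \<open>d \<le> c\<close> encode the empty set, and their images stay empty because
  \<open>squeeze\<close> is monotone; the interval consisting of \<open>k\<close> alone collapses to
  the empty set by the same formula.\<close>

lemma phi_cut:
  assumes k: "1 \<le> k" and I: "{} \<in> I"
  shows "phi I k = {{Suc (squeeze k c)..squeeze k d} | c d. {Suc c..d} \<in> I}"
proof (intro set_eqI iffI)
  fix A assume "A \<in> phi I k"
  then consider a b where "A = interval_erase a b k" "1 \<le> a" "a \<le> b" "{a..b} \<in> I" | "A = {}"
    by (auto simp: phi_def)
  then show "A \<in> {{Suc (squeeze k c)..squeeze k d} | c d. {Suc c..d} \<in> I}"
  proof cases
    case 1
    then obtain c where "a = Suc c" by (cases a) auto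
    then show ?thesis using 1 interval_erase_squeeze[OF k, of c b] by auto
  next
    case 2
    have "{Suc 0..0} \<in> I" "A = {Suc (squeeze k 0)..squeeze k 0}" using I 2 by auto
    then show ?thesis by blast
  qed
next
  fix A assume "A \<in> {{Suc (squeeze k c)..squeeze k d} | c d. {Suc c..d} \<in> I}"
  then obtain c d where A: "A = {Suc (squeeze k c)..squeeze k d}" "{Suc c..d} \<in> I" by auto
  show "A \<in> phi I k"
  proof (cases "c < d")
    case True
    then have "A = interval_erase (Suc c) d k" "1 \<le> Suc c" "Suc c \<le> d"
      using A interval_erase_squeeze[OF k True] by auto
    then show ?thesis using A(2) unfolding phi_def by blast
  next
    case False
    then have "squeeze k d \<le> squeeze k c" by (intro squeeze_mono) simp
    then show ?thesis using A by (simp add: phi_def)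
  qed
qed

section \<open>Order statistics\<close>

text \<open>In a sorted list the elements up to \<open>x\<close> form an initial segment, whose
  length the filter measures.\<close>

lemma sorted_nth_le_iff:
  fixes xs :: "real list"
  assumes "sorted xs" "k < length xs"
  shows "xs ! k \<le> x \<longleftrightarrow> k < length (filter (\<lambda>t. t \<le> x) xs)"
  using assms
proof (induction xs arbitrary: k)
  case Nil
  then show ?case by simp
next
  case (Cons y ys)
  show ?case
  proof (cases "y \<le> x")
    case True
    then show ?thesis using Cons by (cases k) auto
  next
    case False
    then have "filter (\<lambda>t. t \<le> x) ys = []"
      using Cons.prems by (fastforce simp: filter_empty_conv)
    moreover have "\<not> (y # ys) ! k \<le> x"
      using Cons.prems False by (cases k) (force dest: nth_mem)+
    ultimately show ?thesis using False by simp
  qed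
qed

text \<open>The Galois connection between order statistics and the counting function; most later
  facts on order statistics rest on it.\<close>

lemma order_stat_le_iff:
  assumes "i \<in> {1..n}"
  shows "order_stat u n i \<le> x \<longleftrightarrow> i \<le> cnt u n x"
proof -
  have "length (filter (\<lambda>t. t \<le> x) (map u [1..<Suc n])) = cnt u n x"
    by (induction n) (auto simp: cnt_Suc)
  then show ?thesis
    using assms sorted_nth_le_iff[of "sort (map u [1..<Suc n])" "i - 1" x]
    unfolding order_stat_def by (simp add: filter_sort del: upt_Suc) linarith
qed

lemma order_stat_in:
  assumes "i \<in> {1..n}"
  shows "order_stat u n i \<in> u ` {1..n}"
proof -
  have "order_stat u n i \<in> set (sort (map u [1..<Suc n]))"
    unfolding order_stat_def by (rule nth_mem) (use assms in auto)
  then show ?thesis by (auto simp del: upt_Suc)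
qed

abbreviation opad :: "(nat \<Rightarrow> real) \<Rightarrow> nat \<Rightarrow> nat \<Rightarrow> real" where
  "opad u n \<equiv> pad n (order_stat u n)"

text \<open>The cells between consecutive order statistics are closed on the left and open on the
  right, and the count is the label of the cell. The paddings -1 and 2 bound the outermost cells
  since \<open>x\<close> lies in [0,1].\<close>

lemma cnt_in_cell:
  assumes "0 \<le> x" "x \<le> 1" 
  shows "opad u n (cnt u n x) \<le> x" "x < opad u n (Suc (cnt u n x))"
proof -
  show "opad u n (cnt u n x) \<le> x"
  proof (cases "cnt u n x = 0")
    case True
    then show ?thesis using assms by (simp add: pad_def)
  next
    case False
    then have "cnt u n x \<in> {1..n}" using cnt_le[of u n x] by simp
    then show ?thesis using order_stat_le_iff[of "cnt u n x" n u x] by (simp add: pad_def)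
  qed
  show "x < opad u n (Suc (cnt u n x))"
  proof (cases "cnt u n x = n")
    case True
    then show ?thesis using assms by (simp add: pad_def)
  next
    case False
    then have "Suc (cnt u n x) \<in> {1..n}" using cnt_le[of u n x] by simp
    then show ?thesis using order_stat_le_iff[of "Suc (cnt u n x)" n u x] by (simp add: pad_def)
  qed
qed

text \<open>A sample point can only be the left end of its half-open cell, so strictness on the left
  says exactly that \<open>x\<close> is not a sample point.\<close>

lemma cell_iff:
  assumes x: "0 \<le> x" "x \<le> 1" and c: "c \<le> n"
  shows "opad u n c < x \<and> x < opad u n (Suc c) \<longleftrightarrow> cnt u n x = c \<and> x \<notin> u ` {1..n}"
proof
  assume *: "opad u n c < x \<and> x < opad u n (Suc c)"
  have "c \<le> cnt u n x"
    using * c order_stat_le_iff[of c n u x] by (cases "c = 0") (auto simp: pad_def)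
  moreover have "\<not> Suc c \<le> cnt u n x"
    using * c order_stat_le_iff[of "Suc c" n u x] cnt_le[of u n x] by (cases "c = n") (auto simp: pad_def)
  ultimately have eq: "cnt u n x = c" by simp
  have "x \<notin> u ` {1..n}"
  proof
    assume "x \<in> u ` {1..n}"
    then obtain j where j: "j \<in> {1..n}" "x = u j" by auto
    have "cnt u n (opad u n c) < cnt u n x"
      using * j by (intro cnt_strict[where j=j]) auto
    then have "0 < c" and lt: "cnt u n (opad u n c) < c" using eq by auto
    then have "opad u n c = order_stat u n c" using c by (simp add: pad_def)
    then show False
      using order_stat_le_iff[of c n u "opad u n c"] c lt \<open>0 < c\<close> by simp
  qed
  with eq show "cnt u n x = c \<and> x \<notin> u ` {1..n}" by simp
next
  assume *: "cnt u n x = c \<and> x \<notin> u ` {1..n}"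
  then have "opad u n c \<le> x" "x < opad u n (Suc c)"
    using cnt_in_cell[OF x, where u=u and n=n] by auto
  moreover have "opad u n c \<noteq> x"
    using * c order_stat_in[of c n u] x by (cases "c = 0") (auto simp: pad_def)
  ultimately show "opad u n c < x \<and> x < opad u n (Suc c)" by simp
qed

lemma opad_mono:
  assumes "1 \<le> a" "a \<le> b" "b \<le> n"
  shows "opad u n a \<le> opad u n b"
  using assms order_stat_le_iff[of a n u "order_stat u n b"] order_stat_le_iff[of b n u "order_stat u n b"]
  by (auto simp: pad_def)

lemma InSy_infD:
  assumes "K \<in> InSy_inf" "(x, y) \<in> K"
  shows "0 \<le> x" "x \<le> y" "y \<le> 1"
  using assms by (auto simp: InSy_inf_def)

text \<open>Both coordinates of a point of \<open>K\<close> are read through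
  \<open>cell_iff\<close>. Points whose counts differ by at most one only produce the empty set or a
  singleton, which both sides contain anyway. In this form the dependence on \<open>u\<close> is
  through counts and the set of points alone, hence symmetric in the first \<open>n\<close>
  points.\<close>

lemma phi_inf_cut:
  assumes K: "K \<in> InSy_inf"
  shows "phi_inf n K (order_stat u n) = {{}} \<union> {{j} | j. j \<in> {1..n}} \<union>
    {{Suc (cnt u n x)..cnt u n y} | x y. (x, y) \<in> K \<and> x \<notin> u ` {1..n} \<and> y \<notin> u ` {1..n}}"
    (is "?L = {{}} \<union> ?S \<union> ?C")
proof (intro set_eqI iffI)
  fix A assume "A \<in> ?L"
  then consider "A \<in> {{}} \<union> ?S" | a b x y where "A = {a..b}" "1 \<le> a" "a < b" "b \<le> n" "(x,y) \<in> K"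
    "opad u n (a - 1) < x" "x < opad u n a" "opad u n b < y" "y < opad u n (b + 1)"
    by (auto simp: phi_inf_def)
  then show "A \<in> {{}} \<union> ?S \<union> ?C"
  proof cases
    case 1
    then show ?thesis by blast
  next
    case 2
    then obtain c where a: "a = Suc c" by (cases a) auto
    have "cnt u n x = c \<and> x \<notin> u ` {1..n}" "cnt u n y = b \<and> y \<notin> u ` {1..n}"
      using 2 a InSy_infD[OF K \<open>(x,y) \<in> K\<close>] cell_iff[of x c n u] cell_iff[of y b n u] by auto
    then show ?thesis using 2 a by blast
  qed
next
  fix A assume "A \<in> {{}} \<union> ?S \<union> ?C"
  then consider "A \<in> {{}} \<union> ?S" | x y where "A = {Suc (cnt u n x)..cnt u n y}" "(x,y) \<in> K" "x \<notin> u ` {1..n}" "y \<notin> u ` {1..n}"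
    by blast
  then show "A \<in> ?L"
  proof cases
    case 1
    then show ?thesis by (auto simp: phi_inf_def)
  next
    case 2
    let ?a = "Suc (cnt u n x)" and ?b = "cnt u n y"
    have xy: "0 \<le> x" "x \<le> 1" "0 \<le> y" "y \<le> 1" using InSy_infD[OF K 2(2)] by auto
    consider "?a < ?b" | "?a = ?b" | "?b < ?a" by linarith
    then show ?thesis
    proof cases
      case 1
      have "opad u n (?a - 1) < x \<and> x < opad u n ?a" "opad u n ?b < y \<and> y < opad u n (?b + 1)"
        using cell_iff[OF xy(1,2) cnt_le[of u n x], of u] cell_iff[OF xy(3,4) cnt_le[of u n y], of u] 2 by auto
      moreover have "opad u n ?a \<le> opad u n ?b"
        by (rule opad_mono) (use 1 cnt_le[of u n y] in auto)
      ultimately have "\<exists>a b. A = {a..b} \<and> 1 \<le> a \<and> a < b \<and> b \<le> n \<and>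
        (\<exists>(x, y)\<in>K. opad u n (a - 1) < x \<and> x < opad u n a \<and> opad u n a \<le> opad u n b \<and>
                    opad u n b < y \<and> y < opad u n (b + 1))"
        using 1 2(1,2) cnt_le[of u n y] by (intro exI[of _ ?a] exI[of _ ?b] conjI bexI[of _ "(x, y)"]) auto
      then show ?thesis unfolding phi_inf_def by blast
    next
      case c2: 2
      then have "A = {?b}" "?b \<in> {1..n}" using 2(1) cnt_le[of u n y] by auto
      then show ?thesis by (auto simp: phi_inf_def)
    next
      case 3
      then show ?thesis using 2(1) by (auto simp: phi_inf_def)
    qed
  qed
qed

lemma phi_inf_in_InSy:
  "phi_inf n K v \<in> InSy n"
proof -
  have "\<exists>a b. 1 \<le> a \<and> a \<le> b \<and> b \<le> n \<and> A = {a..b}" if A: "A \<in> phi_inf n K v" "A \<noteq> {}" for A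
  proof -
    consider j where "j \<in> {1..n}" "A = {j}" | a b where "A = {a..b}" "1 \<le> a" "a < b" "b \<le> n"
      using A unfolding phi_inf_def by blast
    then show ?thesis
    proof cases
      case 1
      then have "1 \<le> j \<and> j \<le> j \<and> j \<le> n \<and> A = {j..j}" by simp
      then show ?thesis by blast
    next
      case 2
      then show ?thesis using less_imp_le by blast
    qed
  qed
  moreover have "{} \<in> phi_inf n K v" "\<forall>j\<in>{1..n}. {j} \<in> phi_inf n K v" by (auto simp: phi_inf_def)
  ultimately show ?thesis unfolding InSy_def by blast
qed

lemma InSyD_cut:
  assumes "I \<in> InSy n" "A \<in> I"
  obtains c d where "A = {Suc c..d}" "c \<le> d" "d \<le> n" "A \<noteq> {} \<Longrightarrow> c < d"
proof (cases "A = {}")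
  case True
  then show ?thesis by (intro that[of 0 0]) auto
next
  case False
  then obtain a b where ab: "1 \<le> a" "a \<le> b" "b \<le> n" "A = {a..b}" using assms by (auto simp: InSy_def)
  then show ?thesis by (intro that[of "a - 1" b]) auto
qed

lemma InSy_empty: "I \<in> InSy n \<Longrightarrow> {} \<in> I"
  and InSy_single: "I \<in> InSy n \<Longrightarrow> j \<in> {1..n} \<Longrightarrow> {j} \<in> I"
  by (auto simp: InSy_def)

lemma InSy_cut_le:
  assumes "I \<in> InSy n" "{Suc c..d} \<in> I" "c < d"
  shows "d \<le> n"
proof -
  obtain c' d' where "{Suc c..d} = {Suc c'..d'}" "d' \<le> n" using InSyD_cut[OF assms(1,2)] by metis
  then show ?thesis using atLeastAtMost_Suc_eq_iff[OF assms(3)] by metis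
qed

section \<open>Typical points\<close>

text \<open>For positive \<open>n\<close>, the Kolmogorov distance between the empirical
  distribution of the first \<open>n\<close> points and the uniform law is at most
  \<open>e\<close>.\<close>

definition disc :: "(nat \<Rightarrow> real) \<Rightarrow> nat \<Rightarrow> real \<Rightarrow> bool" where
  "disc u n e \<longleftrightarrow> (\<forall>x\<in>{0..1}. \<bar>real (cnt u n x) / real n - x\<bar> \<le> e)"

definition generic :: "(nat \<Rightarrow> real) \<Rightarrow> bool" where
  "generic u \<longleftrightarrow> inj_on u {1..} \<and> (\<forall>i\<ge>1. 0 < u i \<and> u i < 1)"

text \<open>Uniform convergence of the empirical distribution functions, as in the Glivenko-Cantelli
  theorem, along a sequence without ties.\<close>

definition nice :: "(nat \<Rightarrow> real) \<Rightarrow> bool" where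
  "nice u \<longleftrightarrow> generic u \<and> (\<forall>e>0. \<exists>N. \<forall>n\<ge>N. disc u n e)"

text \<open>The values \<open>-1\<close> and \<open>2\<close> stand for a missing left or right neighbour, as in \<^const>\<open>pad\<close>.\<close>

definition good :: "(real \<times> real) set \<Rightarrow> (nat \<Rightarrow> real) \<Rightarrow> bool" where
  "good K u \<longleftrightarrow> (\<forall>\<alpha>\<in>insert (-1) (u ` {1..}). \<forall>\<beta>\<in>u ` {1..}. \<forall>\<gamma>\<in>u ` {1..}. \<forall>\<delta>\<in>insert 2 (u ` {1..}).
     \<alpha> < \<beta> \<and> \<beta> < \<gamma> \<and> \<gamma> < \<delta> \<and> (\<exists>(x, y)\<in>K. \<alpha> \<le> x \<and> x \<le> \<beta> \<and> \<gamma> \<le> y \<and> y \<le> \<delta>) \<longrightarrow>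
     (\<exists>(x, y)\<in>K. \<alpha> < x \<and> x < \<beta> \<and> \<gamma> < y \<and> y < \<delta>))"

lemma cnt_order_stat:
  assumes u: "generic u" and i: "i \<in> {1..n}"
  shows "cnt u n (order_stat u n i) = i"
proof -
  have *: "inj_on u {1..n}" using u by (auto simp: generic_def intro: inj_on_subset)
  let ?s = "order_stat u n i"
  obtain j where j: "j \<in> {1..n}" "?s = u j" using order_stat_in[OF i, of u] by (auto simp: image_iff)
  have "i \<le> cnt u n ?s" using order_stat_le_iff[OF i, of u ?s] by simp
  \<comment> \<open>If the count were larger, at least \<open>i\<close> points would lie strictly
    below \<open>?s\<close>. The largest of them, \<open>?t\<close>, would then have a count of at
    least \<open>i\<close>, so the Galois connection would give \<open>?s \<le> ?t\<close>.\<close>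
  moreover have "\<not> Suc i \<le> cnt u n ?s"
  proof
    assume "Suc i \<le> cnt u n ?s"
    then have "Suc i \<le> card ({l \<in> {1..n}. u l \<le> ?s})" by (simp add: cnt_def)
    also have "{l \<in> {1..n}. u l \<le> ?s} = insert j {l \<in> {1..n}. u l < ?s}"
      using j * by (auto simp: less_le inj_on_eq_iff)
    also have "card \<dots> = Suc (card {l \<in> {1..n}. u l < ?s})"
      using j by (intro card_insert_disjoint) auto
    finally have le: "i \<le> card {l \<in> {1..n}. u l < ?s}" by simp
    define S where "S = {l \<in> {1..n}. u l < ?s}"
    have S: "finite S" "i \<le> card S" using le by (auto simp: S_def)
    then have ne: "S \<noteq> {}" using i by auto
    let ?t = "Max (u ` S)"
    have "?t \<in> u ` S" using ne S by (intro Max_in) auto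
    then have "?t < ?s" by (auto simp: S_def)
    moreover have "S \<subseteq> {l \<in> {1..n}. u l \<le> ?t}" using S by (auto simp: S_def)
    then have "card S \<le> cnt u n ?t" unfolding cnt_def by (intro card_mono) auto
    then have "i \<le> cnt u n ?t" using S by simp
    then have "?s \<le> ?t" using order_stat_le_iff[OF i] by blast
    ultimately show False by simp
  qed
  ultimately show ?thesis by simp
qed

lemma cnt_surj:
  assumes u: "generic u" and "z \<le> n"
  obtains v where "0 \<le> v" "v \<le> 1" "cnt u n v = z"
proof (cases "z = 0")
  case True
  have "{j \<in> {1..n}. u j \<le> 0} = {}" using u by (force simp: generic_def)
  then show ?thesis using True that[of 0] by (auto simp: cnt_def)
next
  case False
  then have z: "z \<in> {1..n}" using assms by auto
  then obtain j where "j \<in> {1..n}" "order_stat u n z = u j" using order_stat_in[OF z, of u] by (auto simp: image_iff)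
  then show ?thesis using cnt_order_stat[OF u z] u that[of "order_stat u n z"] by (force simp: generic_def)
qed

lemma opad_strict:
  assumes u: "generic u" and "a < b" "b \<le> Suc n"
  shows "opad u n a < opad u n b"
proof -
  have rng: "0 < order_stat u n i \<and> order_stat u n i < 1" if "i \<in> {1..n}" for i
    using order_stat_in[OF that, of u] u by (auto simp: generic_def)
  show ?thesis
  proof (cases "1 \<le> a \<and> b \<le> n")
    case True
    then have "\<not> order_stat u n b \<le> order_stat u n a"
      using assms order_stat_le_iff[of b n u "order_stat u n a"] cnt_order_stat[OF u, of a n] by auto
    then show ?thesis using True assms by (auto simp: pad_def)
  next
    case False
    then show ?thesis using assms rng[of a] rng[of b] by (auto simp: pad_def)
  qed
qed

text \<open>Goodness turns a hit of the closed cell into a hit of the open one. It asks for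
  \<open>\<beta> < \<gamma>\<close>, which fails when \<open>d = Suc c\<close>; in that case the
  interval is a singleton and belongs to the system by definition.\<close>

lemma phi_inf_good:
  assumes K: "K \<in> InSy_inf" and u: "generic u" and g: "good K u" and xy: "(x, y) \<in> K"
    and c: "opad u n c \<le> x" "x \<le> opad u n (Suc c)" and d: "opad u n d \<le> y" "y \<le> opad u n (Suc d)"
    and cd: "c < d" "d \<le> n"
  shows "{Suc c..d} \<in> phi_inf n K (order_stat u n)"
proof (cases "Suc c < d")
  case False
  then have "{Suc c..d} = {d}" "d \<in> {1..n}" using cd by auto
  then show ?thesis by (auto simp: phi_inf_def)
next
  case True
  have mem: "opad u n i \<in> u ` {1..}" if "i \<in> {1..n}" for i
    using order_stat_in[OF that, of u] that by (auto simp: pad_def)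
  have 1: "opad u n c \<in> insert (-1) (u ` {1..})"
    using mem[of c] cd by (cases "c = 0") (auto simp: pad_def)
  have 2: "opad u n (Suc d) \<in> insert 2 (u ` {1..})"
    using mem[of "Suc d"] cd by (cases "d = n") (auto simp: pad_def)
  have st: "opad u n c < opad u n (Suc c)" "opad u n (Suc c) < opad u n d" "opad u n d < opad u n (Suc d)"
    using opad_strict[OF u] True cd by auto
  have ex: "\<exists>(x, y)\<in>K. opad u n c \<le> x \<and> x \<le> opad u n (Suc c) \<and> opad u n d \<le> y \<and> y \<le> opad u n (Suc d)"
    using xy c d by blast
  have "\<exists>(x, y)\<in>K. opad u n c < x \<and> x < opad u n (Suc c) \<and> opad u n d < y \<and> y < opad u n (Suc d)"
    using g[unfolded good_def, rule_format, OF 1 mem[of "Suc c"] mem[of d] 2] ex st True cd by simp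
  then have "\<exists>a b. {Suc c..d} = {a..b} \<and> 1 \<le> a \<and> a < b \<and> b \<le> n \<and>
        (\<exists>(x, y)\<in>K. opad u n (a - 1) < x \<and> x < opad u n a \<and> opad u n a \<le> opad u n b \<and>
                    opad u n b < y \<and> y < opad u n (b + 1))"
    using True cd less_imp_le[OF st(2)] by (intro exI[of _ "Suc c"] exI[of _ d]) auto
  then show ?thesis unfolding phi_inf_def by blast
qed

text \<open>A point of \<open>K\<close> with a coordinate on a sample point is invisible to the
  strict inequalities of \<open>phi_inf\<close>. It still lies in a closed cell, so goodness makes
  its interval present.\<close>

lemma phi_inf_good_cnt:
  assumes K: "K \<in> InSy_inf" and u: "generic u" and g: "good K u" and xy: "(x, y) \<in> K"
  shows "{Suc (cnt u n x)..cnt u n y} \<in> phi_inf n K (order_stat u n)"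
proof (cases "cnt u n x < cnt u n y")
  case True
  have "0 \<le> x" "x \<le> 1" "0 \<le> y" "y \<le> 1" using InSy_infD[OF K xy] by auto
  then show ?thesis
    using cnt_in_cell[of x n u] cnt_in_cell[of y n u] True cnt_le
    by (intro phi_inf_good[OF K u g xy]) auto
next
  case False
  then show ?thesis by (auto simp: phi_inf_def)
qed

text \<open>From left to right, a coordinate that avoids the first \<open>n + 1\<close> points
  avoids the first \<open>n\<close>. From right to left, a coordinate may avoid the first
  \<open>n\<close> points and coincide with \<open>u (Suc n)\<close>; goodness still supplies the
  interval at level \<open>n + 1\<close>.\<close>

lemma phi_phi_inf:
  assumes K: "K \<in> InSy_inf" and u: "generic u" and g: "good K u"
  shows "phi (phi_inf (Suc n) K (order_stat u (Suc n))) (eraser_of_U u n) = phi_inf n K (order_stat u n)"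
proof -
  let ?k = "eraser_of_U u n"
  let ?P = "phi_inf (Suc n) K (order_stat u (Suc n))" and ?Q = "phi_inf n K (order_stat u n)"
  have k: "1 \<le> ?k" "?k \<le> Suc n" using eraser_of_U_range[of u n] by auto
  have P: "?P \<in> InSy (Suc n)" and Q: "?Q \<in> InSy n" by (rule phi_inf_in_InSy)+
  have eq: "phi ?P ?k = {{Suc (squeeze ?k c)..squeeze ?k d} | c d. {Suc c..d} \<in> ?P}"
    by (rule phi_cut[OF k(1) InSy_empty[OF P]])
  show ?thesis
  proof (intro set_eqI iffI)
    fix A assume "A \<in> phi ?P ?k"
    then obtain c d where A: "A = {Suc (squeeze ?k c)..squeeze ?k d}" "{Suc c..d} \<in> ?P" unfolding eq by auto
    show "A \<in> ?Q"
    proof (cases "c < d")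
      case False
      then have "squeeze ?k d \<le> squeeze ?k c" by (intro squeeze_mono) simp
      then show ?thesis using A InSy_empty[OF Q] by simp
    next
      case True
      have "{Suc c..d} \<noteq> {}" using True by simp
      then consider j where "{Suc c..d} = {j}" "j \<in> {1..Suc n}" | x y where "{Suc c..d} = {Suc (cnt u (Suc n) x)..cnt u (Suc n) y}"
          "(x,y) \<in> K" "x \<notin> u ` {1..Suc n}" "y \<notin> u ` {1..Suc n}"
        using A(2) unfolding phi_inf_cut[OF K] by blast
      then show ?thesis
      proof cases
        case 1
        then have "d = j" "Suc c = j" using True by (metis atLeastatMost_empty_iff2 less_eq_Suc_le singletonD atLeastAtMost_iff order_refl)+
        then have "A = {} \<or> (\<exists>i\<in>{1..n}. A = {i})"
          using A 1 k by (auto simp: squeeze_def)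
        then show ?thesis using InSy_empty[OF Q] InSy_single[OF Q] by auto
      next
        case 2
        then have "A = {Suc (cnt u n x)..cnt u n y}"
          using A atLeastAtMost_Suc_eq_iff[OF True 2(1)] cnt_squeeze[of u n x] cnt_squeeze[of u n y] by simp
        moreover have "x \<notin> u ` {1..n}" "y \<notin> u ` {1..n}" using 2 by auto
        ultimately show ?thesis using 2(2) unfolding phi_inf_cut[OF K] by blast
      qed
    qed
  next
    fix A assume "A \<in> ?Q"
    then consider "A = {}" | j where "j \<in> {1..n}" "A = {j}" | x y where "A = {Suc (cnt u n x)..cnt u n y}" "(x,y) \<in> K"
      unfolding phi_inf_cut[OF K] by blast
    then show "A \<in> phi ?P ?k"
    proof cases
      case 1
      then show ?thesis by (simp add: phi_def)
    next
      case 2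
      show ?thesis
      proof (cases "?k \<le> j")
        \<comment> \<open>The point with label \<open>j\<close> at level \<open>n\<close> had label
          \<open>j + 1\<close> before the erasure if the erased label was at most
          \<open>j\<close>.\<close>
        case True
        have "A = {Suc (squeeze ?k j)..squeeze ?k (Suc j)}" using True 2 k by (auto simp: squeeze_def)
        moreover have "{Suc j..Suc j} \<in> ?P" using InSy_single[OF P, of "Suc j"] 2 by simp
        ultimately show ?thesis unfolding eq by blast
      next
        case False
        have "A = {Suc (squeeze ?k (j - 1))..squeeze ?k j}" using False 2 by (auto simp: squeeze_def)
        moreover have "{Suc (j - 1)..j} \<in> ?P" using InSy_single[OF P, of "j"] 2 by simp
        ultimately show ?thesis unfolding eq by blast
      qed
    next
      case 3
      have "{Suc (cnt u (Suc n) x)..cnt u (Suc n) y} \<in> ?P" by (rule phi_inf_good_cnt[OF K u g 3(2)])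
      then show ?thesis unfolding eq using 3 cnt_squeeze[of u n x] cnt_squeeze[of u n y] by auto
    qed
  qed
qed

section \<open>Rescaled interval systems\<close>

text \<open>One path of an erased-interval process whose erasers are the relative ranks of
  \<open>u\<close>.\<close>

definition eraser_chain :: "(nat \<Rightarrow> real) \<Rightarrow> (nat \<Rightarrow> nat set set) \<Rightarrow> bool" where
  "eraser_chain u J \<longleftrightarrow> (\<forall>n\<ge>1. J n \<in> InSy n \<and> J n = phi (J (Suc n)) (eraser_of_U u n))"

lemma eraser_chainD:
  assumes "eraser_chain u J" "1 \<le> n"
  shows "J n \<in> InSy n" "J n = phi (J (Suc n)) (eraser_of_U u n)"
  using assms unfolding eraser_chain_def by blast+

text \<open>A pair of cuts at level \<open>m\<close> is represented by a pair of reals, and the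
  counts of the same reals give its image at level \<open>n\<close>. The intermediate erasures are
  absorbed one at a time, by induction on \<open>m\<close>.\<close>

lemma chain_cut:
  assumes u: "generic u" and J: "eraser_chain u J" and nm: "1 \<le> n" "n \<le> m"
  shows "J n = {{Suc (cnt u n v)..cnt u n w} | v w. v \<in> {0..1} \<and> w \<in> {0..1} \<and>
    {Suc (cnt u m v)..cnt u m w} \<in> J m}"
  using nm(2)
proof (induction m rule: dec_induct)
  case base
  have Jn: "J n \<in> InSy n" by (rule eraser_chainD(1)[OF J nm(1)])
  show ?case
  proof (intro set_eqI iffI)
    fix A assume A: "A \<in> J n"
    obtain c d where cd: "A = {Suc c..d}" "c \<le> d" "d \<le> n" using InSyD_cut[OF Jn A] by metis
    obtain v where v: "0 \<le> v" "v \<le> 1" "cnt u n v = c" using cnt_surj[OF u, of c n] cd by auto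
    obtain w where w: "0 \<le> w" "w \<le> 1" "cnt u n w = d" using cnt_surj[OF u, of d n] cd by auto
    show "A \<in> {{Suc (cnt u n v)..cnt u n w} | v w. v \<in> {0..1} \<and> w \<in> {0..1} \<and>
      {Suc (cnt u n v)..cnt u n w} \<in> J n}"
      using A cd(1) v w by (intro CollectI exI[of _ v] exI[of _ w]) auto
  qed blast
next
  case (step m)
  let ?k = "eraser_of_U u m"
  have JS: "J (Suc m) \<in> InSy (Suc m)" and Jm: "J m = phi (J (Suc m)) ?k"
    using eraser_chainD(1)[OF J, of "Suc m"] eraser_chainD(2)[OF J, of m] step.hyps nm by auto
  have eq: "J m = {{Suc (squeeze ?k c)..squeeze ?k d} | c d. {Suc c..d} \<in> J (Suc m)}"
    unfolding Jm using eraser_of_U_range[of u m] by (intro phi_cut InSy_empty[OF JS]) auto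
  show ?case
  proof (intro set_eqI iffI)
    fix A assume "A \<in> J n"
    then obtain v w where A: "A = {Suc (cnt u n v)..cnt u n w}" "v \<in> {0..1}" "w \<in> {0..1}"
      and vw: "{Suc (cnt u m v)..cnt u m w} \<in> J m"
      unfolding step.IH by auto
    show "A \<in> {{Suc (cnt u n v)..cnt u n w} | v w. v \<in> {0..1} \<and> w \<in> {0..1} \<and>
      {Suc (cnt u (Suc m) v)..cnt u (Suc m) w} \<in> J (Suc m)}"
    proof (cases "cnt u m v < cnt u m w")
      case True
      obtain c d where cd: "{Suc (cnt u m v)..cnt u m w} = {Suc (squeeze ?k c)..squeeze ?k d}"
        "{Suc c..d} \<in> J (Suc m)" using vw unfolding eq by auto
      have sq: "squeeze ?k c = cnt u m v" "squeeze ?k d = cnt u m w"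
        using atLeastAtMost_Suc_eq_iff[OF True cd(1)] by auto
      then have "c < d" using True squeeze_mono[of d c ?k] by (cases "c < d") auto
      then have "d \<le> Suc m" "c \<le> Suc m" using InSy_cut_le[OF JS cd(2)] by auto
      then obtain v' w' where v: "v' \<in> {0..1}" "cnt u (Suc m) v' = c" and w: "w' \<in> {0..1}" "cnt u (Suc m) w' = d"
        using cnt_surj[OF u, of c "Suc m"] cnt_surj[OF u, of d "Suc m"] by (metis atLeastAtMost_iff)
      \<comment> \<open>The new representatives are chosen for their counts at level
        \<open>m + 1\<close>. They share the counts of \<open>v\<close> and \<open>w\<close> at
        level \<open>m\<close>, hence also at level \<open>n\<close>.\<close>
      have "cnt u m v' = cnt u m v" "cnt u m w' = cnt u m w"
        using cnt_squeeze[of u m v'] cnt_squeeze[of u m w'] v w sq by auto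
      then have "cnt u n v' = cnt u n v" "cnt u n w' = cnt u n w"
        using cnt_eq_restrict step.hyps by blast+
      then show ?thesis using A(1) cd(2) v w by (intro CollectI exI[of _ v'] exI[of _ w']) auto
    next
      case False
      have "cnt u n w \<le> cnt u n v"
      proof (cases "v \<le> w")
        case True
        then have "cnt u m v = cnt u m w" using False cnt_mono[of v w u m] by linarith
        then show ?thesis using cnt_eq_restrict[of u m v w n] step.hyps by simp
      next
        case False
        then show ?thesis by (intro cnt_mono) simp
      qed
      then have "A = {}" using A by simp
      moreover have "{Suc (cnt u (Suc m) 0)..cnt u (Suc m) 0} \<in> J (Suc m)" using InSy_empty[OF JS] by simp
      ultimately show ?thesis by (intro CollectI exI[of _ 0]) auto
    qed
  next
    fix A assume "A \<in> {{Suc (cnt u n v)..cnt u n w} | v w. v \<in> {0..1} \<and> w \<in> {0..1} \<and>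
      {Suc (cnt u (Suc m) v)..cnt u (Suc m) w} \<in> J (Suc m)}"
    then obtain v w where A: "A = {Suc (cnt u n v)..cnt u n w}" "v \<in> {0..1}" "w \<in> {0..1}"
      and vw: "{Suc (cnt u (Suc m) v)..cnt u (Suc m) w} \<in> J (Suc m)" by auto
    have "{Suc (cnt u m v)..cnt u m w} \<in> J m"
      unfolding eq using vw cnt_squeeze[of u m v] cnt_squeeze[of u m w] by auto
    then show "A \<in> J n" unfolding step.IH using A by auto
  qed
qed

text \<open>Equal cuts encode the empty set, and their rescaled pair lies on the diagonal, which
  every rescaled system contains.\<close>

lemma rescale_memI:
  assumes "{Suc c..d} \<in> I" "c \<le> d" "d \<le> n"
  shows "(real c / real n, real d / real n) \<in> rescale n I"
proof (cases "c < d")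
  case True
  have "(real c / real n, real d / real n) = ((real (Suc c) - 1) / real n, real d / real n)" "1 \<le> Suc c" "Suc c \<le> d"
    using True by auto
  then show ?thesis using assms(1) unfolding rescale_def by blast
next
  case False
  then have "(real c / real n, real d / real n) \<in> diag"
    using assms by (auto simp: diag_def divide_le_eq_1)
  then show ?thesis by (simp add: rescale_def)
qed

lemma rescale_memE:
  assumes "p \<in> rescale n I" "I \<in> InSy n"
  obtains "p \<in> diag" | c d where "p = (real c / real n, real d / real n)" "{Suc c..d} \<in> I" "c < d" "d \<le> n"
proof (cases "p \<in> diag")
  case False
  then obtain a b where ab: "p = ((real a - 1) / real n, real b / real n)" "1 \<le> a" "a \<le> b" "{a..b} \<in> I"
    using assms by (auto simp: rescale_def)
  then have "{Suc (a - 1)..b} \<in> I" "a - 1 < b" by auto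
  moreover from this have "b \<le> n" using InSy_cut_le[OF assms(2)] by blast
  ultimately show ?thesis using that(2)[of "a - 1" b] ab by (auto simp: of_nat_diff)
qed (use that in auto)

lemma rescale_in_InSy_inf:
  assumes I: "I \<in> InSy n" and n: "1 \<le> n"
  shows "rescale n I \<in> InSy_inf"
proof -
  have *: "rescale n I \<subseteq> (\<lambda>(c, d). (real c / real n, real d / real n)) ` ({..n} \<times> {..n}) \<union> diag"
  proof
    fix p assume "p \<in> rescale n I"
    from this I show "p \<in> (\<lambda>(c, d). (real c / real n, real d / real n)) ` ({..n} \<times> {..n}) \<union> diag"
    proof (cases rule: rescale_memE)
      case (2 c d)
      then show ?thesis by (intro UnI1 image_eqI[of _ _ "(c, d)"]) auto
    qed simp
  qed
  have "rescale n I = (rescale n I - diag) \<union> diag" by (auto simp: rescale_def)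
  moreover have "finite (rescale n I - diag)"
  proof (rule finite_subset)
    show "rescale n I - diag \<subseteq> (\<lambda>(c, d). (real c / real n, real d / real n)) ` ({..n} \<times> {..n})"
      using * by blast
  qed simp
  moreover have "compact diag"
  proof -
    have "diag = (\<lambda>x. (x, x)) ` {0..1}" by (auto simp: diag_def)
    moreover have "compact ((\<lambda>x::real. (x, x)) ` {0..1})" by (intro compact_continuous_image continuous_intros) auto
    ultimately show ?thesis by simp
  qed
  ultimately have "compact (rescale n I)" by (metis compact_Un finite_imp_compact)
  moreover have "rescale n I \<subseteq> {(x, y). 0 \<le> x \<and> x \<le> y \<and> y \<le> 1}"
  proof
    fix p assume "p \<in> rescale n I"
    from this I show "p \<in> {(x, y). 0 \<le> x \<and> x \<le> y \<and> y \<le> 1}"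
    proof (cases rule: rescale_memE)
      case (2 c d)
      then show ?thesis using n by (auto simp: divide_right_mono divide_le_eq_1)
    qed (auto simp: diag_def)
  qed
  moreover have "diag \<subseteq> rescale n I" by (simp add: rescale_def)
  ultimately show ?thesis by (simp add: InSy_inf_def)
qed

lemma diag_in_InSy_inf: "diag \<in> InSy_inf"
proof -
  have "diag = (\<lambda>x. (x, x)) ` {0..1}" by (auto simp: diag_def)
  moreover have "compact ((\<lambda>x::real. (x, x)) ` {0..1})" by (intro compact_continuous_image continuous_intros) auto
  ultimately have "compact diag" by simp
  then show ?thesis by (auto simp: InSy_inf_def diag_def)
qed

lemma disc_nonneg: "disc u n e \<Longrightarrow> 0 \<le> e"
  unfolding disc_def by (metis abs_ge_zero atLeastAtMost_iff order_trans zero_le_one order_refl)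

lemma discD: "disc u n e \<Longrightarrow> v \<in> {0..1} \<Longrightarrow> \<bar>real (cnt u n v) / real n - v\<bar> \<le> e"
  by (auto simp: disc_def)

lemma cnt_less_imp: "cnt u n v < cnt u n w \<Longrightarrow> v < w"
  using cnt_mono[of w v u n] by (cases "v < w") auto

text \<open>By \<open>chain_cut\<close> the same reals \<open>v\<close> and \<open>w\<close> yield a
  point at level \<open>n\<close> and a point at level \<open>m\<close>: their values under the two
  empirical distribution functions. Each coordinate moves by at most \<open>e + e'\<close>, and the
  l1-distance adds the two coordinates.\<close>

lemma d_haus_rescale_chain:
  assumes u: "generic u" and J: "eraser_chain u J" and nm: "1 \<le> n" "n \<le> m"
    and e: "disc u n e" and e': "disc u m e'"
  shows "d_haus (rescale n (J n)) (rescale m (J m)) \<le> 2 * (e + e')"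
proof -
  have Jn: "J n \<in> InSy n" and Jm: "J m \<in> InSy m" using eraser_chainD(1)[OF J] nm by auto
  note eq = chain_cut[OF u J nm]
  have dist: "l1_dist (real (cnt u n v) / real n, real (cnt u n w) / real n)
      (real (cnt u m v) / real m, real (cnt u m w) / real m) \<le> 2 * (e + e')"
    if "v \<in> {0..1}" "w \<in> {0..1}" for v w
  proof -
    have "\<bar>real (cnt u n v) / real n - real (cnt u m v) / real m\<bar> \<le> e + e'"
      using discD[OF e that(1)] discD[OF e' that(1)] by linarith
    moreover have "\<bar>real (cnt u n w) / real n - real (cnt u m w) / real m\<bar> \<le> e + e'"
      using discD[OF e that(2)] discD[OF e' that(2)] by linarith
    ultimately show ?thesis unfolding l1_dist_def fst_conv snd_conv mult_2 by (rule add_mono)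
  qed
  have diag0: "l1_dist p p \<le> 2 * (e + e')" for p
    using disc_nonneg[OF e] disc_nonneg[OF e'] by (simp add: l1_dist_def)
  show ?thesis
  proof (rule d_haus_leI)
    show "rescale n (J n) \<in> InSy_inf" "rescale m (J m) \<in> InSy_inf"
      using rescale_in_InSy_inf Jn Jm nm by auto
  next
    fix p assume "p \<in> rescale n (J n)"
    from this Jn show "\<exists>q\<in>rescale m (J m). l1_dist p q \<le> 2 * (e + e')"
    proof (cases rule: rescale_memE)
      case 1
      then have "p \<in> rescale m (J m)" by (simp add: rescale_def)
      then show ?thesis using diag0 by blast
    next
      case (2 c d)
      then obtain v w where vw: "{Suc c..d} = {Suc (cnt u n v)..cnt u n w}" "v \<in> {0..1}" "w \<in> {0..1}"
        "{Suc (cnt u m v)..cnt u m w} \<in> J m" unfolding eq by auto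
      then have cd: "cnt u n v = c" "cnt u n w = d" using atLeastAtMost_Suc_eq_iff[OF 2(3) vw(1)] by auto
      then have "v < w" using 2(3) cnt_less_imp[of u n v w] by simp
      then have "(real (cnt u m v) / real m, real (cnt u m w) / real m) \<in> rescale m (J m)"
        using vw(4) by (intro rescale_memI cnt_mono cnt_le) auto
      then show ?thesis using dist[OF vw(2,3)] cd 2(1) by blast
    qed
  next
    fix q assume "q \<in> rescale m (J m)"
    from this Jm show "\<exists>p\<in>rescale n (J n). l1_dist q p \<le> 2 * (e + e')"
    proof (cases rule: rescale_memE)
      case 1
      then have "q \<in> rescale n (J n)" by (simp add: rescale_def)
      then show ?thesis using diag0 by blast
    next
      case (2 c d)
      obtain v w where vw: "v \<in> {0..1}" "w \<in> {0..1}" "cnt u m v = c" "cnt u m w = d"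
      proof -
        have "c \<le> m" "d \<le> m" using 2 by auto
        then obtain v w where "0 \<le> v" "v \<le> 1" "cnt u m v = c" "0 \<le> w" "w \<le> 1" "cnt u m w = d"
          using cnt_surj[OF u] by metis
        then show thesis by (intro that) auto
      qed
      then have "v < w" using 2(3) cnt_less_imp[of u m v w] by simp
      have "{Suc (cnt u n v)..cnt u n w} \<in> J n" unfolding eq using vw 2 by blast
      then have "(real (cnt u n v) / real n, real (cnt u n w) / real n) \<in> rescale n (J n)"
        using \<open>v < w\<close> by (intro rescale_memI cnt_mono cnt_le) auto
      then show ?thesis using dist[OF vw(1,2)] vw 2(1) by (metis l1_dist_sym)
    qed
  qed
qed

text \<open>Each of the two coordinates costs the discrepancy \<open>e\<close>. The term
  \<open>1 / real n\<close> is due to the singletons, which every interval system contains: they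
  rescale to points at l1-distance 1/n from the diagonal.\<close>

lemma d_haus_rescale_phi_inf:
  assumes K: "K \<in> InSy_inf" and u: "generic u" and g: "good K u" and n: "1 \<le> n" and e: "disc u n e"
  shows "d_haus K (rescale n (phi_inf n K (order_stat u n))) \<le> 2 * e + 1 / real n"
proof -
  let ?P = "phi_inf n K (order_stat u n)"
  have P: "?P \<in> InSy n" by (rule phi_inf_in_InSy)
  have dist: "l1_dist (x, y) (real (cnt u n x) / real n, real (cnt u n y) / real n) \<le> 2 * e + 1 / real n"
    if "(x, y) \<in> K" for x y
  proof -
    have "l1_dist (x, y) (real (cnt u n x) / real n, real (cnt u n y) / real n) \<le> 2 * e"
    proof -
      have "\<bar>real (cnt u n x) / real n - x\<bar> \<le> e" "\<bar>real (cnt u n y) / real n - y\<bar> \<le> e"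
        using discD[OF e, of x] discD[OF e, of y] InSy_infD[OF K that] by auto
      then show ?thesis
        unfolding l1_dist_def fst_conv snd_conv mult_2 by (subst (1 2) abs_minus_commute) (rule add_mono)
    qed
    also have "\<dots> \<le> 2 * e + 1 / real n" by simp
    finally show ?thesis .
  qed
  have diag0: "l1_dist p p \<le> 2 * e + 1 / real n" for p
    using disc_nonneg[OF e] by (simp add: l1_dist_def)
  show ?thesis
  proof (rule d_haus_leI[OF K rescale_in_InSy_inf[OF P n]])
    fix p assume p: "p \<in> K"
    obtain x y where xy: "p = (x, y)" by (cases p)
    have "(real (cnt u n x) / real n, real (cnt u n y) / real n) \<in> rescale n ?P"
      using phi_inf_good_cnt[OF K u g p[unfolded xy]] InSy_infD(2)[OF K p[unfolded xy]]
      by (intro rescale_memI cnt_mono cnt_le)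
    then show "\<exists>q\<in>rescale n ?P. l1_dist p q \<le> 2 * e + 1 / real n" using dist p xy by blast
  next
    fix q assume "q \<in> rescale n ?P"
    from this P show "\<exists>p\<in>K. l1_dist q p \<le> 2 * e + 1 / real n"
    proof (cases rule: rescale_memE)
      case 1
      then have "q \<in> K" using K by (auto simp: InSy_inf_def)
      then show ?thesis using diag0 by blast
    next
      case (2 c d)
      have "{Suc c..d} \<noteq> {}" using 2 by simp
      then consider j where "{Suc c..d} = {j}" | x y where "{Suc c..d} = {Suc (cnt u n x)..cnt u n y}" "(x,y) \<in> K"
        using 2(2) unfolding phi_inf_cut[OF K] by blast
      then show ?thesis
      proof cases
        case 1
        then have "d = Suc c" using 2(3) by (metis atLeastatMost_empty_iff2 less_eq_Suc_le singletonD atLeastAtMost_iff order_refl)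
        moreover have "(real c / real n, real c / real n) \<in> diag"
          using 2 by (auto simp: diag_def divide_le_eq_1)
        then have "(real c / real n, real c / real n) \<in> K" using K by (auto simp: InSy_inf_def)
        moreover have "l1_dist q (real c / real n, real c / real n) = 1 / real n"
          using 2(1) \<open>d = Suc c\<close> by (simp add: l1_dist_def add_divide_distrib)
        ultimately show ?thesis using disc_nonneg[OF e] by (intro bexI[of _ "(real c / real n, real c / real n)"]) auto
      next
        case c2: 2
        then show ?thesis using dist[OF c2(2)] atLeastAtMost_Suc_eq_iff[OF 2(3) c2(1)] 2(1) by (metis l1_dist_sym)
      qed
    qed
  qed
qed

section \<open>Completeness of the limit space\<close>

interpretation IS: Metric_space InSy_inf d_haus
  by (rule Metric_space_d_haus)

lemma l1_dist_tendsto: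
  assumes "s \<longlonglongrightarrow> p"
  shows "(\<lambda>n. l1_dist q (s n)) \<longlonglongrightarrow> l1_dist q p"
  unfolding l1_dist_def by (intro tendsto_intros assms)

lemma triangle_compact: "compact {(x, y). (0::real) \<le> x \<and> x \<le> y \<and> y \<le> 1}"
proof -
  have "closed {p :: real \<times> real. 0 \<le> fst p \<and> fst p \<le> snd p \<and> snd p \<le> 1}"
    by (intro closed_Collect_conj closed_Collect_le continuous_intros)
  moreover have "bounded {p :: real \<times> real. 0 \<le> fst p \<and> fst p \<le> snd p \<and> snd p \<le> 1}"
    by (rule bounded_subset[OF bounded_cbox[of "(0, 0)" "(1, 1)"]]) (auto simp: cbox_Pair_eq)
  moreover have "{p :: real \<times> real. 0 \<le> fst p \<and> fst p \<le> snd p \<and> snd p \<le> 1} = {(x, y). 0 \<le> x \<and> x \<le> y \<and> y \<le> 1}"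
    by auto
  ultimately show ?thesis by (simp add: compact_eq_bounded_closed)
qed

text \<open>The limit consists of the points that all late members of the sequence approximate. To
  find a point of it near a given point of some member, that point is followed through the later
  members and a cluster point is taken in the compact triangle.\<close>

lemma IS_mcomplete: "IS.mcomplete"
  unfolding IS.mcomplete_def
proof (intro allI impI)
  fix \<sigma> assume C: "IS.MCauchy \<sigma>"
  then have \<sigma>: "\<sigma> n \<in> InSy_inf" for n by (auto simp: IS.MCauchy_def)
  have Cauchy: "\<exists>N. \<forall>n\<ge>N. \<forall>m\<ge>N. d_haus (\<sigma> n) (\<sigma> m) < e" if "0 < e" for e
    using C that unfolding IS.MCauchy_def by meson
  define K where "K = {p. \<forall>e>0. \<exists>N. \<forall>n\<ge>N. \<exists>q\<in>\<sigma> n. l1_dist p q \<le> e}"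
  define T where "T = {(x, y). (0::real) \<le> x \<and> x \<le> y \<and> y \<le> 1}"
  have cT: "compact T" unfolding T_def by (rule triangle_compact)
  have sub: "\<sigma> n \<subseteq> T" "diag \<subseteq> \<sigma> n" for n using \<sigma>[of n] by (auto simp: InSy_inf_def T_def)
  have KD: "\<exists>N. \<forall>n\<ge>N. \<exists>q\<in>\<sigma> n. l1_dist p q \<le> e" if "p \<in> K" "0 < e" for p e
    using that unfolding K_def by blast
  have clK: "closed K"
  proof (unfold closed_sequential_limits, intro allI impI, elim conjE)
    fix s l assume s: "\<forall>n. s n \<in> K" "s \<longlonglongrightarrow> l"
    show "l \<in> K"
      unfolding K_def
    proof (intro CollectI allI impI)
      fix e :: real assume e: "0 < e"
      have "(\<lambda>n. l1_dist l (s n)) \<longlonglongrightarrow> 0" using l1_dist_tendsto[OF s(2), of l] by (simp add: l1_dist_def)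
      then have "eventually (\<lambda>n. l1_dist l (s n) < e/2) sequentially" using e by (intro order_tendstoD) auto
      then obtain i where i: "l1_dist l (s i) < e/2" by (auto simp: eventually_sequentially)
      obtain N where N: "\<forall>n\<ge>N. \<exists>q\<in>\<sigma> n. l1_dist (s i) q \<le> e/2"
        using KD[of "s i" "e/2"] s(1) e by auto
      show "\<exists>N. \<forall>n\<ge>N. \<exists>q\<in>\<sigma> n. l1_dist l q \<le> e"
      proof (intro exI allI impI)
        fix n assume "N \<le> n"
        then obtain q where "q \<in> \<sigma> n" "l1_dist (s i) q \<le> e/2" using N by blast
        then show "\<exists>q\<in>\<sigma> n. l1_dist l q \<le> e"
          using i l1_dist_triangle[of l q "s i"] by (intro bexI[of _ q]) auto
      qed
    qed
  qed
  have "K \<subseteq> T"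
  proof
    fix p assume p: "p \<in> K"
    have "\<exists>q\<in>T. l1_dist p q \<le> inverse (real (Suc i))" for i
    proof -
      obtain N where "\<forall>n\<ge>N. \<exists>q\<in>\<sigma> n. l1_dist p q \<le> inverse (real (Suc i))"
        using KD[OF p, of "inverse (real (Suc i))"] by auto
      then obtain q where "q \<in> \<sigma> N" "l1_dist p q \<le> inverse (real (Suc i))" by blast
      then show ?thesis using sub by blast
    qed
    then obtain f where f: "\<And>i. f i \<in> T" "\<And>i. l1_dist p (f i) \<le> inverse (real (Suc i))" by metis
    have lim0: "(\<lambda>i. l1_dist p (f i)) \<longlonglongrightarrow> 0"
      by (rule real_tendsto_sandwich[OF _ _ tendsto_const LIMSEQ_inverse_real_of_nat]) (use f(2) in \<open>auto simp: l1_dist_nonneg\<close>)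
    have "(\<lambda>i. dist (f i) p) \<longlonglongrightarrow> 0"
    proof (rule real_tendsto_sandwich[OF _ _ tendsto_const lim0])
      have "dist (f i) p \<le> l1_dist p (f i)" for i
        unfolding l1_dist_def dist_prod_def by (rule order_trans[OF sqrt_sum_squares_le_sum_abs]) (auto simp: dist_real_def)
      then show "\<forall>\<^sub>F i in sequentially. dist (f i) p \<le> l1_dist p (f i)" by simp
    qed auto
    then have "f \<longlonglongrightarrow> p" by (rule tendsto_dist_iff[THEN iffD2])
    then show "p \<in> T" using compact_imp_closed[OF cT] f(1) closed_sequentially by blast
  qed
  moreover have "diag \<subseteq> K"
  proof
    fix p assume "p \<in> diag"
    then have "\<And>n. p \<in> \<sigma> n" using sub by blast
    moreover have "l1_dist p p \<le> e" if "0 < e" for e using that by (simp add: l1_dist_def)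
    ultimately show "p \<in> K" unfolding K_def by blast
  qed
  moreover from calculation have "compact K"
    using compact_Int_closed[OF cT clK] by (simp add: inf.absorb2)
  ultimately have K: "K \<in> InSy_inf" by (simp add: InSy_inf_def T_def)
  have bound: "\<exists>N. \<forall>n\<ge>N. d_haus (\<sigma> n) K \<le> 2 * e" if e: "0 < e" for e
  proof -
    obtain N where N: "\<forall>n\<ge>N. \<forall>m\<ge>N. d_haus (\<sigma> n) (\<sigma> m) < e" using Cauchy[OF e] by blast
    have "d_haus (\<sigma> n) K \<le> 2 * e" if n: "N \<le> n" for n
    proof (rule d_haus_leI[OF \<sigma> K])
      fix q assume q: "q \<in> \<sigma> n"
      have "\<exists>r\<in>\<sigma> m. l1_dist q r \<le> e" if "N \<le> m" for m
        using d_haus_near[OF \<sigma>[of n] \<sigma>[of m] q] N n that by (metis less_imp_le order_trans)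
      then have "\<exists>r\<in>\<sigma> (N + m). l1_dist q r \<le> e" for m by simp
      then obtain f where f: "\<And>m. f m \<in> \<sigma> (N + m)" "\<And>m. l1_dist q (f m) \<le> e" by metis
      have "\<And>m. f m \<in> T" using f(1) sub by blast
      then obtain p r where pr: "p \<in> T" "strict_mono r" "(f \<circ> r) \<longlonglongrightarrow> p"
        using cT unfolding compact_def by metis
      have "l1_dist q p \<le> e"
        by (rule LIMSEQ_le_const2[OF l1_dist_tendsto[OF pr(3)]]) (use f(2) in auto)
      \<comment> \<open>So far \<open>p\<close> is approximated along a subsequence only; the Cauchy
        property extends this to all late indices.\<close>
      moreover have "p \<in> K"
        unfolding K_def
      proof (intro CollectI allI impI)
        fix \<eta> :: real assume \<eta>: "0 < \<eta>"
        obtain N' where N': "\<forall>n\<ge>N'. \<forall>m\<ge>N'. d_haus (\<sigma> n) (\<sigma> m) < \<eta>/2" using Cauchy[of "\<eta>/2"] \<eta> by auto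
        have "(\<lambda>n. l1_dist p ((f \<circ> r) n)) \<longlonglongrightarrow> 0" using l1_dist_tendsto[OF pr(3), of p] by (simp add: l1_dist_def)
        then have "eventually (\<lambda>n. l1_dist p ((f \<circ> r) n) < \<eta>/2) sequentially" using \<eta> by (intro order_tendstoD) auto
        then obtain i where i: "\<forall>j\<ge>i. l1_dist p ((f \<circ> r) j) < \<eta>/2" by (auto simp: eventually_sequentially)
        define j where "j = max i N'"
        have j: "l1_dist p (f (r j)) < \<eta>/2" "N' \<le> N + r j" using i seq_suble[OF pr(2), of j] by (auto simp: j_def)
        show "\<exists>N. \<forall>n\<ge>N. \<exists>q\<in>\<sigma> n. l1_dist p q \<le> \<eta>"
        proof (intro exI allI impI)
          fix n assume n: "N' \<le> n"
          obtain q where "q \<in> \<sigma> n" "l1_dist (f (r j)) q \<le> d_haus (\<sigma> (N + r j)) (\<sigma> n)"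
            using d_haus_near[OF \<sigma> \<sigma> f(1)] by metis
          moreover have "d_haus (\<sigma> (N + r j)) (\<sigma> n) < \<eta>/2" using N' j(2) n by blast
          ultimately show "\<exists>q\<in>\<sigma> n. l1_dist p q \<le> \<eta>"
            using j(1) l1_dist_triangle[of p q "f (r j)"] by (intro bexI[of _ q]) auto
        qed
      qed
      ultimately show "\<exists>p\<in>K. l1_dist q p \<le> 2 * e" using e by (intro bexI[of _ p]) auto
    next
      fix p assume "p \<in> K"
      then obtain N' where N': "\<forall>n\<ge>N'. \<exists>q\<in>\<sigma> n. l1_dist p q \<le> e" using KD e by blast
      define m where "m = max N N'"
      obtain q where q: "q \<in> \<sigma> m" "l1_dist p q \<le> e" using N' max.cobounded2[of N' N] unfolding m_def by blast
      obtain r where "r \<in> \<sigma> n" "l1_dist q r \<le> d_haus (\<sigma> m) (\<sigma> n)" using d_haus_near[OF \<sigma> \<sigma> q(1)] by metis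
      moreover have "d_haus (\<sigma> m) (\<sigma> n) < e" using N n by (simp add: m_def)
      ultimately show "\<exists>r\<in>\<sigma> n. l1_dist p r \<le> 2 * e"
        using q(2) l1_dist_triangle[of p r q] by (intro bexI[of _ r]) auto
    qed
    then show ?thesis by blast
  qed
  have "limitin IS.mtopology \<sigma> K sequentially"
    unfolding IS.limit_metric_sequentially
  proof (intro conjI allI impI K)
    fix e :: real assume "0 < e"
    then obtain N where "\<forall>n\<ge>N. d_haus (\<sigma> n) K \<le> 2 * (e/3)" using bound[of "e/3"] by auto
    then have "\<forall>n\<ge>N. \<sigma> n \<in> InSy_inf \<and> d_haus (\<sigma> n) K < e" using \<sigma> \<open>0 < e\<close> by fastforce
    then show "\<exists>N. \<forall>n\<ge>N. \<sigma> n \<in> InSy_inf \<and> d_haus (\<sigma> n) K < e" by blast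
  qed
  then show "\<exists>x. limitin IS.mtopology \<sigma> x sequentially" by blast
qed

section \<open>Limits along a typical path\<close>

lemma limitin_IS_iff:
  "limitin InSy_inf_topology \<sigma> K sequentially \<longleftrightarrow>
    K \<in> InSy_inf \<and> (\<forall>e>0. \<exists>N. \<forall>n\<ge>N. \<sigma> n \<in> InSy_inf \<and> d_haus (\<sigma> n) K < e)"
  by (rule IS.limit_metric_sequentially)

lemma nice_disc:
  assumes "nice u" "0 < e"
  obtains N where "1 \<le> N" "\<And>n. N \<le> n \<Longrightarrow> disc u n e"
proof -
  obtain N where "\<forall>n\<ge>N. disc u n e" using assms unfolding nice_def by blast
  then show ?thesis by (intro that[of "max 1 N"]) auto
qed

lemma rescale_chain_converges:
  assumes u: "nice u" and J: "eraser_chain u J"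
  obtains K where "limitin InSy_inf_topology (\<lambda>n. rescale n (J n)) K sequentially"
proof -
  have g: "generic u" using u by (simp add: nice_def)
  \<comment> \<open>Shifted by one, because nothing is known about level 0.\<close>
  define \<sigma> where "\<sigma> n = rescale (Suc n) (J (Suc n))" for n
  have mem: "rescale n (J n) \<in> InSy_inf" if "1 \<le> n" for n
    using rescale_in_InSy_inf[OF eraser_chainD(1)[OF J that] that] .
  have "IS.MCauchy \<sigma>"
    unfolding IS.MCauchy_def
  proof (intro conjI allI impI)
    show "range \<sigma> \<subseteq> InSy_inf" using mem by (auto simp: \<sigma>_def)
    fix e :: real assume e: "0 < e"
    \<comment> \<open>Twice the sum of two discrepancies \<open>e/5\<close> stays below
      \<open>e\<close>.\<close>
    obtain N where N: "1 \<le> N" "\<And>n. N \<le> n \<Longrightarrow> disc u n (e/5)" using nice_disc[OF u, of "e/5"] e by auto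
    have le: "d_haus (\<sigma> n) (\<sigma> m) < e" if "N \<le> n" "n \<le> m" for n m
    proof -
      have "d_haus (\<sigma> n) (\<sigma> m) \<le> 2 * (e/5 + e/5)"
        unfolding \<sigma>_def using that by (intro d_haus_rescale_chain[OF g J] N) auto
      also have "\<dots> < e" using e by simp
      finally show ?thesis .
    qed
    have "d_haus (\<sigma> n) (\<sigma> m) < e" if "N \<le> n" "N \<le> m" for n m
      using le[of n m] le[of m n] that d_haus_sym[of "\<sigma> n" "\<sigma> m"] by (cases "n \<le> m") auto
    then show "\<exists>N. \<forall>n n'. N \<le> n \<longrightarrow> N \<le> n' \<longrightarrow> d_haus (\<sigma> n) (\<sigma> n') < e" by blast
  qed
  then obtain K where K: "limitin InSy_inf_topology \<sigma> K sequentially"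
    using IS_mcomplete unfolding IS.mcomplete_def by blast
  have "limitin InSy_inf_topology (\<lambda>n. rescale n (J n)) K sequentially"
    using K unfolding \<sigma>_def by (rule limitin_sequentially_offset_rev[where k=1, simplified])
  then show ?thesis by (rule that)
qed

text \<open>The counting function jumps at finitely many points only, and \<open>x\<close> has a
  positive distance from all of them.\<close>

lemma off_points_nbhd:
  assumes "x \<notin> u ` {1..n}"
  obtains d where "0 < d" "\<And>v. \<bar>v - x\<bar> < d \<Longrightarrow> v \<notin> u ` {1..n} \<and> cnt u n v = cnt u n x"
proof -
  have "\<exists>d>0. \<forall>t\<in>u ` {1..n}. t \<noteq> x \<longrightarrow> d \<le> dist x t" by (rule finite_set_avoid) simp
  then obtain d where d: "0 < d" "\<And>t. t \<in> u ` {1..n} \<Longrightarrow> d \<le> dist x t" using assms by metis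
  have "v \<notin> u ` {1..n} \<and> cnt u n v = cnt u n x" if "\<bar>v - x\<bar> < d" for v
  proof
    show "v \<notin> u ` {1..n}" using d(2)[of v] that by (auto simp: dist_real_def)
    have "u j \<le> v \<longleftrightarrow> u j \<le> x" if "j \<in> {1..n}" for j
      using d(2)[of "u j"] that \<open>\<bar>v - x\<bar> < d\<close> by (auto simp: dist_real_def)
    then have "{j \<in> {1..n}. u j \<le> v} = {j \<in> {1..n}. u j \<le> x}" by blast
    then show "cnt u n v = cnt u n x" by (simp add: cnt_def)
  qed
  with d show ?thesis using that by blast
qed

lemma l1_dist_coord:
  "\<bar>fst p - fst q\<bar> \<le> l1_dist p q" "\<bar>snd p - snd q\<bar> \<le> l1_dist p q"
  by (auto simp: l1_dist_def)

text \<open>Points whose cell is not occupied keep a positive distance from \<open>K\<close>: a limit point of \<open>K\<close>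
  would lie in the closed cell, and goodness upgrades closed cells to open ones.\<close>

lemma unoccupied_cell_far:
  assumes K: "K \<in> InSy_inf" and u: "generic u" and g: "good K u" and cd: "c < d" "d \<le> n"
    and nin: "{Suc c..d} \<notin> phi_inf n K (order_stat u n)"
  obtains e where "0 < e" "\<And>p v w. p \<in> K \<Longrightarrow> v \<in> {0..1} \<Longrightarrow> w \<in> {0..1} \<Longrightarrow> cnt u n v = c \<Longrightarrow>
    cnt u n w = d \<Longrightarrow> e \<le> l1_dist p (v, w)"
proof (rule ccontr)
  assume contra: "\<not> thesis"
  have "\<exists>p v w. p \<in> K \<and> v \<in> {0..1} \<and> w \<in> {0..1} \<and> cnt u n v = c \<and> cnt u n w = d \<and>
      l1_dist p (v, w) < inverse (real (Suc i))" for i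
  proof (rule ccontr)
    assume "\<not> ?thesis"
    then have "thesis" by (intro that[of "inverse (real (Suc i))"]) (auto simp: not_less)
    then show False using contra by blast
  qed
  then obtain p v w where f: "\<And>i. p i \<in> K" "\<And>i. v i \<in> {0..1}" "\<And>i. w i \<in> {0..1}" "\<And>i. cnt u n (v i) = c"
    "\<And>i. cnt u n (w i) = d" "\<And>i. l1_dist (p i) (v i, w i) < inverse (real (Suc i))" by metis
  have "compact K" using K by (simp add: InSy_inf_def)
  then obtain q r where q: "q \<in> K" "strict_mono r" "(p \<circ> r) \<longlonglongrightarrow> q"
    using f(1) unfolding compact_def by metis
  have h0: "(\<lambda>i. inverse (real (Suc (r i)))) \<longlonglongrightarrow> 0"
    using LIMSEQ_subseq_LIMSEQ[OF LIMSEQ_inverse_real_of_nat q(2)] by (simp add: comp_def)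
  have le: "\<bar>v i - fst (p i)\<bar> \<le> inverse (real (Suc i))" "\<bar>w i - snd (p i)\<bar> \<le> inverse (real (Suc i))" for i
    using f(6)[of i] l1_dist_coord[of "p i" "(v i, w i)"] by (auto simp: abs_minus_commute)
  have d1: "(\<lambda>i. v (r i) - fst (p (r i))) \<longlonglongrightarrow> 0"
    by (rule Lim_null_comparison[OF _ h0], rule always_eventually, rule allI) (simp only: real_norm_def le)
  have d2: "(\<lambda>i. w (r i) - snd (p (r i))) \<longlonglongrightarrow> 0"
    by (rule Lim_null_comparison[OF _ h0], rule always_eventually, rule allI) (simp only: real_norm_def le)
  from tendsto_add[OF d1 tendsto_fst[OF q(3)]] tendsto_add[OF d2 tendsto_snd[OF q(3)]]
  have lim: "(\<lambda>i. v (r i)) \<longlonglongrightarrow> fst q" "(\<lambda>i. w (r i)) \<longlonglongrightarrow> snd q" by (auto simp: comp_def)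
  have cell: "opad u n c \<le> v i" "v i \<le> opad u n (Suc c)" "opad u n d \<le> w i" "w i \<le> opad u n (Suc d)" for i
    using cnt_in_cell[of "v i" n u] cnt_in_cell[of "w i" n u] f(2-5)[of i] by auto
  have "opad u n c \<le> fst q" "opad u n d \<le> snd q"
    using LIMSEQ_le_const[OF lim(1)] LIMSEQ_le_const[OF lim(2)] cell by blast+
  moreover have "fst q \<le> opad u n (Suc c)" "snd q \<le> opad u n (Suc d)"
    using LIMSEQ_le_const2[OF lim(1)] LIMSEQ_le_const2[OF lim(2)] cell by blast+
  ultimately have "{Suc c..d} \<in> phi_inf n K (order_stat u n)"
    using phi_inf_good[OF K u g, of "fst q" "snd q" n c d] q(1) cd by simp
  with nin show False by blast
qed

text \<open>Both inclusions pass through a level \<open>m\<close> at which the discrepancy and the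
  Hausdorff distance to \<open>K\<close> are small. An interval of \<open>J n\<close> comes from a
  pair of reals in its cell that lies close to \<open>K\<close>, which
  \<open>unoccupied_cell_far\<close> forbids when the interval is absent from
  \<open>phi_inf\<close>. Conversely, a point of \<open>K\<close> off the sample points is close to
  a rescaled interval of level \<open>m\<close>, whose reals fall into the same cell.\<close>

lemma chain_eq_phi_inf:
  assumes u: "nice u" and J: "eraser_chain u J" and g: "good K u"
    and lim: "limitin InSy_inf_topology (\<lambda>n. rescale n (J n)) K sequentially" and n: "1 \<le> n"
  shows "J n = phi_inf n K (order_stat u n)"
proof -
  have gen: "generic u" using u by (simp add: nice_def)
  have K: "K \<in> InSy_inf" using lim by (simp add: limitin_IS_iff)
  let ?P = "phi_inf n K (order_stat u n)"
  have Jn: "J n \<in> InSy n" by (rule eraser_chainD(1)[OF J n])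
  have Jm: "J m \<in> InSy m" "rescale m (J m) \<in> InSy_inf" if "n \<le> m" for m
    using eraser_chainD(1)[OF J, of m] rescale_in_InSy_inf[of "J m" m] that n by auto
  have P: "?P \<in> InSy n" by (rule phi_inf_in_InSy)
  have near: "\<exists>m\<ge>n. disc u m e \<and> d_haus (rescale m (J m)) K < e" if e: "0 < e" for e
  proof -
    obtain N where N: "\<forall>m\<ge>N. rescale m (J m) \<in> InSy_inf \<and> d_haus (rescale m (J m)) K < e"
      using lim e unfolding limitin_IS_iff by blast
    obtain N' where N': "\<And>m. N' \<le> m \<Longrightarrow> disc u m e" using nice_disc[OF u e] by blast
    show ?thesis using N N' by (intro exI[of _ "max n (max N N')"]) auto
  qed
  show ?thesis
  proof (intro set_eqI iffI)
    fix A assume A: "A \<in> J n"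
    show "A \<in> ?P"
    proof (cases "A = {}")
      case True
      then show ?thesis using InSy_empty[OF P] by simp
    next
      case False
      then obtain c d where cd: "A = {Suc c..d}" "c < d" "d \<le> n" using InSyD_cut[OF Jn A] by metis
      show ?thesis
      proof (rule ccontr)
        assume "A \<notin> ?P"
        then obtain e where e: "0 < e" "\<And>p v w. p \<in> K \<Longrightarrow> v \<in> {0..1} \<Longrightarrow> w \<in> {0..1} \<Longrightarrow> cnt u n v = c \<Longrightarrow>
          cnt u n w = d \<Longrightarrow> e \<le> l1_dist p (v, w)"
          using unoccupied_cell_far[OF K gen g cd(2,3)] cd(1) by metis
        \<comment> \<open>The discrepancy enters once for each coordinate and the Hausdorff distance
          once, so \<open>(v, w)\<close> comes within \<open>3e/4\<close> of
          \<open>K\<close>.\<close>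
        obtain m where m: "n \<le> m" "disc u m (e/4)" "d_haus (rescale m (J m)) K < e/4" using near[of "e/4"] e by auto
        obtain v w where vw: "{Suc c..d} = {Suc (cnt u n v)..cnt u n w}" "v \<in> {0..1}" "w \<in> {0..1}"
          "{Suc (cnt u m v)..cnt u m w} \<in> J m" using A cd(1) unfolding chain_cut[OF gen J n m(1)] by auto
        have c: "cnt u n v = c" "cnt u n w = d" using atLeastAtMost_Suc_eq_iff[OF cd(2) vw(1)] by auto
        then have "v < w" using cd(2) cnt_less_imp[of u n v w] by simp
        let ?q = "(real (cnt u m v) / real m, real (cnt u m w) / real m)"
        have "?q \<in> rescale m (J m)" using vw(4) \<open>v < w\<close> by (intro rescale_memI cnt_mono cnt_le) auto
        then obtain p where p: "p \<in> K" "l1_dist ?q p \<le> d_haus (rescale m (J m)) K"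
          using d_haus_near[OF Jm(2)[OF m(1)] K] by metis
        have "l1_dist ?q (v, w) \<le> e/4 + e/4"
          unfolding l1_dist_def fst_conv snd_conv using discD[OF m(2) vw(2)] discD[OF m(2) vw(3)] by (rule add_mono)
        then have "l1_dist p (v, w) < e"
          using p(2) m(3) e(1) l1_dist_triangle[of p "(v, w)" ?q] l1_dist_sym[of p ?q] by linarith
        with e(2)[OF p(1) vw(2,3) c] show False by simp
      qed
    qed
  next
    fix A assume "A \<in> ?P"
    then consider "A = {}" | j where "j \<in> {1..n}" "A = {j}" | x y where "A = {Suc (cnt u n x)..cnt u n y}" "(x,y) \<in> K"
      "x \<notin> u ` {1..n}" "y \<notin> u ` {1..n}"
      unfolding phi_inf_cut[OF K] by blast
    then show "A \<in> J n"
    proof cases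
      case 3
      show ?thesis
      proof (cases "x < y")
        case False
        then have "A = {}" using cnt_mono[of y x u n] 3(1) by simp
        then show ?thesis using InSy_empty[OF Jn] by simp
      next
        case True
        obtain dx where dx: "0 < dx" "\<And>v. \<bar>v - x\<bar> < dx \<Longrightarrow> v \<notin> u ` {1..n} \<and> cnt u n v = cnt u n x"
          using off_points_nbhd[OF 3(3)] by metis
        obtain dy where dy: "0 < dy" "\<And>v. \<bar>v - y\<bar> < dy \<Longrightarrow> v \<notin> u ` {1..n} \<and> cnt u n v = cnt u n y"
          using off_points_nbhd[OF 3(4)] by metis
        \<comment> \<open>With this choice a displacement below \<open>2 * e\<close> preserves both
          counts, and a point within \<open>e\<close> of \<open>(x, y)\<close> cannot lie on the
          diagonal.\<close>
        define e where "e = min (min dx dy) (y - x) / 2"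
        have e: "0 < e" "2 * e \<le> dx" "2 * e \<le> dy" "e < y - x" using dx dy True by (auto simp: e_def min_def)
        obtain m where m: "n \<le> m" "disc u m e" "d_haus (rescale m (J m)) K < e" using near[OF e(1)] by blast
        have "d_haus K (rescale m (J m)) < e" using m(3) d_haus_sym[of K] by simp
        then obtain q where q: "q \<in> rescale m (J m)" "l1_dist (x, y) q < e"
          using d_haus_near[OF K Jm(2)[OF m(1)] 3(2)] by (metis order_le_less_trans)
        from q(1) Jm(1)[OF m(1)] show ?thesis
        proof (cases rule: rescale_memE)
          case 1
          then have "y - x \<le> l1_dist (x, y) q" by (auto simp: diag_def l1_dist_def)
          then show ?thesis using q(2) e(4) by simp
        next
          case (2 c d)
          then have "c \<le> m" "d \<le> m" by auto
          then obtain v w where v: "0 \<le> v" "v \<le> 1" "cnt u m v = c" and w: "0 \<le> w" "w \<le> 1" "cnt u m w = d"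
            using cnt_surj[OF gen] by metis
          have "\<bar>real c / real m - v\<bar> \<le> e" "\<bar>real d / real m - w\<bar> \<le> e"
            using discD[OF m(2), of v] discD[OF m(2), of w] v w by auto
          moreover have "\<bar>x - real c / real m\<bar> < e" "\<bar>y - real d / real m\<bar> < e"
            using l1_dist_coord[of "(x, y)" q] q(2) 2(1) by auto
          ultimately have "\<bar>v - x\<bar> < dx" "\<bar>w - y\<bar> < dy" using e by linarith+
          then have "cnt u n v = cnt u n x" "cnt u n w = cnt u n y" using dx(2) dy(2) by blast+
          then have "A = {Suc (cnt u n v)..cnt u n w}" using 3(1) by simp
          moreover have "{Suc (cnt u m v)..cnt u m w} \<in> J m" using 2 v w by simp
          moreover have "v \<in> {0..1}" "w \<in> {0..1}" using v w by auto
          ultimately show ?thesis unfolding chain_cut[OF gen J n m(1)] by blast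
        qed
      qed
    qed (use InSy_empty[OF Jn] InSy_single[OF Jn] in auto)
  qed
qed

lemma finite_InSy: "finite (InSy n)"
proof (rule finite_subset)
  show "InSy n \<subseteq> Pow (Pow {1..n})" by (fastforce simp: InSy_def)
qed simp

text \<open>There are finitely many candidate intervals, so a radius is found for each and the least
  one is taken. A hit of an open cell survives a small change of \<open>K\<close>; a miss survives
  because \<open>unoccupied_cell_far\<close> keeps \<open>K\<close> at a positive distance from the
  cell.\<close>

lemma phi_inf_stable:
  assumes K: "K \<in> InSy_inf" and u: "generic u" and g: "good K u"
  obtains e where "0 < e" "\<And>L. L \<in> InSy_inf \<Longrightarrow> d_haus K L < e \<Longrightarrow>
    phi_inf n L (order_stat u n) = phi_inf n K (order_stat u n)"
proof -
  let ?P = "\<lambda>L. phi_inf n L (order_stat u n)"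
  have P: "?P L \<in> InSy n" for L by (rule phi_inf_in_InSy)
  have "\<exists>e>0. \<forall>L\<in>InSy_inf. d_haus K L < e \<longrightarrow> (A \<in> ?P L \<longleftrightarrow> A \<in> ?P K)" for A
  proof (cases "A = {} \<or> (\<exists>j\<in>{1..n}. A = {j}) \<or> \<not> (\<exists>c d. A = {Suc c..d} \<and> c < d \<and> d \<le> n)")
    case True
    then consider "A = {} \<or> (\<exists>j\<in>{1..n}. A = {j})" | "A \<noteq> {}" "\<not> (\<exists>c d. A = {Suc c..d} \<and> c < d \<and> d \<le> n)" by blast
    then have "A \<in> ?P L \<longleftrightarrow> A \<in> ?P K" for L
    proof cases
      case 1
      then show ?thesis using InSy_empty[OF P] InSy_single[OF P] by auto
    next
      case 2
      then have "A \<notin> ?P L" for L using InSyD_cut[OF P[of L], of A] by blast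
      then show ?thesis by blast
    qed
    then show ?thesis by (intro exI[of _ 1]) auto
  next
    case False
    then obtain c d where cd: "A = {Suc c..d}" "c < d" "d \<le> n" by blast
    show ?thesis
    proof (cases "A \<in> ?P K")
      case True
      then obtain x y where xy: "A = {Suc (cnt u n x)..cnt u n y}" "(x,y) \<in> K" "x \<notin> u ` {1..n}" "y \<notin> u ` {1..n}"
        using False unfolding phi_inf_cut[OF K] by blast
      obtain dx where dx: "0 < dx" "\<And>v. \<bar>v - x\<bar> < dx \<Longrightarrow> v \<notin> u ` {1..n} \<and> cnt u n v = cnt u n x"
        using off_points_nbhd[OF xy(3)] by metis
      obtain dy where dy: "0 < dy" "\<And>v. \<bar>v - y\<bar> < dy \<Longrightarrow> v \<notin> u ` {1..n} \<and> cnt u n v = cnt u n y"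
        using off_points_nbhd[OF xy(4)] by metis
      have "A \<in> ?P L" if L: "L \<in> InSy_inf" "d_haus K L < min dx dy" for L
      proof -
        obtain q where q: "q \<in> L" "l1_dist (x, y) q < min dx dy"
          using d_haus_near[OF K L(1) xy(2)] L(2) by (metis order_le_less_trans)
        have "\<bar>fst q - x\<bar> < dx" "\<bar>snd q - y\<bar> < dy"
          using l1_dist_coord[of "(x, y)" q] q(2) by (auto simp: abs_minus_commute)
        then have "fst q \<notin> u ` {1..n} \<and> cnt u n (fst q) = cnt u n x" "snd q \<notin> u ` {1..n} \<and> cnt u n (snd q) = cnt u n y"
          using dx(2) dy(2) by blast+
        moreover have "(fst q, snd q) \<in> L" using q by simp
        ultimately have "A = {Suc (cnt u n (fst q))..cnt u n (snd q)} \<and> (fst q, snd q) \<in> L \<and>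
            fst q \<notin> u ` {1..n} \<and> snd q \<notin> u ` {1..n}"
          using xy(1) by simp
        then show ?thesis unfolding phi_inf_cut[OF L(1)] by blast
      qed
      then show ?thesis using True dx dy by (intro exI[of _ "min dx dy"]) auto
    next
      case c2: False
      then obtain e where e: "0 < e" "\<And>p v w. p \<in> K \<Longrightarrow> v \<in> {0..1} \<Longrightarrow> w \<in> {0..1} \<Longrightarrow> cnt u n v = c \<Longrightarrow>
          cnt u n w = d \<Longrightarrow> e \<le> l1_dist p (v, w)"
        using unoccupied_cell_far[OF K u g cd(2,3)] cd(1) by metis
      have "A \<notin> ?P L" if L: "L \<in> InSy_inf" "d_haus K L < e" for L
      proof
        assume "A \<in> ?P L"
        then obtain x y where xy: "A = {Suc (cnt u n x)..cnt u n y}" "(x,y) \<in> L"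
          using False unfolding phi_inf_cut[OF L(1)] by blast
        have c: "cnt u n x = c" "cnt u n y = d" using atLeastAtMost_Suc_eq_iff[OF cd(2), of "cnt u n x" "cnt u n y"] xy cd by auto
        obtain p where p: "p \<in> K" "l1_dist (x, y) p \<le> d_haus L K"
          using d_haus_near[OF L(1) K xy(2)] by metis
        have "e \<le> l1_dist p (x, y)" using InSy_infD[OF L(1) xy(2)] by (intro e(2) p c) auto
        then show False using p(2) L(2) d_haus_sym[of K L] l1_dist_sym[of p "(x, y)"] by simp
      qed
      then show ?thesis using c2 e(1) by blast
    qed
  qed
  then obtain f where f: "\<And>A. 0 < f A" "\<And>A L. L \<in> InSy_inf \<Longrightarrow> d_haus K L < f A \<Longrightarrow> (A \<in> ?P L \<longleftrightarrow> A \<in> ?P K)"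
    by metis
  define e where "e = Min (f ` Pow {1..n})"
  have fin: "finite (f ` Pow {1..n})" "f ` Pow {1..n} \<noteq> {}" by auto
  have e: "0 < e" "\<And>A. A \<in> Pow {1..n} \<Longrightarrow> e \<le> f A"
    unfolding e_def using f(1) Min_gr_iff[OF fin] Min_le[OF fin(1)] by blast+
  have sub: "?P L \<subseteq> Pow {1..n}" for L using P[of L] by (fastforce simp: InSy_def)
  have "?P L = ?P K" if "L \<in> InSy_inf" "d_haus K L < e" for L
  proof (rule set_eqI)
    fix A show "A \<in> ?P L \<longleftrightarrow> A \<in> ?P K"
    proof (cases "A \<in> Pow {1..n}")
      case True
      then show ?thesis using f(2)[OF that(1), of A] e(2)[OF True] that(2) by simp
    qed (use sub in blast)
  qed
  with e(1) show ?thesis using that by blast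
qed

section \<open>Recovering the points from their relative ranks\<close>

lemma generic_inj: "generic u \<Longrightarrow> inj_on u {1..n}"
  by (auto simp: generic_def intro: inj_on_subset)

lemma cnt_self_inj:
  assumes u: "generic u" and "i \<in> {1..n}" "j \<in> {1..n}" "cnt u n (u i) = cnt u n (u j)"
  shows "i = j"
proof (rule ccontr)
  assume "i \<noteq> j"
  then have "u i \<noteq> u j" by (rule inj_on_contraD[OF generic_inj[OF u] _ assms(2,3)])
  then consider "u i < u j" | "u j < u i" by linarith
  then show False
  proof cases
    case 1
    from cnt_strict[of "u i" u j "u j" n, OF this order_refl assms(3)] assms(4) show False by simp
  next
    case 2
    from cnt_strict[of "u j" u i "u i" n, OF this order_refl assms(2)] assms(4) show False by simp
  qed
qed

lemma cnt_self_range: "i \<in> {1..n} \<Longrightarrow> cnt u n (u i) \<in> {1..n}"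
proof -
  assume i: "i \<in> {1..n}"
  have "0 < cnt u n (u i)" unfolding cnt_def card_gt_0_iff using i by auto
  then show ?thesis using cnt_le[of u n "u i"] by auto
qed

lemma cnt_self_surj:
  assumes u: "generic u"
  shows "(\<lambda>i. cnt u n (u i)) ` {1..n} = {1..n}"
proof (rule endo_inj_surj)
  show "(\<lambda>i. cnt u n (u i)) ` {1..n} \<subseteq> {1..n}" using cnt_self_range by blast
  show "inj_on (\<lambda>i. cnt u n (u i)) {1..n}" using cnt_self_inj[OF u] by (rule inj_onI)
qed simp

text \<open>Inserting \<open>Suc n\<close> at its own rank shifts the labels at and behind that
  position by one, and by \<open>cnt_squeeze\<close> the ranks change in the same way. The list
  therefore names the points in increasing order.\<close>

lemma eraser_perm_ranks:
  assumes u: "generic u"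
  shows "length (eraser_perm (eraser_of_U u) n) = n \<and>
    (\<forall>i\<in>{1..n}. eraser_perm (eraser_of_U u) n ! (cnt u n (u i) - 1) = i)"
proof (induction n)
  case (Suc n)
  let ?L = "eraser_perm (eraser_of_U u) n" and ?k = "eraser_of_U u n"
  have k: "1 \<le> ?k" "?k \<le> Suc n" using eraser_of_U_range[of u n] by auto
  have len: "length ?L = n" and IH: "\<And>i. i \<in> {1..n} \<Longrightarrow> ?L ! (cnt u n (u i) - 1) = i" using Suc by auto
  have lt: "length (take (?k - 1) ?L) = ?k - 1" using len k by simp
  have "(take (?k - 1) ?L @ [Suc n] @ drop (?k - 1) ?L) ! (cnt u (Suc n) (u i) - 1) = i" if i: "i \<in> {1..Suc n}" for i
  proof (cases "i = Suc n")
    case True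
    then show ?thesis using lt by (simp add: eraser_of_U_eq[symmetric] nth_append)
  next
    case False
    then have i': "i \<in> {1..n}" using i by auto
    let ?r = "cnt u (Suc n) (u i)"
    have r: "cnt u n (u i) = squeeze ?k ?r" by (rule cnt_squeeze)
    have r1: "1 \<le> ?r" "?r \<le> Suc n" using cnt_self_range[OF i, of u] by auto
    have "?r \<noteq> ?k" using cnt_self_inj[OF u i, of "Suc n"] False unfolding eraser_of_U_eq by auto
    then consider "?r < ?k" | "?k < ?r" by linarith
    then show ?thesis
    proof cases
      case 1
      then have "cnt u n (u i) = ?r" using r by (simp add: squeeze_def)
      then show ?thesis using IH[OF i'] 1 r1 lt k len by (auto simp: nth_append)
    next
      case 2
      then have c: "cnt u n (u i) = ?r - 1" using r by (simp add: squeeze_def)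
      have dr: "drop (?k - 1) ?L ! (?r - 1 - (?k - 1) - 1) = ?L ! (?r - 1 - 1)"
        using 2 r1 k len by (subst nth_drop) (auto intro!: arg_cong[where f="(!) ?L"])
      have nl: "\<not> ?r - 1 < ?k - 1" "?r - 1 - (?k - 1) \<noteq> 0" using 2 k by auto
      have "(take (?k - 1) ?L @ [Suc n] @ drop (?k - 1) ?L) ! (?r - 1) = ([Suc n] @ drop (?k - 1) ?L) ! (?r - 1 - (?k - 1))"
        unfolding nth_append[of "take (?k - 1) ?L"] lt using nl(1) by simp
      also have "\<dots> = drop (?k - 1) ?L ! (?r - 1 - (?k - 1) - 1)"
        using nl(2) by (simp only: append.simps nth_Cons' if_False)
      also have "\<dots> = i" using dr IH[OF i'] c by simp
      finally show ?thesis .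
    qed
  qed
  then show ?case using len k by simp
qed simp

lemma eraser_perm_inv_ranks:
  assumes u: "generic u" and i: "i \<in> {1..n}"
  shows "eraser_perm_inv (eraser_of_U u) n i = cnt u n (u i)"
  unfolding eraser_perm_inv_def
proof (rule the_equality)
  show "cnt u n (u i) \<in> {1..n} \<and> eraser_perm (eraser_of_U u) n ! (cnt u n (u i) - 1) = i"
    using eraser_perm_ranks[OF u, of n] cnt_self_range[OF i] i by blast
  fix j assume j: "j \<in> {1..n} \<and> eraser_perm (eraser_of_U u) n ! (j - 1) = i"
  then obtain l where l: "l \<in> {1..n}" "j = cnt u n (u l)" using cnt_self_surj[OF u, of n] by (metis imageE)
  then have "l = i" using eraser_perm_ranks[OF u, of n] j by metis
  then show "j = cnt u n (u i)" using l by simp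
qed

text \<open>Index 0 has no influence because the first insertion goes into the empty list. This
  allows eraser sequences to be restricted to \<open>{1..}\<close>, as the product space
  requires.\<close>

lemma eraser_perm_cong:
  assumes "\<And>k. 1 \<le> k \<Longrightarrow> e k = e' k"
  shows "eraser_perm e n = eraser_perm e' n"
proof (induction n)
  case (Suc n)
  then show ?case using assms[of n] by (cases "n = 0") auto
qed simp

lemma U_of_eraser_cong:
  assumes "\<And>k. 1 \<le> k \<Longrightarrow> e k = e' k"
  shows "U_of_eraser e i = U_of_eraser e' i"
proof -
  have "eraser_perm e n = eraser_perm e' n" for n by (rule eraser_perm_cong) (rule assms)
  then show ?thesis by (simp add: U_of_eraser_def eraser_perm_inv_def)
qed

text \<open>The position of \<open>i\<close> in the permutation, divided by \<open>n\<close>, is the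
  empirical distribution function at \<open>u i\<close>, and this tends to
  \<open>u i\<close>.\<close>

lemma U_of_eraser_of_U:
  assumes u: "nice u" and i: "1 \<le> i"
  shows "U_of_eraser (eraser_of_U u) i = u i"
proof -
  have g: "generic u" using u by (simp add: nice_def)
  have "(\<lambda>n. real (eraser_perm_inv (eraser_of_U u) n i) / real n) \<longlonglongrightarrow> u i"
  proof (rule LIMSEQ_I)
    fix r :: real assume r: "0 < r"
    obtain N where N: "\<And>n. N \<le> n \<Longrightarrow> disc u n (r/2)" using nice_disc[OF u, of "r/2"] r by auto
    have "norm (real (eraser_perm_inv (eraser_of_U u) n i) / real n - u i) < r" if "max N i \<le> n" for n
    proof -
      have "i \<in> {1..n}" using that i by auto
      moreover have "u i \<in> {0..1}" using g i by (auto simp: generic_def less_imp_le)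
      ultimately show ?thesis using discD[OF N, of n "u i"] that r by (simp add: eraser_perm_inv_ranks[OF g])
    qed
    then show "\<exists>no. \<forall>n\<ge>no. norm (real (eraser_perm_inv (eraser_of_U u) n i) / real n - u i) < r" by blast
  qed
  then show ?thesis unfolding U_of_eraser_def by (rule limI)
qed

lemma order_stat_cong: "(\<And>i. i \<in> {1..n} \<Longrightarrow> u i = v i) \<Longrightarrow> order_stat u n = order_stat v n"
proof -
  assume *: "\<And>i. i \<in> {1..n} \<Longrightarrow> u i = v i"
  have "map u [1..<Suc n] = map v [1..<Suc n]" by (rule map_cong) (use * in auto)
  then show "order_stat u n = order_stat v n" by (simp only: order_stat_def[abs_def])
qed

section \<open>Rational rectangles determine compact sets\<close>

lemma rational_rectangle:
  fixes x y :: real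
  assumes "0 < e"
  obtains q1 q2 r1 r2 :: rat where "of_rat q1 < x" "x < of_rat q2" "of_rat r1 < y" "y < of_rat r2"
    "x - e < of_rat q1" "of_rat q2 < x + e" "y - e < of_rat r1" "of_rat r2 < y + e"
proof -
  have "x - e < x" "x < x + e" "y - e < y" "y < y + e" using assms by auto
  then show ?thesis using of_rat_dense[of "x - e" x] of_rat_dense[of x "x + e"] of_rat_dense[of "y - e" y] of_rat_dense[of y "y + e"] that
    by metis
qed

text \<open>A point of \<open>K\<close> outside \<open>L\<close> has a positive distance from
  \<open>L\<close>. A rational rectangle around it that extends by less than half this distance in
  each direction misses \<open>L\<close>.\<close>

lemma InSy_inf_eqI:
  assumes K: "K \<in> InSy_inf" and L: "L \<in> InSy_inf"
    and hit: "\<And>q1 q2 r1 r2 :: rat. K \<inter> {of_rat q1<..<of_rat q2} \<times> {of_rat r1<..<of_rat r2} = {} \<longleftrightarrow>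
      L \<inter> {of_rat q1<..<of_rat q2} \<times> {of_rat r1<..<of_rat r2} = {}"
  shows "K = L"
proof -
  have sub: "K \<subseteq> L" if L: "L \<in> InSy_inf" and hit: "\<And>q1 q2 r1 r2 :: rat. L \<inter> {of_rat q1<..<of_rat q2} \<times> {of_rat r1<..<of_rat r2} = {} \<Longrightarrow>
      K \<inter> {of_rat q1<..<of_rat q2} \<times> {of_rat r1<..<of_rat r2} = {}" for K L
  proof
    fix p assume p: "p \<in> K"
    obtain q where q: "q \<in> L" "(INF r\<in>L. l1_dist p r) = l1_dist p q" "\<And>r. r \<in> L \<Longrightarrow> l1_dist p q \<le> l1_dist p r"
      using INF_l1_dist_attained[OF L] by metis
    have "l1_dist p q = 0"
    proof (rule ccontr)
      assume "l1_dist p q \<noteq> 0"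
      then have e: "0 < l1_dist p q / 2" using l1_dist_nonneg[of p q] by simp
      obtain q1 q2 r1 r2 :: rat where b: "of_rat q1 < fst p" "fst p < of_rat q2" "of_rat r1 < snd p" "snd p < of_rat r2"
        "fst p - l1_dist p q / 2 < of_rat q1" "of_rat q2 < fst p + l1_dist p q / 2"
        "snd p - l1_dist p q / 2 < of_rat r1" "of_rat r2 < snd p + l1_dist p q / 2"
        by (rule rational_rectangle[OF e])
      have "p \<in> K \<inter> {of_rat q1<..<of_rat q2} \<times> {of_rat r1<..<of_rat r2}" using p b by (cases p) auto
      then obtain r where r: "r \<in> L" "r \<in> {of_rat q1<..<of_rat q2} \<times> {of_rat r1<..<of_rat r2}" using hit by blast
      then have r': "of_rat q1 < fst r" "fst r < of_rat q2" "of_rat r1 < snd r" "snd r < of_rat r2" by (cases r; auto)+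
      have "\<bar>fst p - fst r\<bar> < l1_dist p q / 2" "\<bar>snd p - snd r\<bar> < l1_dist p q / 2"
        using b r' by linarith+
      then have "l1_dist p r < l1_dist p q" unfolding l1_dist_def[of p r] by linarith
      then show False using q(3)[OF r(1)] by simp
    qed
    then show "p \<in> L" using q(1) by (simp add: l1_dist_eq_0)
  qed
  show ?thesis using sub[OF L, of K] sub[OF K, of L] hit by blast
qed

section \<open>Borel structure of the path space and of the limit space\<close>

section \<open>The space of paths\<close>

definition paths :: "path set" where
  "paths = (\<Pi>\<^sub>E n\<in>{1..}. InSy n \<times> {1..n + 1})"

lemma topspace_path_topology: "topspace path_topology = paths"
  by (simp add: path_topology_def paths_def)

lemma space_borel_of: "space (borel_of X) = topspace X"
  unfolding borel_of_def by (rule space_measure_of) (auto dest: openin_subset)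

lemma sets_borel_of: "sets (borel_of X) = sigma_sets (topspace X) {U. openin X U}"
  unfolding borel_of_def by (rule sets_measure_of) (auto dest: openin_subset)

lemma openin_sets_borel_of: "openin X U \<Longrightarrow> U \<in> sets (borel_of X)"
  by (simp add: sets_borel_of sigma_sets.Basic)

lemma space_path_space: "space path_space = paths"
  by (simp add: space_borel_of topspace_path_topology)

definition cyl :: "nat \<Rightarrow> path \<Rightarrow> path set" where
  "cyl n g = {f \<in> paths. \<forall>i\<in>{1..n}. f i = g i}"

text \<open>An intersection-stable generator of the Borel sets of paths. It is countable because
  each level has finitely many values; the empty set is added since two cylinders may be
  disjoint.\<close>

definition cyls :: "path set set" where
  "cyls = insert {} {cyl n g | n g. g \<in> (\<Pi>\<^sub>E i\<in>{1..n}. InSy i \<times> {1..i + 1})}"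

lemma countable_cyls: "countable cyls"
proof -
  have "{cyl n g | n g. g \<in> (\<Pi>\<^sub>E i\<in>{1..n}. InSy i \<times> {1..i + 1})} =
      (\<Union>n. cyl n ` (\<Pi>\<^sub>E i\<in>{1..n}. InSy i \<times> {1..i + 1}))" by auto
  moreover have "countable (\<Pi>\<^sub>E i\<in>{1..n}. InSy i \<times> {1..i + 1})" for n :: nat
    by (intro countable_finite finite_PiE) (auto simp: finite_InSy)
  ultimately show ?thesis unfolding cyls_def by simp
qed

lemma cyl_of_path:
  assumes "f \<in> paths"
  shows "f \<in> cyl n f" "cyl n f \<in> cyls"
proof -
  show "f \<in> cyl n f" using assms by (simp add: cyl_def)
  have "restrict f {1..n} \<in> (\<Pi>\<^sub>E i\<in>{1..n}. InSy i \<times> {1..i + 1})" using assms unfolding paths_def by (fastforce simp: PiE_iff)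
  moreover have "cyl n f = cyl n (restrict f {1..n})" by (auto simp: cyl_def)
  ultimately show "cyl n f \<in> cyls" unfolding cyls_def by blast
qed

lemma Int_stable_cyls: "Int_stable cyls"
proof -
  have *: "cyl n g \<inter> cyl m h \<in> cyls" if "h \<in> (\<Pi>\<^sub>E i\<in>{1..m}. InSy i \<times> {1..i + 1})" "n \<le> m" for n m g h
  proof (cases "\<forall>i\<in>{1..n}. g i = h i")
    case True
    then have "cyl n g \<inter> cyl m h = cyl m h" using that(2) by (fastforce simp: cyl_def)
    then show ?thesis using that(1) unfolding cyls_def by auto
  next
    case False
    then have "cyl n g \<inter> cyl m h = {}" using that(2) by (force simp: cyl_def)
    then show ?thesis by (simp add: cyls_def)
  qed
  show ?thesis
  proof (rule Int_stableI)
    fix A B assume "A \<in> cyls" "B \<in> cyls"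
    then consider "A = {} \<or> B = {}" | n g m h where "A = cyl n g" "B = cyl m h"
      "g \<in> (\<Pi>\<^sub>E i\<in>{1..n}. InSy i \<times> {1..i + 1})" "h \<in> (\<Pi>\<^sub>E i\<in>{1..m}. InSy i \<times> {1..i + 1})"
      unfolding cyls_def by blast
    then show "A \<inter> B \<in> cyls"
    proof cases
      case 1
      then show ?thesis by (auto simp: cyls_def)
    next
      case 2
      then show ?thesis using *[of h m n g] *[of g n m h] by (cases "n \<le> m") (auto simp: Int_commute)
    qed
  qed
qed

lemma openin_path_coord: "1 \<le> n \<Longrightarrow> openin path_topology {f \<in> paths. f n \<in> A}"
proof -
  assume n: "1 \<le> n"
  have "continuous_map path_topology (discrete_topology (InSy n \<times> {1..n + 1})) (\<lambda>f. f n)"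
    unfolding path_topology_def using n by (intro continuous_map_product_projection) simp
  then have "openin path_topology {f \<in> topspace path_topology. f n \<in> A \<inter> (InSy n \<times> {1..n + 1})}"
    by (rule openin_continuous_map_preimage) simp
  moreover have "{f \<in> topspace path_topology. f n \<in> A \<inter> (InSy n \<times> {1..n + 1})} = {f \<in> paths. f n \<in> A}"
    using n unfolding topspace_path_topology by (auto simp: paths_def PiE_iff)
  ultimately show ?thesis by simp
qed

lemma openin_cyl: "openin path_topology (cyl n g)"
proof -
  have eq: "cyl n g = (if n = 0 then paths else paths \<inter> (\<Inter>i\<in>{1..n}. {f \<in> paths. f i \<in> {g i}}))"
    by (auto simp: cyl_def)
  have "openin path_topology (\<Inter>i\<in>{1..n}. {f \<in> paths. f i \<in> {g i}})" if "n \<noteq> 0"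
    using that by (intro openin_INT2 openin_path_coord) auto
  moreover have "openin path_topology paths"
    using openin_topspace[of path_topology] by (simp only: topspace_path_topology)
  ultimately show ?thesis unfolding eq by (simp only: openin_Int split: if_split) blast
qed

lemma open_paths_cyl:
  assumes U: "openin path_topology U" and f: "f \<in> U"
  obtains n where "cyl n f \<subseteq> U"
proof -
  obtain V where V: "finite {i \<in> {1..}. V i \<noteq> topspace (discrete_topology (InSy i \<times> {1..i + 1}))}"
    "f \<in> Pi\<^sub>E {1..} V" "Pi\<^sub>E {1..} V \<subseteq> U"
    using U[unfolded path_topology_def openin_product_topology_alt, THEN bspec, OF f] by blast
  \<comment> \<open>The element 1 is inserted because the set of restricted coordinates may be
    empty.\<close>
  define n where "n = Max (insert 1 {i \<in> {1..}. V i \<noteq> topspace (discrete_topology (InSy i \<times> {1..i + 1}))})"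
  have n: "V i = InSy i \<times> {1..i + 1}" if "n < i" for i
  proof (rule ccontr)
    assume "V i \<noteq> InSy i \<times> {1..i + 1}"
    moreover have "1 \<le> n" unfolding n_def using V(1) by (intro Max_ge) auto
    ultimately have "i \<le> n" unfolding n_def using that V(1) by (intro Max_ge) auto
    with that show False by simp
  qed
  have "cyl n f \<subseteq> Pi\<^sub>E {1..} V"
  proof
    fix h assume h: "h \<in> cyl n f"
    have *: "h i \<in> V i" if "i \<in> {1..}" for i
    proof (cases "i \<le> n")
      case True
      then have "h i = f i" using h that by (simp add: cyl_def)
      then show ?thesis using V(2) that by (auto simp: PiE_iff)
    next
      case False
      then show ?thesis using n[of i] h that by (simp add: cyl_def paths_def PiE_iff)
    qed
    have "h \<in> extensional {1..}" using h by (simp add: cyl_def paths_def PiE_iff)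
    then show "h \<in> Pi\<^sub>E {1..} V" using * unfolding PiE_iff by blast
  qed
  then show ?thesis using V(3) that by blast
qed

lemma cyls_subset: "cyls \<subseteq> Pow paths"
  by (auto simp: cyls_def cyl_def)

text \<open>An open set contains a cylinder around each of its paths, so it is a countable union of
  cylinders.\<close>

lemma sets_path_space: "sets path_space = sigma_sets paths cyls"
proof -
  have "sigma_sets paths {U. openin path_topology U} = sigma_sets paths cyls"
  proof (rule sigma_sets_eqI)
    fix U assume "U \<in> {U. openin path_topology U}"
    then have U: "openin path_topology U" by simp
    then have sub: "U \<subseteq> paths" using openin_subset topspace_path_topology by blast
    have "U = \<Union>{C \<in> cyls. C \<subseteq> U}"
    proof (intro equalityI subsetI)
      fix f assume f: "f \<in> U"
      obtain n where n: "cyl n f \<subseteq> U" using open_paths_cyl[OF U f] by blast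
      have "f \<in> paths" using f sub by blast
      then show "f \<in> \<Union>{C \<in> cyls. C \<subseteq> U}" using cyl_of_path[of f n] n by blast
    qed blast
    moreover have "\<Union>{C \<in> cyls. C \<subseteq> U} \<in> sigma_sets paths cyls"
      by (rule sigma_sets_UNION) (auto intro: countable_subset[OF _ countable_cyls])
    ultimately show "U \<in> sigma_sets paths cyls" by simp
  next
    fix C assume "C \<in> cyls"
    then show "C \<in> sigma_sets paths {U. openin path_topology U}"
      unfolding cyls_def using openin_cyl by (auto intro: sigma_sets.Basic sigma_sets.Empty)
  qed
  then show ?thesis by (simp add: sets_borel_of topspace_path_topology)
qed

lemma measurable_path_coord:
  assumes "1 \<le> n"
  shows "(\<lambda>f. f n) \<in> path_space \<rightarrow>\<^sub>M count_space UNIV"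
proof (rule measurableI)
  fix A :: "(nat set set \<times> nat) set"
  have "(\<lambda>f. f n) -` A \<inter> space path_space = {f \<in> paths. f n \<in> A}" by (auto simp: space_path_space)
  then show "(\<lambda>f. f n) -` A \<inter> space path_space \<in> sets path_space"
    using openin_sets_borel_of[OF openin_path_coord[OF assms]] by simp
qed simp

lemma measurable_pathI:
  assumes sp: "\<And>\<omega>. \<omega> \<in> space M \<Longrightarrow> f \<omega> \<in> paths"
    and m: "\<And>n. 1 \<le> n \<Longrightarrow> (\<lambda>\<omega>. f \<omega> n) \<in> M \<rightarrow>\<^sub>M count_space UNIV"
  shows "f \<in> M \<rightarrow>\<^sub>M path_space"
proof (rule measurable_sigma_sets[OF sets_path_space cyls_subset])
  show "f \<in> space M \<rightarrow> paths" using sp by blast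
  fix C assume "C \<in> cyls"
  then consider "C = {}" | n g where "C = cyl n g" unfolding cyls_def by blast
  then show "f -` C \<inter> space M \<in> sets M"
  proof cases
    case 2
    have "f -` C \<inter> space M = {\<omega> \<in> space M. \<forall>i\<in>{1..n}. f \<omega> i = g i}"
      using sp by (auto simp: 2 cyl_def)
    moreover have "{\<omega> \<in> space M. f \<omega> i = g i} \<in> sets M" if "i \<in> {1..n}" for i
    proof -
      have "(\<lambda>\<omega>. f \<omega> i) -` {g i} \<inter> space M \<in> sets M" using that by (intro measurable_sets[OF m]) auto
      then show ?thesis by (simp add: vimage_def Int_def conj_commute)
    qed
    ultimately show ?thesis by (simp add: sets.sets_Collect_finite_All)
  qed simp
qed

section \<open>Borel structure of the limit space\<close>

abbreviation BIS :: "(real \<times> real) set measure" where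
  "BIS \<equiv> borel_of InSy_inf_topology"

lemma space_BIS: "space BIS = InSy_inf"
  by (simp add: space_borel_of)

text \<open>A compact set close to \<open>K\<close> in the Hausdorff distance has a point close to
  the point of \<open>K\<close> in \<open>R\<close>. Measurability in the compact set is later
  reduced to such events with rational rectangles.\<close>

lemma openin_hit:
  assumes "open R"
  shows "openin InSy_inf_topology {K \<in> InSy_inf. K \<inter> R \<noteq> {}}"
  unfolding IS.openin_mtopology
proof (intro conjI allI impI)
  fix K assume "K \<in> {K \<in> InSy_inf. K \<inter> R \<noteq> {}}"
  then obtain p where K: "K \<in> InSy_inf" and p: "p \<in> K" "p \<in> R" by blast
  obtain e where e: "0 < e" "ball p e \<subseteq> R" using assms p(2) open_contains_ball by blast
  have "IS.mball K e \<subseteq> {K \<in> InSy_inf. K \<inter> R \<noteq> {}}"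
  proof
    fix L assume "L \<in> IS.mball K e"
    then have L: "L \<in> InSy_inf" "d_haus K L < e" by auto
    obtain q where q: "q \<in> L" "l1_dist p q \<le> d_haus K L" using d_haus_near[OF K L(1) p(1)] by metis
    have "dist p q \<le> l1_dist p q"
      unfolding l1_dist_def dist_prod_def by (rule order_trans[OF sqrt_sum_squares_le_sum_abs]) (auto simp: dist_real_def)
    then have "q \<in> ball p e" using q L by auto
    then show "L \<in> {K \<in> InSy_inf. K \<inter> R \<noteq> {}}" using q e L by blast
  qed
  then show "\<exists>r>0. IS.mball K r \<subseteq> {K \<in> InSy_inf. K \<inter> R \<noteq> {}}" using e(1) by blast
qed blast

lemma measurable_hit: "open R \<Longrightarrow> {K \<in> InSy_inf. K \<inter> R \<noteq> {}} \<in> sets BIS"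
  by (intro openin_sets_borel_of openin_hit)

section \<open>Almost sure properties of uniform points and measurability of the sampling
  map\<close>

section \<open>The law of a \<open>U\<close>-process\<close>

abbreviation unif :: "real measure" where
  "unif \<equiv> uniform_measure lborel {0..1}"

lemma prob_space_unif: "prob_space unif"
  by (rule prob_space_uniform_measure) auto

lemma sets_unif [measurable_cong]: "sets unif = sets borel"
  by simp

lemma emeasure_unif_singleton: "emeasure unif {s} = 0"
proof -
  have "emeasure lborel ({0..1} \<inter> {s}) \<le> emeasure lborel {s}" by (rule emeasure_mono) auto
  then show ?thesis by (subst emeasure_uniform_measure) auto
qed

lemma prob_space_U_measure: "prob_space U_measure"
  unfolding U_measure_def by (intro prob_space_PiM prob_space_unif)

interpretation UM: prob_space U_measure
  by (rule prob_space_U_measure)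

lemma space_U_measure: "space U_measure = extensional {1..}"
  by (auto simp: U_measure_def space_PiM PiE_UNIV_domain PiE_def)

lemma sets_U_measure: "sets U_measure = sets (\<Pi>\<^sub>M i\<in>{1..}. borel)"
  unfolding U_measure_def by (rule sets_PiM_cong) auto

lemma measurable_U_coord: "1 \<le> i \<Longrightarrow> (\<lambda>u. u i) \<in> borel_measurable U_measure"
  by (subst measurable_cong_sets[OF sets_U_measure refl]) (rule measurable_component_singleton, simp)

lemma distr_U_coord: "1 \<le> i \<Longrightarrow> distr U_measure unif (\<lambda>u. u i) = unif"
  unfolding U_measure_def by (rule distr_PiM_component) (auto intro: prob_space_unif)

text \<open>Each line in the direction of coordinate \<open>i\<close> meets \<open>B\<close> in at
  most one point, and the uniform law has no atoms. Integrating over that coordinate first gives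
  zero.\<close>

lemma U_coord_null:
  assumes i: "1 \<le> i" and B: "B \<in> sets U_measure"
    and one: "\<And>u s t. u \<in> extensional {1..} \<Longrightarrow> u(i := s) \<in> B \<Longrightarrow> u(i := t) \<in> B \<Longrightarrow> s = t"
  shows "B \<in> null_sets U_measure"
proof -
  let ?N = "\<Pi>\<^sub>M j\<in>{1..} - {i}. unif"
  have ins: "insert i ({1..} - {i}) = {1..}" using i by auto
  have eq: "distr (unif \<Otimes>\<^sub>M ?N) U_measure (\<lambda>(x, X). X(i := x)) = U_measure"
    using distr_pair_PiM_eq_PiM[of "{1..} - {i}" "\<lambda>_. unif" i] prob_space_unif unfolding ins U_measure_def by simp
  interpret u: prob_space unif by (rule prob_space_unif)
  interpret N: prob_space ?N by (intro prob_space_PiM prob_space_unif)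
  interpret pair_sigma_finite unif ?N ..
  have m: "(\<lambda>(x, X). X(i := x)) \<in> (unif \<Otimes>\<^sub>M ?N) \<rightarrow>\<^sub>M U_measure"
    using measurable_add_dim[of i "{1..} - {i}" "\<lambda>_. unif"] unfolding ins U_measure_def
    by (subst (asm) measurable_pair_swap_iff) (simp add: case_prod_unfold)
  have "emeasure U_measure B = emeasure (distr (unif \<Otimes>\<^sub>M ?N) U_measure (\<lambda>(x, X). X(i := x))) B"
    by (simp only: eq)
  also have "\<dots> = emeasure (unif \<Otimes>\<^sub>M ?N) ((\<lambda>(x, X). X(i := x)) -` B \<inter> space (unif \<Otimes>\<^sub>M ?N))"
    by (rule emeasure_distr[OF m B])
  also have "\<dots> = (\<integral>\<^sup>+X. emeasure unif ((\<lambda>x. (x, X)) -` ((\<lambda>(x, X). X(i := x)) -` B \<inter> space (unif \<Otimes>\<^sub>M ?N))) \<partial>?N)"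
    by (rule emeasure_pair_measure_alt2) (rule measurable_sets[OF m B])
  also have "\<dots> = (\<integral>\<^sup>+X. 0 \<partial>?N)"
  proof (rule nn_integral_cong)
    fix X assume X: "X \<in> space ?N"
    let ?S = "(\<lambda>x. (x, X)) -` ((\<lambda>(x, X). X(i := x)) -` B \<inter> space (unif \<Otimes>\<^sub>M ?N))"
    have ext: "X \<in> extensional {1..}" using X i by (auto simp: space_PiM PiE_def extensional_def)
    have S: "?S \<subseteq> {x. X(i := x) \<in> B}" by auto
    show "emeasure unif ?S = 0"
    proof (cases "?S = {}")
      case False
      then obtain s where "X(i := s) \<in> B" using S by blast
      then have "?S \<subseteq> {s}" using S one[OF ext] by blast
      then have "emeasure unif ?S \<le> emeasure unif {s}" by (intro emeasure_mono) auto
      then show ?thesis by (simp add: emeasure_unif_singleton)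
    qed simp
  qed
  finally show ?thesis using B by auto
qed

lemma U_coord_AE:
  assumes i: "1 \<le> i" and P: "Measurable.pred U_measure P"
    and one: "\<And>u s t. u \<in> extensional {1..} \<Longrightarrow> \<not> P (u(i := s)) \<Longrightarrow> \<not> P (u(i := t)) \<Longrightarrow> s = t"
  shows "AE u in U_measure. P u"
proof -
  have "{u \<in> space U_measure. \<not> P u} \<in> null_sets U_measure"
    using P by (intro U_coord_null[OF i]) (auto intro: one)
  then show ?thesis by (rule AE_I') auto
qed

lemma cnt_sum: "real (cnt u n x) = (\<Sum>j\<in>{1..n}. indicator {..x} (u j))"
proof -
  have "(\<Sum>j\<in>{1..n}. indicator {..x} (u j)) = real (card {j \<in> {1..n}. u j \<le> x})"
    by (simp add: indicator_def of_bool_def sum.If_cases Int_def)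
  then show ?thesis by (simp add: cnt_def)
qed

lemma measurable_cnt:
  assumes [measurable]: "\<And>i. 1 \<le> i \<Longrightarrow> (\<lambda>\<omega>. u \<omega> i) \<in> borel_measurable M" "x \<in> borel_measurable M"
  shows "(\<lambda>\<omega>. cnt (u \<omega>) n (x \<omega>)) \<in> M \<rightarrow>\<^sub>M count_space UNIV"
proof -
  have "cnt (u \<omega>) n (x \<omega>) = (\<Sum>j\<in>{1..n}. if u \<omega> j \<le> x \<omega> then 1 else 0)" for \<omega>
    by (simp add: cnt_def sum.If_cases Int_def)
  moreover have "(\<lambda>\<omega>. \<Sum>j\<in>{1..n}. if u \<omega> j \<le> x \<omega> then 1 else 0 :: nat) \<in> M \<rightarrow>\<^sub>M count_space UNIV"
    by measurable
  ultimately show ?thesis by simp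
qed

lemma measurable_eraser_of_U:
  assumes [measurable]: "\<And>i. 1 \<le> i \<Longrightarrow> (\<lambda>\<omega>. u \<omega> i) \<in> borel_measurable M"
  shows "(\<lambda>\<omega>. eraser_of_U (u \<omega>) n) \<in> M \<rightarrow>\<^sub>M count_space UNIV"
  unfolding eraser_of_U_eq by (intro measurable_cnt) auto

text \<open>Hoeffding's inequality bounds the deviation probabilities by a geometric sequence, and
  the Borel-Cantelli lemma turns this into almost sure convergence.\<close>

lemma U_lln:
  assumes q: "0 \<le> q" "q \<le> 1"
  shows "AE u in U_measure. (\<lambda>n. real (cnt u n q) / real n) \<longlonglongrightarrow> q"
proof -
  let ?X = "\<lambda>j u. indicator {..q} (u j) :: real"
  have mX: "?X j \<in> borel_measurable U_measure" if "1 \<le> j" for j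
    using measurable_U_coord[OF that] by measurable
  have ind: "UM.indep_vars (\<lambda>_. unif) (\<lambda>j u. u j) {1..n}" if "1 \<le> n" for n :: nat
  proof (subst UM.indep_vars_iff_distr_eq_PiM')
    show "{1..n} \<noteq> {}" using that by simp
    show "(\<lambda>u. u i) \<in> U_measure \<rightarrow>\<^sub>M unif" if "i \<in> {1..n}" for i
      using measurable_U_coord[of i] that by (simp cong: measurable_cong_sets)
    have "distr U_measure (\<Pi>\<^sub>M i\<in>{1..n}. unif) (\<lambda>u. \<lambda>i\<in>{1..n}. u i) = (\<Pi>\<^sub>M i\<in>{1..n}. unif)"
      unfolding U_measure_def using distr_PiM_reindex[of "{1..}" "\<lambda>_. unif" "\<lambda>i. i" "{1..n}"] prob_space_unif by auto
    also have "\<dots> = (\<Pi>\<^sub>M i\<in>{1..n}. distr U_measure unif (\<lambda>u. u i))"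
      by (intro PiM_cong) (auto simp: distr_U_coord)
    finally show "distr U_measure (\<Pi>\<^sub>M i\<in>{1..n}. unif) (\<lambda>u. \<lambda>i\<in>{1..n}. u i) = (\<Pi>\<^sub>M i\<in>{1..n}. distr U_measure unif (\<lambda>u. u i))" .
  qed
  have dX: "distr U_measure borel (?X j) = distr unif borel (indicator {..q})" if "1 \<le> j" for j
  proof -
    have "distr U_measure borel (?X j) = distr (distr U_measure unif (\<lambda>u. u j)) borel (indicator {..q})"
      using measurable_U_coord[OF that] by (subst distr_distr) (auto simp: comp_def cong: measurable_cong_sets)
    then show ?thesis by (simp add: distr_U_coord[OF that])
  qed
  have EX: "UM.expectation (?X 1) = q"
  proof -
    have "UM.expectation (?X 1) = integral\<^sup>L (distr U_measure borel (?X 1)) (\<lambda>x. x)"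
      using mX[of 1] by (subst integral_distr) auto
    also have "\<dots> = integral\<^sup>L unif (indicator {..q})"
    proof -
      have [measurable]: "(indicator {..q} :: real \<Rightarrow> real) \<in> borel_measurable unif" by (rule borel_measurable_indicator) simp
      show ?thesis unfolding dX[OF order_refl] by (subst integral_distr) auto
    qed
    also have "\<dots> = measure unif {..q}" by simp
    also have "\<dots> = measure lborel ({0..1} \<inter> {..q}) / measure lborel {0..1::real}"
      by (rule measure_uniform_measure) auto
    also have "{0..1} \<inter> {..q} = {0..q}" using q by auto
    finally show ?thesis using q by simp
  qed
  have bound: "UM.prob {u \<in> space U_measure. \<bar>real (cnt u n q) / real n - q\<bar> \<ge> e} \<le> 2 * exp (-2 * real n * e\<^sup>2)"
    if n: "1 \<le> n" and e: "0 < e" for n :: nat and e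
  proof -
    interpret H: Hoeffding_ineq_iid U_measure "{1..n}" ?X "?X 1" 0 1 q
    proof unfold_locales
      show "UM.indep_vars (\<lambda>_. borel) ?X {1..n}"
        by (rule UM.indep_vars_compose2[OF ind[OF n]]) measurable
      show "distr U_measure borel (?X i) = distr U_measure borel (?X 1)" if "i \<in> {1..n}" for i
        using that dX[of i] dX[of 1] by simp
      show "?X 1 \<in> borel_measurable U_measure" by (rule mX) simp
      show "AE x in U_measure. ?X 1 x \<in> {0..1}" by (auto simp: indicator_def)
      show "q \<equiv> UM.expectation (?X 1)" using EX by simp
    qed simp
    show ?thesis using H.Hoeffding_ineq_abs_ge'[of e] e n by (simp add: cnt_sum)
  qed
  have ev: "AE u in U_measure. \<forall>\<^sub>F n in sequentially. \<bar>real (cnt u n q) / real n - q\<bar> < e" if e: "0 < e" for e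
  proof -
    let ?A = "\<lambda>n. {u \<in> space U_measure. \<bar>real (cnt u n q) / real n - q\<bar> \<ge> e}"
    have [measurable]: "(\<lambda>u. cnt u n q) \<in> U_measure \<rightarrow>\<^sub>M count_space UNIV" for n
      by (rule measurable_cnt) (auto intro: measurable_U_coord)
    have m: "?A n \<in> sets U_measure" for n by measurable
    have "summable (\<lambda>n. UM.prob (?A n))"
    proof (rule summable_comparison_test_ev)
      show "\<forall>\<^sub>F n in sequentially. norm (UM.prob (?A n)) \<le> 2 * exp (-2 * e\<^sup>2) ^ n"
        using eventually_ge_at_top[of 1]
      proof eventually_elim
        case (elim n)
        have "exp (-2 * e\<^sup>2) ^ n = exp (-2 * real n * e\<^sup>2)" by (simp add: exp_of_nat_mult[symmetric] mult_ac)
        then show ?case using bound[OF elim e] by simp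
      qed
      show "summable (\<lambda>n. 2 * exp (-2 * e\<^sup>2) ^ n)" using e by (intro summable_mult summable_geometric) simp
    qed
    then have "AE u in U_measure. \<forall>\<^sub>F n in sequentially. u \<in> space U_measure - ?A n"
      by (intro borel_cantelli_AE1 m) (auto simp: less_top[symmetric])
    then show ?thesis by eventually_elim (auto elim!: eventually_mono)
  qed
  have "AE u in U_measure. \<forall>k. \<forall>\<^sub>F n in sequentially. \<bar>real (cnt u n q) / real n - q\<bar> < inverse (real (Suc k))"
    unfolding AE_all_countable by (intro allI ev) simp
  then show ?thesis
  proof eventually_elim
    case (elim u)
    show ?case
    proof (rule LIMSEQ_I)
      fix r :: real assume "0 < r"
      then obtain k where "inverse (real (Suc k)) < r" using reals_Archimedean by blast
      then have "\<forall>\<^sub>F n in sequentially. \<bar>real (cnt u n q) / real n - q\<bar> < r"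
        using elim[rule_format, of k] by (auto elim!: eventually_mono)
      then show "\<exists>no. \<forall>n\<ge>no. norm (real (cnt u n q) / real n - q) < r" by (simp add: eventually_sequentially)
    qed
  qed
qed

lemma fine_grid:
  fixes e :: real
  assumes e: "0 < e"
  obtains k :: nat where "0 < k" "1 / real k < e / 2"
proof -
  obtain k :: nat where k: "2 / e < real k" using reals_Archimedean2 by blast
  have "0 < 2 / e" using e by simp
  then have "0 < k" using k by (metis of_nat_0_less_iff order_less_trans)
  moreover from this have "1 / real k < e / 2" using k e by (simp add: field_simps)
  ultimately show ?thesis by (rule that)
qed

text \<open>Polya: by monotonicity it is enough to control the empirical distribution function on a finite grid.\<close>

lemma disc_of_grid:
  assumes k: "0 < k" and ke: "1 / real k < e / 2"
    and grid: "\<And>j. j \<le> k \<Longrightarrow> \<bar>real (cnt u n (real j / real k)) / real n - real j / real k\<bar> < e / 2"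
  shows "disc u n e"
  unfolding disc_def
proof
  let ?g = "\<lambda>j::nat. real j / real k"
  have k0: "0 < real k" using k by simp
  fix x :: real assume x: "x \<in> {0..1}"
  define j where "j = nat \<lfloor>x * real k\<rfloor>"
  have j: "real j \<le> x * real k" "x * real k < real j + 1" using x k0 by (auto simp: j_def)
  have lo: "?g j \<le> x" and hi: "x \<le> ?g (Suc j)" using j k0 by (auto simp: field_simps)
  have "x * real k \<le> 1 * real k" using x by (intro mult_right_mono) auto
  then have "real j \<le> real k" using j(1) by linarith
  then have jk: "j \<le> k" by simp
  define F where "F y = real (cnt u n y) / real n" for y
  define g where "g i = ?g i" for i
  define h where "h = 1 / real k"
  have F: "F y \<le> F z" if "y \<le> z" for y z
    unfolding F_def using that by (intro divide_right_mono) (auto intro: cnt_mono)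
  have NF: "\<bar>F (g i) - g i\<bar> < e / 2" if "i \<le> k" for i
    unfolding F_def g_def using grid[OF that] .
  have gS: "g (Suc j) = g j + h" by (simp add: g_def h_def add_divide_distrib)
  have h: "0 \<le> h" "h < e / 2" using ke by (auto simp: h_def)
  have lo: "g j \<le> x" and hi: "x \<le> g j + h" using lo hi gS by (auto simp: g_def)
  have up: "F x \<le> g j + h + e / 2"
  proof (cases "j = k")
    case True
    then have "g j = 1" using k0 by (simp add: g_def)
    then have "F x = F (g j)" using lo x by simp
    then show ?thesis using NF[OF jk] h by linarith
  next
    case False
    then have "\<bar>F (g j + h) - (g j + h)\<bar> < e / 2" using jk NF[of "Suc j"] gS by simp
    then show ?thesis using F[OF hi] by linarith
  qed
  have "\<bar>F x - x\<bar> \<le> e"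
    using NF[OF jk] F[OF lo] up lo hi h by linarith
  then show "\<bar>real (cnt u n x) / real n - x\<bar> \<le> e" by (simp add: F_def)
qed

lemma disc_of_rationals:
  assumes conv: "\<And>q :: rat. 0 \<le> (of_rat q :: real) \<Longrightarrow> of_rat q \<le> (1 :: real) \<Longrightarrow> (\<lambda>n. real (cnt u n (of_rat q)) / real n) \<longlonglongrightarrow> of_rat q"
    and e: "0 < e"
  shows "\<exists>N. \<forall>n\<ge>N. disc u n e"
proof -
  obtain k where k0: "0 < k" and ke: "1 / real k < e / 2" by (rule fine_grid[OF e])
  let ?g = "\<lambda>j::nat. real j / real k"
  have "\<forall>\<^sub>F n in sequentially. \<bar>real (cnt u n (?g j)) / real n - ?g j\<bar> < e / 2" if "j \<le> k" for j
  proof -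
    have "(\<lambda>n. real (cnt u n (?g j)) / real n) \<longlonglongrightarrow> ?g j"
      using conv[of "of_nat j / of_nat k"] that k0 by (simp add: of_rat_divide divide_le_eq_1)
    then show ?thesis using e by (auto simp: tendsto_iff dist_real_def dest!: spec[of _ "e/2"])
  qed
  then have "\<forall>\<^sub>F n in sequentially. \<forall>j\<in>{..k}. \<bar>real (cnt u n (?g j)) / real n - ?g j\<bar> < e / 2"
    by (intro eventually_ball_finite) auto
  then obtain N where N: "\<And>n j. N \<le> n \<Longrightarrow> j \<le> k \<Longrightarrow> \<bar>real (cnt u n (?g j)) / real n - ?g j\<bar> < e / 2"
    unfolding eventually_sequentially by auto
  have "disc u n e" if n: "N \<le> n" for n by (rule disc_of_grid[OF k0 ke N[OF n]])
  then show ?thesis by blast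
qed

text \<open>Countably many conditions replace the bound over all \<open>x\<close> and all
  \<open>e\<close>, which makes the predicate measurable.\<close>

lemma nice_iff:
  "nice u \<longleftrightarrow> generic u \<and> (\<forall>q::rat. 0 \<le> (of_rat q :: real) \<and> of_rat q \<le> (1 :: real) \<longrightarrow>
     (\<forall>k. \<exists>N. \<forall>n\<ge>N. \<bar>real (cnt u n (of_rat q)) / real n - of_rat q\<bar> \<le> inverse (real (Suc k))))"
  (is "_ \<longleftrightarrow> generic u \<and> ?R")
proof
  assume u: "nice u"
  have ?R
  proof (intro allI impI)
    fix q :: rat and k :: nat assume q: "0 \<le> (of_rat q :: real) \<and> of_rat q \<le> (1 :: real)"
    obtain N where "\<And>n. N \<le> n \<Longrightarrow> disc u n (inverse (real (Suc k)))" using nice_disc[OF u, of "inverse (real (Suc k))"] by auto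
    then show "\<exists>N. \<forall>n\<ge>N. \<bar>real (cnt u n (of_rat q)) / real n - of_rat q\<bar> \<le> inverse (real (Suc k))"
      using q discD by (metis atLeastAtMost_iff)
  qed
  then show "generic u \<and> ?R" using u by (simp add: nice_def)
next
  assume r: "generic u \<and> ?R"
  have "(\<lambda>n. real (cnt u n (of_rat q)) / real n) \<longlonglongrightarrow> of_rat q" if "0 \<le> (of_rat q :: real)" "of_rat q \<le> (1 :: real)" for q :: rat
  proof (rule LIMSEQ_I)
    fix e :: real assume "0 < e"
    then obtain k where k: "inverse (real (Suc k)) < e" using reals_Archimedean by blast
    have "\<exists>N. \<forall>n\<ge>N. \<bar>real (cnt u n (of_rat q)) / real n - of_rat q\<bar> \<le> inverse (real (Suc k))" using r that by blast
    then show "\<exists>N. \<forall>n\<ge>N. norm (real (cnt u n (of_rat q)) / real n - of_rat q) < e"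
      using k unfolding real_norm_def by (meson order_le_less_trans)
  qed
  then show "nice u" unfolding nice_def using r disc_of_rationals[of u] by blast
qed

lemma generic_iff:
  "generic u \<longleftrightarrow> (\<forall>i. \<forall>j. 1 \<le> i \<longrightarrow> 1 \<le> j \<longrightarrow> i \<noteq> j \<longrightarrow> u i \<noteq> u j) \<and> (\<forall>i. 1 \<le> i \<longrightarrow> 0 < u i \<and> u i < 1)"
  unfolding generic_def inj_on_def by (auto simp: Ball_def)

lemma pred_generic:
  assumes "\<And>i. 1 \<le> i \<Longrightarrow> (\<lambda>\<omega>. u \<omega> i) \<in> borel_measurable M"
  shows "Measurable.pred M (\<lambda>\<omega>. generic (u \<omega>))"
proof -
  have [measurable]: "Measurable.pred M (\<lambda>\<omega>. 1 \<le> i \<longrightarrow> 1 \<le> j \<longrightarrow> i \<noteq> j \<longrightarrow> u \<omega> i \<noteq> u \<omega> j)" for i j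
  proof (cases "1 \<le> i \<and> 1 \<le> j")
    case True
    then have [measurable]: "(\<lambda>\<omega>. u \<omega> i) \<in> borel_measurable M" "(\<lambda>\<omega>. u \<omega> j) \<in> borel_measurable M"
      using assms by auto
    show ?thesis by measurable
  qed auto
  have [measurable]: "Measurable.pred M (\<lambda>\<omega>. 1 \<le> i \<longrightarrow> 0 < u \<omega> i \<and> u \<omega> i < 1)" for i
  proof (cases "1 \<le> i")
    case True
    then have [measurable]: "(\<lambda>\<omega>. u \<omega> i) \<in> borel_measurable M" using assms by auto
    show ?thesis by measurable
  qed auto
  show ?thesis unfolding generic_iff by (intro pred_intros_logic(3) pred_intros_countable(1)) fact+
qed

lemma pred_nice:
  assumes u: "\<And>i. 1 \<le> i \<Longrightarrow> (\<lambda>\<omega>. u \<omega> i) \<in> borel_measurable M"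
  shows "Measurable.pred M (\<lambda>\<omega>. nice (u \<omega>))"
proof -
  have [measurable]: "(\<lambda>\<omega>. cnt (u \<omega>) n (of_rat q)) \<in> M \<rightarrow>\<^sub>M count_space UNIV" for n and q :: rat
    by (intro measurable_cnt u) auto
  note [measurable] = pred_generic[OF u]
  show ?thesis unfolding nice_iff by measurable
qed

lemma pred_neq:
  fixes f g :: "'a \<Rightarrow> real"
  assumes "f \<in> borel_measurable M" "g \<in> borel_measurable M"
  shows "Measurable.pred M (\<lambda>x. f x \<noteq> g x)"
  using assms by measurable

text \<open>Ties and end points are excluded by \<open>U_coord_AE\<close>, as each is produced by at
  most one value of coordinate \<open>i\<close>. Equidistribution follows from the law of large
  numbers at all rationals.\<close>

lemma AE_nice: "AE u in U_measure. nice u"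
proof -
  have ne: "AE u in U_measure. u i \<noteq> u j" if "1 \<le> i" "1 \<le> j" "i \<noteq> j" for i j
  proof (rule U_coord_AE[OF that(1)])
    show "Measurable.pred U_measure (\<lambda>u. u i \<noteq> u j)" using that by (intro pred_neq measurable_U_coord)
  qed (use that in auto)
  have ne': "AE u in U_measure. u i \<noteq> c" if "1 \<le> i" for i c
  proof (rule U_coord_AE[OF that])
    show "Measurable.pred U_measure (\<lambda>u. u i \<noteq> c)" using that by (intro pred_neq measurable_U_coord borel_measurable_const)
  qed auto
  have "AE u in U_measure. u i \<in> {0..1}" if "1 \<le> i" for i
  proof -
    have "AE x in unif. x \<in> {0..1}" by (rule AE_uniform_measureI) auto
    then have "AE x in distr U_measure unif (\<lambda>u. u i). x \<in> {0..1}" by (simp only: distr_U_coord[OF that])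
    then show ?thesis
      by (rule AE_distrD[rotated]) (use measurable_U_coord[OF that] in \<open>simp cong: measurable_cong_sets\<close>)
  qed
  then have "AE u in U_measure. 1 \<le> i \<longrightarrow> 0 < u i \<and> u i < 1" for i
  proof (cases "1 \<le> i")
    case True
    from \<open>\<And>i. 1 \<le> i \<Longrightarrow> AE u in U_measure. u i \<in> {0..1}\<close>[OF True] ne'[OF True, of 0] ne'[OF True, of 1]
    show ?thesis by eventually_elim (auto simp: less_le)
  qed auto
  then have 1: "AE u in U_measure. \<forall>i. 1 \<le> i \<longrightarrow> 0 < u i \<and> u i < 1" by (simp add: AE_all_countable)
  have "AE u in U_measure. 1 \<le> i \<longrightarrow> 1 \<le> j \<longrightarrow> i \<noteq> j \<longrightarrow> u i \<noteq> u j" for i j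
    using ne[of i j] by (cases "1 \<le> i \<and> 1 \<le> j \<and> i \<noteq> j") auto
  then have 2: "AE u in U_measure. \<forall>i j. 1 \<le> i \<longrightarrow> 1 \<le> j \<longrightarrow> i \<noteq> j \<longrightarrow> u i \<noteq> u j" by (simp add: AE_all_countable)
  have "AE u in U_measure. 0 \<le> (of_rat q :: real) \<and> of_rat q \<le> (1 :: real) \<longrightarrow>
      (\<lambda>n. real (cnt u n (of_rat q)) / real n) \<longlonglongrightarrow> of_rat q" for q :: rat
    using U_lln[of "of_rat q"] by (cases "0 \<le> (of_rat q :: real) \<and> of_rat q \<le> (1 :: real)") auto
  then have 3: "AE u in U_measure. \<forall>q::rat. 0 \<le> (of_rat q :: real) \<and> of_rat q \<le> (1 :: real) \<longrightarrow>
      (\<lambda>n. real (cnt u n (of_rat q)) / real n) \<longlonglongrightarrow> of_rat q" by (simp add: AE_all_countable)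
  from 1 2 3 show ?thesis
  proof eventually_elim
    case (elim u)
    then have "generic u" unfolding generic_iff by blast
    moreover have "\<exists>N. \<forall>n\<ge>N. disc u n e" if "0 < e" for e
      using elim(3) that by (intro disc_of_rationals) auto
    ultimately show ?case by (simp add: nice_def)
  qed
qed

section \<open>Measurability of the sampling map\<close>

text \<open>Interval systems live in an uncountable type, but each level has finitely many of them.
  Checking single values is then enough for measurability into the full discrete space.\<close>

lemma finite_range_measurable:
  assumes fin: "finite A" and rng: "\<And>\<omega>. \<omega> \<in> space M \<Longrightarrow> f \<omega> \<in> A"
    and m: "\<And>a. a \<in> A \<Longrightarrow> {\<omega> \<in> space M. f \<omega> = a} \<in> sets M"
  shows "f \<in> M \<rightarrow>\<^sub>M count_space UNIV"
proof (rule measurableI)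
  fix B
  have "f -` B \<inter> space M = (\<Union>a\<in>A \<inter> B. {\<omega> \<in> space M. f \<omega> = a})" using rng by auto
  then show "f -` B \<inter> space M \<in> sets M" using fin m by auto
qed simp

text \<open>The existence of a point of \<open>K\<close> in an open cell is an uncountable union of
  conditions. It becomes a countable one over rational rectangles whose sides contain no sample
  point; on such a side the count is constant and equal to the count at the left end.\<close>

lemma phi_inf_mem_iff:
  assumes K: "K \<in> InSy_inf" and cd: "c < d" "d \<le> n"
  shows "{Suc c..d} \<in> phi_inf n K (order_stat u n) \<longleftrightarrow> d = Suc c \<or>
    (\<exists>q1 q2 r1 r2 :: rat. K \<in> {K \<in> InSy_inf. K \<inter> {of_rat q1<..<of_rat q2} \<times> {of_rat r1<..<of_rat r2} \<noteq> {}} \<and>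
      (\<forall>j\<in>{1..n}. \<not> (of_rat q1 < u j \<and> u j < of_rat q2) \<and> \<not> (of_rat r1 < u j \<and> u j < of_rat r2)) \<and>
      cnt u n (of_rat q1) = c \<and> cnt u n (of_rat r1) = d)" (is "?L \<longleftrightarrow> d = Suc c \<or> ?R")
proof
  assume L: ?L
  have "{Suc c..d} \<noteq> {}" using cd by simp
  then consider j where "{Suc c..d} = {j}" | x y where "{Suc c..d} = {Suc (cnt u n x)..cnt u n y}" "(x,y) \<in> K"
      "x \<notin> u ` {1..n}" "y \<notin> u ` {1..n}"
    using L unfolding phi_inf_cut[OF K] by blast
  then show "d = Suc c \<or> ?R"
  proof cases
    case 1
    then have "card {Suc c..d} = 1" by simp
    then have "d = Suc c" using cd by simp
    then show ?thesis ..
  next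
    case 2
    have cnt: "cnt u n x = c" "cnt u n y = d" using atLeastAtMost_Suc_eq_iff[OF cd(1) 2(1)] by auto
    obtain dx where dx: "0 < dx" "\<And>v. \<bar>v - x\<bar> < dx \<Longrightarrow> v \<notin> u ` {1..n} \<and> cnt u n v = cnt u n x"
      using off_points_nbhd[OF 2(3)] by metis
    obtain dy where dy: "0 < dy" "\<And>v. \<bar>v - y\<bar> < dy \<Longrightarrow> v \<notin> u ` {1..n} \<and> cnt u n v = cnt u n y"
      using off_points_nbhd[OF 2(4)] by metis
    have e: "0 < min dx dy" using dx dy by simp
    obtain q1 q2 r1 r2 :: rat where b: "of_rat q1 < x" "x < of_rat q2" "of_rat r1 < y" "y < of_rat r2"
      "x - min dx dy < of_rat q1" "of_rat q2 < x + min dx dy" "y - min dx dy < of_rat r1" "of_rat r2 < y + min dx dy"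
      by (rule rational_rectangle[OF e])
    have "(x, y) \<in> K \<inter> {of_rat q1<..<of_rat q2} \<times> {of_rat r1<..<of_rat r2}" using 2 b by auto
    then have a1: "K \<in> {K \<in> InSy_inf. K \<inter> {of_rat q1<..<of_rat q2} \<times> {of_rat r1<..<of_rat r2} \<noteq> {}}" using K by blast
    have bb: "x - dx < of_rat q1" "of_rat q2 < x + dx" "y - dy < of_rat r1" "of_rat r2 < y + dy"
      using b by linarith+
    have a2: "\<forall>j\<in>{1..n}. \<not> (of_rat q1 < u j \<and> u j < of_rat q2) \<and> \<not> (of_rat r1 < u j \<and> u j < of_rat r2)"
    proof (intro ballI conjI notI)
      fix j assume j: "j \<in> {1..n}"
      show False if "of_rat q1 < u j \<and> u j < of_rat q2"
      proof -
        have "\<bar>u j - x\<bar> < dx" using that bb by linarith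
        then show False using dx(2) j by blast
      qed
      show False if "of_rat r1 < u j \<and> u j < of_rat r2"
      proof -
        have "\<bar>u j - y\<bar> < dy" using that bb by linarith
        then show False using dy(2) j by blast
      qed
    qed
    have "\<bar>of_rat q1 - x\<bar> < dx" "\<bar>of_rat r1 - y\<bar> < dy" using b bb by linarith+
    then have a3: "cnt u n (of_rat q1) = c" "cnt u n (of_rat r1) = d"
      using dx(2)[of "of_rat q1"] dy(2)[of "of_rat r1"] cnt by auto
    have ?R by (intro exI conjI) (rule a1 a2 a3)+
    then show ?thesis ..
  qed
next
  assume "d = Suc c \<or> ?R"
  then show ?L
  proof
    assume "d = Suc c"
    then have "{Suc c..d} = {d}" "d \<in> {1..n}" using cd by auto
    then show ?thesis by (auto simp: phi_inf_def)
  next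
    assume ?R
    then obtain q1 q2 r1 r2 :: rat where R: "K \<in> {K \<in> InSy_inf. K \<inter> {of_rat q1<..<of_rat q2} \<times> {of_rat r1<..<of_rat r2} \<noteq> {}}"
      and off: "\<forall>j\<in>{1..n}. \<not> (of_rat q1 < u j \<and> u j < of_rat q2) \<and> \<not> (of_rat r1 < u j \<and> u j < of_rat r2)"
      and cnt: "cnt u n (of_rat q1) = c" "cnt u n (of_rat r1) = d" by (elim exE conjE) (rule that)
    from R obtain x y where xy: "(x, y) \<in> K" "of_rat q1 < x" "x < of_rat q2" "of_rat r1 < y" "y < of_rat r2" by auto
    have "x \<notin> u ` {1..n}" "y \<notin> u ` {1..n}" using off xy by auto
    moreover have "u j \<le> x \<longleftrightarrow> u j \<le> of_rat q1" "u j \<le> y \<longleftrightarrow> u j \<le> of_rat r1" if "j \<in> {1..n}" for j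
    proof -
      have "\<not> (of_rat q1 < u j \<and> u j < of_rat q2) \<and> \<not> (of_rat r1 < u j \<and> u j < of_rat r2)" using off that by blast
      then show "u j \<le> x \<longleftrightarrow> u j \<le> of_rat q1" "u j \<le> y \<longleftrightarrow> u j \<le> of_rat r1" using xy by linarith+
    qed
    then have "{j \<in> {1..n}. u j \<le> x} = {j \<in> {1..n}. u j \<le> of_rat q1}" "{j \<in> {1..n}. u j \<le> y} = {j \<in> {1..n}. u j \<le> of_rat r1}"
      by blast+
    then have "cnt u n x = c" "cnt u n y = d" using cnt by (simp_all only: cnt_def)
    ultimately show ?thesis using xy(1) unfolding phi_inf_cut[OF K] by blast
  qed
qed

lemma pred_hit:
  assumes "KK \<in> N \<rightarrow>\<^sub>M BIS" "open R"
  shows "Measurable.pred N (\<lambda>\<omega>. KK \<omega> \<in> {K \<in> InSy_inf. K \<inter> R \<noteq> {}})"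
  using measurable_hit[OF assms(2)] assms(1) by measurable

lemma BIS_range: "KK \<in> N \<rightarrow>\<^sub>M BIS \<Longrightarrow> \<omega> \<in> space N \<Longrightarrow> KK \<omega> \<in> InSy_inf"
  using measurable_space[of KK N BIS \<omega>] by (simp add: space_BIS)

lemma measurable_phi_inf:
  assumes KK: "KK \<in> N \<rightarrow>\<^sub>M BIS" and u: "\<And>i. 1 \<le> i \<Longrightarrow> (\<lambda>\<omega>. u \<omega> i) \<in> borel_measurable N"
  shows "(\<lambda>\<omega>. phi_inf n (KK \<omega>) (order_stat (u \<omega>) n)) \<in> N \<rightarrow>\<^sub>M count_space UNIV"
proof (rule finite_range_measurable[OF finite_InSy[of n] phi_inf_in_InSy])
  let ?P = "\<lambda>\<omega>. phi_inf n (KK \<omega>) (order_stat (u \<omega>) n)"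
  fix J assume J: "J \<in> InSy n"
  have sub: "I \<subseteq> Pow {1..n}" if "I \<in> InSy n" for I using that by (fastforce simp: InSy_def)
  have "{\<omega> \<in> space N. A \<in> ?P \<omega>} \<in> sets N" for A
  proof (cases "A \<noteq> {} \<and> (\<exists>c d. A = {Suc c..d} \<and> c < d \<and> d \<le> n)")
    case False
    have "{\<omega> \<in> space N. A \<in> ?P \<omega>} = (if A = {} then space N else {})"
    proof (cases "A = {}")
      case True
      then show ?thesis using InSy_empty[OF phi_inf_in_InSy] by auto
    next
      case c2: False
      then have "A \<notin> ?P \<omega>" for \<omega> using False InSyD_cut[OF phi_inf_in_InSy, of A] by metis
      then show ?thesis using c2 by auto
    qed
    then show ?thesis by auto
  next
    case True
    then obtain c d where A: "A = {Suc c..d}" "c < d" "d \<le> n" by blast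
    have m1: "Measurable.pred N (\<lambda>\<omega>. KK \<omega> \<in> {K \<in> InSy_inf. K \<inter> {of_rat q1<..<of_rat q2} \<times> {of_rat r1<..<of_rat r2} \<noteq> {}})"
      for q1 q2 r1 r2 :: rat
      by (rule pred_hit[OF KK]) (intro open_Times open_greaterThanLessThan)
    have m2: "Measurable.pred N (\<lambda>\<omega>. cnt (u \<omega>) n (of_rat q) = c)" for q :: rat and c
    proof -
      have [measurable]: "(\<lambda>\<omega>. cnt (u \<omega>) n (of_rat q)) \<in> N \<rightarrow>\<^sub>M count_space UNIV" by (intro measurable_cnt u) auto
      show ?thesis by measurable
    qed
    have m3: "Measurable.pred N (\<lambda>\<omega>. \<forall>j\<in>{1..n}. \<not> (of_rat q1 < u \<omega> j \<and> u \<omega> j < of_rat q2) \<and> \<not> (of_rat r1 < u \<omega> j \<and> u \<omega> j < of_rat r2))"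
      for q1 q2 r1 r2 :: rat
    proof (rule pred_intros_finite)
      fix j assume "j \<in> {1..n}"
      then have [measurable]: "(\<lambda>\<omega>. u \<omega> j) \<in> borel_measurable N" using u by auto
      show "Measurable.pred N (\<lambda>\<omega>. \<not> (of_rat q1 < u \<omega> j \<and> u \<omega> j < of_rat q2) \<and> \<not> (of_rat r1 < u \<omega> j \<and> u \<omega> j < of_rat r2))"
        by measurable
    qed simp
    note [measurable] = m1 m2 m3
    have "{\<omega> \<in> space N. A \<in> ?P \<omega>} = {\<omega> \<in> space N. d = Suc c \<or>
    (\<exists>q1 q2 r1 r2 :: rat. KK \<omega> \<in> {K \<in> InSy_inf. K \<inter> {of_rat q1<..<of_rat q2} \<times> {of_rat r1<..<of_rat r2} \<noteq> {}} \<and>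
      (\<forall>j\<in>{1..n}. \<not> (of_rat q1 < u \<omega> j \<and> u \<omega> j < of_rat q2) \<and> \<not> (of_rat r1 < u \<omega> j \<and> u \<omega> j < of_rat r2)) \<and>
      cnt (u \<omega>) n (of_rat q1) = c \<and> cnt (u \<omega>) n (of_rat r1) = d)}"
      using phi_inf_mem_iff[OF BIS_range[OF KK] A(2,3)] unfolding A(1) by (intro Collect_cong conj_cong refl)
    also have "\<dots> \<in> sets N" by measurable
    finally show ?thesis .
  qed
  then have "{\<omega> \<in> space N. A \<in> ?P \<omega> \<longleftrightarrow> A \<in> J} \<in> sets N" for A
    by (cases "A \<in> J") (auto intro: sets.sets_Collect_neg)
  then have "{\<omega> \<in> space N. \<forall>A\<in>Pow {1..n}. A \<in> ?P \<omega> \<longleftrightarrow> A \<in> J} \<in> sets N"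
    by (intro sets.sets_Collect_finite_All) auto
  moreover have "?P \<omega> = J \<longleftrightarrow> (\<forall>A\<in>Pow {1..n}. A \<in> ?P \<omega> \<longleftrightarrow> A \<in> J)" for \<omega>
    using sub[OF J] sub[OF phi_inf_in_InSy[of n "KK \<omega>" "order_stat (u \<omega>) n"]] by blast
  ultimately show "{\<omega> \<in> space N. ?P \<omega> = J} \<in> sets N" by simp
qed

definition Phi :: "(real \<times> real) set \<Rightarrow> (nat \<Rightarrow> real) \<Rightarrow> path" where
  "Phi K u = (\<lambda>n\<in>{1..}. (phi_inf n K (order_stat u n), eraser_of_U u n))"

lemma Law_eq_distr: "Law K = distr U_measure path_space (Phi K)"
  unfolding Law_def process_law_def process_path_def[abs_def] Phi_def[abs_def] ..

lemma Phi_in_paths: "Phi K u \<in> paths"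
  using phi_inf_in_InSy eraser_of_U_range unfolding Phi_def paths_def by auto

lemma measurable_pair_finite:
  assumes f: "f \<in> M \<rightarrow>\<^sub>M count_space UNIV" and g: "g \<in> M \<rightarrow>\<^sub>M count_space UNIV"
    and fin: "finite A" "finite B" and rng: "\<And>\<omega>. \<omega> \<in> space M \<Longrightarrow> f \<omega> \<in> A" "\<And>\<omega>. \<omega> \<in> space M \<Longrightarrow> g \<omega> \<in> B"
  shows "(\<lambda>\<omega>. (f \<omega>, g \<omega>)) \<in> M \<rightarrow>\<^sub>M count_space UNIV"
proof (rule finite_range_measurable[of "A \<times> B"])
  fix a assume "a \<in> A \<times> B"
  have "{\<omega> \<in> space M. (f \<omega>, g \<omega>) = a} = (f -` {fst a} \<inter> space M) \<inter> (g -` {snd a} \<inter> space M)" by (cases a) auto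
  then show "{\<omega> \<in> space M. (f \<omega>, g \<omega>) = a} \<in> sets M"
    using measurable_sets[OF f, of "{fst a}"] measurable_sets[OF g, of "{snd a}"] by auto
qed (use fin rng in auto)

lemma measurable_Phi:
  assumes KK: "KK \<in> N \<rightarrow>\<^sub>M BIS" and u: "\<And>i. 1 \<le> i \<Longrightarrow> (\<lambda>\<omega>. u \<omega> i) \<in> borel_measurable N"
  shows "(\<lambda>\<omega>. Phi (KK \<omega>) (u \<omega>)) \<in> N \<rightarrow>\<^sub>M path_space"
proof (rule measurable_pathI[OF Phi_in_paths])
  fix n :: nat assume n: "1 \<le> n"
  have "(\<lambda>\<omega>. (phi_inf n (KK \<omega>) (order_stat (u \<omega>) n), eraser_of_U (u \<omega>) n)) \<in> N \<rightarrow>\<^sub>M count_space UNIV"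
    by (rule measurable_pair_finite[OF measurable_phi_inf[OF KK u] measurable_eraser_of_U[OF u] finite_InSy[of n] finite_atLeastAtMost phi_inf_in_InSy eraser_of_U_range])
  then show "(\<lambda>\<omega>. Phi (KK \<omega>) (u \<omega>) n) \<in> N \<rightarrow>\<^sub>M count_space UNIV" using n by (simp add: Phi_def)
qed

lemma measurable_Phi_U: "K \<in> InSy_inf \<Longrightarrow> Phi K \<in> U_measure \<rightarrow>\<^sub>M path_space"
proof -
  assume "K \<in> InSy_inf"
  then have "(\<lambda>_. K) \<in> U_measure \<rightarrow>\<^sub>M BIS" by (simp add: space_BIS)
  from measurable_Phi[OF this, of "\<lambda>u. u", OF measurable_U_coord] show ?thesis by simp
qed

lemma prob_space_Law: "K \<in> InSy_inf \<Longrightarrow> prob_space (Law K)"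
  unfolding Law_eq_distr by (intro UM.prob_space_distr measurable_Phi_U)

lemma sets_Law: "sets (Law K) = sets path_space"
  by (simp add: Law_eq_distr)

lemma space_Law: "space (Law K) = paths"
  by (simp add: Law_eq_distr space_path_space)

section \<open>Almost every point sequence is in good position\<close>

definition hits_open :: "(real \<times> real) set \<Rightarrow> real \<Rightarrow> real \<Rightarrow> real \<Rightarrow> real \<Rightarrow> bool" where
  "hits_open K \<alpha> \<beta> \<gamma> \<delta> \<longleftrightarrow> (\<exists>(x, y)\<in>K. \<alpha> < x \<and> x < \<beta> \<and> \<gamma> < y \<and> y < \<delta>)"

definition hits_closed :: "(real \<times> real) set \<Rightarrow> real \<Rightarrow> real \<Rightarrow> real \<Rightarrow> real \<Rightarrow> bool" where
  "hits_closed K \<alpha> \<beta> \<gamma> \<delta> \<longleftrightarrow> (\<exists>(x, y)\<in>K. \<alpha> \<le> x \<and> x \<le> \<beta> \<and> \<gamma> \<le> y \<and> y \<le> \<delta>)"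

lemma hits_open_iff:
  assumes K: "K \<in> InSy_inf"
  shows "hits_open K \<alpha> \<beta> \<gamma> \<delta> \<longleftrightarrow> (\<exists>q1 q2 r1 r2 :: rat.
    K \<in> {K \<in> InSy_inf. K \<inter> {of_rat q1<..<of_rat q2} \<times> {of_rat r1<..<of_rat r2} \<noteq> {}} \<and>
    \<alpha> \<le> of_rat q1 \<and> of_rat q2 \<le> \<beta> \<and> \<gamma> \<le> of_rat r1 \<and> of_rat r2 \<le> \<delta>)" (is "_ \<longleftrightarrow> ?R")
proof
  assume "hits_open K \<alpha> \<beta> \<gamma> \<delta>"
  then obtain x y where xy: "(x, y) \<in> K" "\<alpha> < x" "x < \<beta>" "\<gamma> < y" "y < \<delta>" by (auto simp: hits_open_def)
  let ?e = "min (min (x - \<alpha>) (\<beta> - x)) (min (y - \<gamma>) (\<delta> - y))"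
  have e: "0 < ?e" using xy by simp
  obtain q1 q2 r1 r2 :: rat where b: "of_rat q1 < x" "x < of_rat q2" "of_rat r1 < y" "y < of_rat r2"
    "x - ?e < of_rat q1" "of_rat q2 < x + ?e" "y - ?e < of_rat r1" "of_rat r2 < y + ?e"
    by (rule rational_rectangle[OF e])
  have "(x, y) \<in> K \<inter> {of_rat q1<..<of_rat q2} \<times> {of_rat r1<..<of_rat r2}" using xy b by auto
  then have "K \<in> {K \<in> InSy_inf. K \<inter> {of_rat q1<..<of_rat q2} \<times> {of_rat r1<..<of_rat r2} \<noteq> {}}" using K by blast
  moreover have "\<alpha> \<le> of_rat q1" "of_rat q2 \<le> \<beta>" "\<gamma> \<le> of_rat r1" "of_rat r2 \<le> \<delta>" using b by linarith+
  ultimately show ?R by blast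
next
  assume ?R
  then obtain q1 q2 r1 r2 :: rat and x y where xy: "(x, y) \<in> K" "of_rat q1 < x" "x < of_rat q2" "of_rat r1 < y" "y < of_rat r2"
    "\<alpha> \<le> of_rat q1" "of_rat q2 \<le> \<beta>" "\<gamma> \<le> of_rat r1" "of_rat r2 \<le> \<delta>" by auto
  then have "\<alpha> < x \<and> x < \<beta> \<and> \<gamma> < y \<and> y < \<delta>" by linarith
  then show "hits_open K \<alpha> \<beta> \<gamma> \<delta>" unfolding hits_open_def using xy(1) by blast
qed

text \<open>By compactness, points of \<open>K\<close> in the enlarged open rectangles have a
  cluster point, which lies in the closed one. Closed hits thereby inherit measurability from open
  hits.\<close>

lemma hits_closed_iff:
  assumes K: "K \<in> InSy_inf"
  shows "hits_closed K \<alpha> \<beta> \<gamma> \<delta> \<longleftrightarrow> (\<forall>n. hits_open K (\<alpha> - inverse (real (Suc n))) (\<beta> + inverse (real (Suc n)))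
    (\<gamma> - inverse (real (Suc n))) (\<delta> + inverse (real (Suc n))))" (is "_ \<longleftrightarrow> ?R")
proof
  assume "hits_closed K \<alpha> \<beta> \<gamma> \<delta>"
  then obtain x y where xy: "(x, y) \<in> K" "\<alpha> \<le> x" "x \<le> \<beta>" "\<gamma> \<le> y" "y \<le> \<delta>" by (auto simp: hits_closed_def)
  have pos: "0 < inverse (real (Suc n))" for n by simp
  have "\<alpha> - inverse (real (Suc n)) < x \<and> x < \<beta> + inverse (real (Suc n)) \<and> \<gamma> - inverse (real (Suc n)) < y
      \<and> y < \<delta> + inverse (real (Suc n))" for n
    using xy pos[of n] by linarith
  then show ?R unfolding hits_open_def using xy(1) by blast
next
  assume R: ?R
  have "\<exists>p\<in>K. \<alpha> - inverse (real (Suc n)) < fst p \<and> fst p < \<beta> + inverse (real (Suc n)) \<and>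
      \<gamma> - inverse (real (Suc n)) < snd p \<and> snd p < \<delta> + inverse (real (Suc n))" for n
    using R[rule_format, of n] unfolding hits_open_def by force
  then obtain p where p: "\<And>n. p n \<in> K" "\<And>n. \<alpha> - inverse (real (Suc n)) < fst (p n) \<and> fst (p n) < \<beta> + inverse (real (Suc n)) \<and>
      \<gamma> - inverse (real (Suc n)) < snd (p n) \<and> snd (p n) < \<delta> + inverse (real (Suc n))" by metis
  have "compact K" using K by (simp add: InSy_inf_def)
  then obtain q r where q: "q \<in> K" "strict_mono r" "(p \<circ> r) \<longlonglongrightarrow> q" using p(1) unfolding compact_def by metis
  have h0: "(\<lambda>i. inverse (real (Suc (r i)))) \<longlonglongrightarrow> 0"
    using LIMSEQ_subseq_LIMSEQ[OF LIMSEQ_inverse_real_of_nat q(2)] by (simp add: comp_def)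
  have l1: "(\<lambda>i. fst (p (r i))) \<longlonglongrightarrow> fst q" "(\<lambda>i. snd (p (r i))) \<longlonglongrightarrow> snd q"
    using tendsto_fst[OF q(3)] tendsto_snd[OF q(3)] by (auto simp: comp_def)
  have "\<alpha> - 0 \<le> fst q"
    by (rule LIMSEQ_le[OF tendsto_diff[OF tendsto_const h0] l1(1)]) (use p(2) less_imp_le in blast)
  moreover have "fst q \<le> \<beta> + 0"
    by (rule LIMSEQ_le[OF l1(1) tendsto_add[OF tendsto_const h0]]) (use p(2) less_imp_le in blast)
  moreover have "\<gamma> - 0 \<le> snd q"
    by (rule LIMSEQ_le[OF tendsto_diff[OF tendsto_const h0] l1(2)]) (use p(2) less_imp_le in blast)
  moreover have "snd q \<le> \<delta> + 0"
    by (rule LIMSEQ_le[OF l1(2) tendsto_add[OF tendsto_const h0]]) (use p(2) less_imp_le in blast)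
  ultimately show "hits_closed K \<alpha> \<beta> \<gamma> \<delta>" unfolding hits_closed_def using q(1) by (intro bexI[of _ q]) auto
qed

lemma pred_hits_open:
  assumes KK: "KK \<in> N \<rightarrow>\<^sub>M BIS"
    and [measurable]: "\<alpha> \<in> borel_measurable N" "\<beta> \<in> borel_measurable N" "\<gamma> \<in> borel_measurable N" "\<delta> \<in> borel_measurable N"
  shows "Measurable.pred N (\<lambda>\<omega>. hits_open (KK \<omega>) (\<alpha> \<omega>) (\<beta> \<omega>) (\<gamma> \<omega>) (\<delta> \<omega>))"
proof -
  have [measurable]: "Measurable.pred N (\<lambda>\<omega>. KK \<omega> \<in> {K \<in> InSy_inf. K \<inter> {of_rat q1<..<of_rat q2} \<times> {of_rat r1<..<of_rat r2} \<noteq> {}})"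
    for q1 q2 r1 r2 :: rat
    by (rule pred_hit[OF KK]) (intro open_Times open_greaterThanLessThan)
  have "Measurable.pred N (\<lambda>\<omega>. (\<exists>q1 q2 r1 r2 :: rat.
    KK \<omega> \<in> {K \<in> InSy_inf. K \<inter> {of_rat q1<..<of_rat q2} \<times> {of_rat r1<..<of_rat r2} \<noteq> {}} \<and>
    \<alpha> \<omega> \<le> of_rat q1 \<and> of_rat q2 \<le> \<beta> \<omega> \<and> \<gamma> \<omega> \<le> of_rat r1 \<and> of_rat r2 \<le> \<delta> \<omega>))"
    by measurable
  then show ?thesis by (rule measurable_cong[THEN iffD2, rotated]) (rule hits_open_iff[OF BIS_range[OF KK]])
qed

lemma pred_hits_closed:
  assumes KK: "KK \<in> N \<rightarrow>\<^sub>M BIS"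
    and [measurable]: "\<alpha> \<in> borel_measurable N" "\<beta> \<in> borel_measurable N" "\<gamma> \<in> borel_measurable N" "\<delta> \<in> borel_measurable N"
  shows "Measurable.pred N (\<lambda>\<omega>. hits_closed (KK \<omega>) (\<alpha> \<omega>) (\<beta> \<omega>) (\<gamma> \<omega>) (\<delta> \<omega>))"
proof -
  have "Measurable.pred N (\<lambda>\<omega>. \<forall>n. hits_open (KK \<omega>) (\<alpha> \<omega> - inverse (real (Suc n))) (\<beta> \<omega> + inverse (real (Suc n)))
    (\<gamma> \<omega> - inverse (real (Suc n))) (\<delta> \<omega> + inverse (real (Suc n))))"
    by (intro pred_intros_countable pred_hits_open[OF KK]) measurable
  then show ?thesis by (rule measurable_cong[THEN iffD2, rotated]) (rule hits_closed_iff[OF BIS_range[OF KK]])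
qed

text \<open>Label \<open>0\<close>, which is not the index of a point, encodes the missing neighbour.\<close>

definition lo :: "(nat \<Rightarrow> real) \<Rightarrow> nat \<Rightarrow> real" where "lo u i = (if i = 0 then -1 else u i)"
definition hi :: "(nat \<Rightarrow> real) \<Rightarrow> nat \<Rightarrow> real" where "hi u i = (if i = 0 then 2 else u i)"

text \<open>Sides are named by indices instead of values. Goodness becomes a countable conjunction,
  and each side depends on at most one coordinate of \<open>u\<close>.\<close>

lemma good_iff:
  "good K u \<longleftrightarrow> (\<forall>i j k l. lo u i < u (Suc j) \<and> u (Suc j) < u (Suc k) \<and> u (Suc k) < hi u l \<and>
    hits_closed K (lo u i) (u (Suc j)) (u (Suc k)) (hi u l) \<longrightarrow> hits_open K (lo u i) (u (Suc j)) (u (Suc k)) (hi u l))"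
proof -
  have UNIV_split: "(UNIV :: nat set) = insert 0 {1..}" by auto
  have 1: "insert (-1) (u ` {1..}) = range (lo u)" unfolding UNIV_split image_insert by (auto simp: lo_def)
  have 2: "insert 2 (u ` {1..}) = range (hi u)" unfolding UNIV_split image_insert by (auto simp: hi_def)
  have "{1..} = range Suc" by (auto simp: image_iff Suc_le_D)
  then have 3: "u ` {1..} = range (\<lambda>j. u (Suc j))" by (simp add: image_image)
  have R: "(\<forall>x\<in>range f. P x) \<longleftrightarrow> (\<forall>i. P (f i))" for f :: "nat \<Rightarrow> real" and P by blast
  show ?thesis unfolding good_def 1 2 unfolding 3 hits_open_def[symmetric] hits_closed_def[symmetric] R ..
qed

lemma measurable_lo_hi:
  assumes u: "\<And>i. 1 \<le> i \<Longrightarrow> (\<lambda>\<omega>. u \<omega> i) \<in> borel_measurable N"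
  shows "(\<lambda>\<omega>. lo (u \<omega>) i) \<in> borel_measurable N" "(\<lambda>\<omega>. hi (u \<omega>) i) \<in> borel_measurable N"
  using u[of i] by (cases "i = 0"; simp add: lo_def hi_def)+

lemma pred_good:
  assumes KK: "KK \<in> N \<rightarrow>\<^sub>M BIS" and u: "\<And>i. 1 \<le> i \<Longrightarrow> (\<lambda>\<omega>. u \<omega> i) \<in> borel_measurable N"
  shows "Measurable.pred N (\<lambda>\<omega>. good (KK \<omega>) (u \<omega>))"
proof -
  have [measurable]: "(\<lambda>\<omega>. u \<omega> (Suc j)) \<in> borel_measurable N" for j using u by simp
  note [measurable] = measurable_lo_hi[OF u] pred_hits_closed[OF KK] pred_hits_open[OF KK]
  have [measurable]: "Measurable.pred N (\<lambda>\<omega>. hits_closed (KK \<omega>) (lo (u \<omega>) i) (u \<omega> (Suc j)) (u \<omega> (Suc k)) (hi (u \<omega>) l))" for i j k l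
    by (intro pred_hits_closed[OF KK] measurable_lo_hi u) auto
  have [measurable]: "Measurable.pred N (\<lambda>\<omega>. hits_open (KK \<omega>) (lo (u \<omega>) i) (u \<omega> (Suc j)) (u \<omega> (Suc k)) (hi (u \<omega>) l))" for i j k l
    by (intro pred_hits_open[OF KK] measurable_lo_hi u) auto
  show ?thesis unfolding good_iff by measurable
qed

text \<open>A monotone predicate of one uniform variable, the others being fixed, is not stable under small
  perturbations of that variable at one point at most.\<close>

lemma AE_up_stable:
  assumes i: "1 \<le> i" and dep: "\<And>u x. Q (u(i := x)) = Q u" and mono: "\<And>u s t. s \<le> t \<Longrightarrow> Q u t \<Longrightarrow> Q u s"
    and m: "\<And>f. f \<in> borel_measurable U_measure \<Longrightarrow> Measurable.pred U_measure (\<lambda>u. Q u (f u))"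
  shows "AE u in U_measure. Q u (u i) \<longrightarrow> (\<exists>n. Q u (u i + inverse (real (Suc n))))"
proof (rule U_coord_AE[OF i])
  note [measurable] = measurable_U_coord[OF i]
  have [measurable]: "Measurable.pred U_measure (\<lambda>u. Q u (u i))" by (rule m) measurable
  have [measurable]: "Measurable.pred U_measure (\<lambda>u. Q u (u i + inverse (real (Suc n))))" for n by (rule m) measurable
  show "Measurable.pred U_measure (\<lambda>u. Q u (u i) \<longrightarrow> (\<exists>n. Q u (u i + inverse (real (Suc n)))))"
    by (intro pred_intros_logic pred_intros_countable) fact+
  fix u s t
  assume a: "\<not> (Q (u(i := s)) ((u(i := s)) i) \<longrightarrow> (\<exists>n. Q (u(i := s)) ((u(i := s)) i + inverse (real (Suc n)))))"
    "\<not> (Q (u(i := t)) ((u(i := t)) i) \<longrightarrow> (\<exists>n. Q (u(i := t)) ((u(i := t)) i + inverse (real (Suc n)))))"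
  have False if "s < t" "Q u t" "\<not> (\<exists>n. Q u (s + inverse (real (Suc n))))" for s t
  proof -
    have "0 < t - s" using that by simp
    then obtain n where "inverse (real (Suc n)) < t - s" using reals_Archimedean by blast
    then have "s + inverse (real (Suc n)) \<le> t" by simp
    then show False using mono that by blast
  qed
  then show "s = t" using a unfolding dep fun_upd_same by (metis linorder_neqE_linordered_idom)
qed

lemma AE_down_stable:
  assumes i: "1 \<le> i" and dep: "\<And>u x. Q (u(i := x)) = Q u" and mono: "\<And>u s t. s \<le> t \<Longrightarrow> Q u s \<Longrightarrow> Q u t"
    and m: "\<And>f. f \<in> borel_measurable U_measure \<Longrightarrow> Measurable.pred U_measure (\<lambda>u. Q u (f u))"
  shows "AE u in U_measure. Q u (u i) \<longrightarrow> (\<exists>n. Q u (u i - inverse (real (Suc n))))"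
proof (rule U_coord_AE[OF i])
  note [measurable] = measurable_U_coord[OF i]
  have [measurable]: "Measurable.pred U_measure (\<lambda>u. Q u (u i))" by (rule m) measurable
  have [measurable]: "Measurable.pred U_measure (\<lambda>u. Q u (u i - inverse (real (Suc n))))" for n by (rule m) measurable
  show "Measurable.pred U_measure (\<lambda>u. Q u (u i) \<longrightarrow> (\<exists>n. Q u (u i - inverse (real (Suc n)))))"
    by (intro pred_intros_logic pred_intros_countable) fact+
  fix u s t
  assume a: "\<not> (Q (u(i := s)) ((u(i := s)) i) \<longrightarrow> (\<exists>n. Q (u(i := s)) ((u(i := s)) i - inverse (real (Suc n)))))"
    "\<not> (Q (u(i := t)) ((u(i := t)) i) \<longrightarrow> (\<exists>n. Q (u(i := t)) ((u(i := t)) i - inverse (real (Suc n)))))"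
  have False if "s < t" "Q u s" "\<not> (\<exists>n. Q u (t - inverse (real (Suc n))))" for s t
  proof -
    have "0 < t - s" using that by simp
    then obtain n where "inverse (real (Suc n)) < t - s" using reals_Archimedean by blast
    then have "s \<le> t - inverse (real (Suc n))" by simp
    then show False using mono that by blast
  qed
  then show "s = t" using a unfolding dep fun_upd_same by (metis linorder_neqE_linordered_idom)
qed

lemma hits_closed_mono:
  "s \<le> t \<Longrightarrow> hits_closed K t \<beta> \<gamma> \<delta> \<Longrightarrow> hits_closed K s \<beta> \<gamma> \<delta>"
  "s \<le> t \<Longrightarrow> hits_closed K \<alpha> s \<gamma> \<delta> \<Longrightarrow> hits_closed K \<alpha> t \<gamma> \<delta>"
  "s \<le> t \<Longrightarrow> hits_closed K \<alpha> \<beta> t \<delta> \<Longrightarrow> hits_closed K \<alpha> \<beta> s \<delta>"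
  "s \<le> t \<Longrightarrow> hits_closed K \<alpha> \<beta> \<gamma> s \<Longrightarrow> hits_closed K \<alpha> \<beta> \<gamma> t"
  unfolding hits_closed_def by (auto intro: order_trans)

text \<open>The four sides are pushed inwards one after another, each through stability in a single
  variable. A closed hit of the shrunken rectangle is an open hit of the original one.\<close>

lemma AE_good:
  assumes K: "K \<in> InSy_inf"
  shows "AE u in U_measure. good K u"
proof -
  let ?h = "\<lambda>n. inverse (real (Suc n))"
  have KK: "(\<lambda>_. K) \<in> U_measure \<rightarrow>\<^sub>M BIS" using K by (simp add: space_BIS)
  note mc = measurable_U_coord measurable_lo_hi[of "\<lambda>u. u", OF measurable_U_coord]
  note pc = pred_hits_closed[OF KK]
  \<comment> \<open>The labels differ so that a side can be moved while the others stay fixed. Label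
    0 may occur at both ends, where it stands for the constants -1 and 2.\<close>
  have "AE u in U_measure. hits_closed K (lo u i) (u j) (u k) (hi u l) \<longrightarrow> hits_open K (lo u i) (u j) (u k) (hi u l)"
    if d: "1 \<le> j" "1 \<le> k" "i \<noteq> j" "i \<noteq> k" "j \<noteq> k" "l \<noteq> j" "l \<noteq> k" "i = 0 \<or> i \<noteq> l" for i j k l
  proof -
    have 1: "AE u in U_measure. hits_closed K (lo u i) (u j) (u k) (hi u l) \<longrightarrow> (\<exists>a. hits_closed K (lo u i + ?h a) (u j) (u k) (hi u l))"
    proof (cases "i = 0")
      case True
      \<comment> \<open>Since \<open>?h 0 = 1\<close>, the side moves from -1 to 0 and loses no
        point of the triangle.\<close>
      have "hits_closed K (lo u i + ?h 0) (u j) (u k) (hi u l)" if "hits_closed K (lo u i) (u j) (u k) (hi u l)" for u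
        using that InSy_infD(1)[OF K] True unfolding hits_closed_def lo_def by fastforce
      then show ?thesis by blast
    next
      case False
      have "AE u in U_measure. hits_closed K (u i) (u j) (u k) (hi u l) \<longrightarrow> (\<exists>a. hits_closed K (u i + ?h a) (u j) (u k) (hi u l))"
        proof (rule AE_up_stable[where Q="\<lambda>u s. hits_closed K s (u j) (u k) (hi u l)"])
          fix f :: "(nat \<Rightarrow> real) \<Rightarrow> real" assume f: "f \<in> borel_measurable U_measure"
          show "Measurable.pred U_measure (\<lambda>u. hits_closed K (f u) (u j) (u k) (hi u l))"
            using d by (intro pc mc f borel_measurable_add borel_measurable_diff borel_measurable_const) auto
        next
          fix u :: "nat \<Rightarrow> real" and s t :: real assume "s \<le> t" "hits_closed K t (u j) (u k) (hi u l)"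
          then show "hits_closed K s (u j) (u k) (hi u l)" by (rule hits_closed_mono(1))
        qed (use False d in \<open>auto simp: hi_def lo_def\<close>)
      then show ?thesis using False by (simp add: lo_def)
    qed
    \<comment> \<open>The statement covers every shift \<open>a\<close> of the previous side, so
      that one null event serves whichever shift occurs.\<close>
    have 2: "AE u in U_measure. \<forall>a. hits_closed K (lo u i + ?h a) (u j) (u k) (hi u l) \<longrightarrow>
        (\<exists>b. hits_closed K (lo u i + ?h a) (u j - ?h b) (u k) (hi u l))"
      unfolding AE_all_countable
    proof
      fix a
      show "AE u in U_measure. hits_closed K (lo u i + ?h a) (u j) (u k) (hi u l) \<longrightarrow>
        (\<exists>b. hits_closed K (lo u i + ?h a) (u j - ?h b) (u k) (hi u l))"
        proof (rule AE_down_stable[where Q="\<lambda>u s. hits_closed K (lo u i + ?h a) s (u k) (hi u l)"])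
          fix f :: "(nat \<Rightarrow> real) \<Rightarrow> real" assume f: "f \<in> borel_measurable U_measure"
          show "Measurable.pred U_measure (\<lambda>u. hits_closed K (lo u i + ?h a) (f u) (u k) (hi u l))"
            using d by (intro pc mc f borel_measurable_add borel_measurable_diff borel_measurable_const) auto
        next
          fix u :: "nat \<Rightarrow> real" and s t :: real assume "s \<le> t" "hits_closed K (lo u i + ?h a) s (u k) (hi u l)"
          then show "hits_closed K (lo u i + ?h a) t (u k) (hi u l)" by (rule hits_closed_mono(2))
        qed (use d in \<open>auto simp: hi_def lo_def\<close>)
    qed
    have 3: "AE u in U_measure. \<forall>a b. hits_closed K (lo u i + ?h a) (u j - ?h b) (u k) (hi u l) \<longrightarrow>
        (\<exists>c. hits_closed K (lo u i + ?h a) (u j - ?h b) (u k + ?h c) (hi u l))"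
      unfolding AE_all_countable
    proof (intro allI)
      fix a b
      show "AE u in U_measure. hits_closed K (lo u i + ?h a) (u j - ?h b) (u k) (hi u l) \<longrightarrow>
        (\<exists>c. hits_closed K (lo u i + ?h a) (u j - ?h b) (u k + ?h c) (hi u l))"
        proof (rule AE_up_stable[where Q="\<lambda>u s. hits_closed K (lo u i + ?h a) (u j - ?h b) s (hi u l)"])
          fix f :: "(nat \<Rightarrow> real) \<Rightarrow> real" assume f: "f \<in> borel_measurable U_measure"
          show "Measurable.pred U_measure (\<lambda>u. hits_closed K (lo u i + ?h a) (u j - ?h b) (f u) (hi u l))"
            using d by (intro pc mc f borel_measurable_add borel_measurable_diff borel_measurable_const) auto
        next
          fix u :: "nat \<Rightarrow> real" and s t :: real assume "s \<le> t" "hits_closed K (lo u i + ?h a) (u j - ?h b) t (hi u l)"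
          then show "hits_closed K (lo u i + ?h a) (u j - ?h b) s (hi u l)" by (rule hits_closed_mono(3))
        qed (use d in \<open>auto simp: hi_def lo_def\<close>)
    qed
    have 4: "AE u in U_measure. \<forall>a b c. hits_closed K (lo u i + ?h a) (u j - ?h b) (u k + ?h c) (hi u l) \<longrightarrow>
        (\<exists>e. hits_closed K (lo u i + ?h a) (u j - ?h b) (u k + ?h c) (hi u l - ?h e))"
      unfolding AE_all_countable
    proof (intro allI)
      fix a b c
      show "AE u in U_measure. hits_closed K (lo u i + ?h a) (u j - ?h b) (u k + ?h c) (hi u l) \<longrightarrow>
        (\<exists>e. hits_closed K (lo u i + ?h a) (u j - ?h b) (u k + ?h c) (hi u l - ?h e))"
      proof (cases "l = 0")
        case True
        \<comment> \<open>Here the side moves from 2 to 1, which still bounds all second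
          coordinates.\<close>
        have "hits_closed K (lo u i + ?h a) (u j - ?h b) (u k + ?h c) (hi u l - ?h 0)"
          if "hits_closed K (lo u i + ?h a) (u j - ?h b) (u k + ?h c) (hi u l)" for u
          using that InSy_infD(3)[OF K] True unfolding hits_closed_def hi_def by fastforce
        then show ?thesis by blast
      next
        case False
        have "AE u in U_measure. hits_closed K (lo u i + ?h a) (u j - ?h b) (u k + ?h c) (u l) \<longrightarrow>
            (\<exists>e. hits_closed K (lo u i + ?h a) (u j - ?h b) (u k + ?h c) (u l - ?h e))"
          proof (rule AE_down_stable[where Q="\<lambda>u s. hits_closed K (lo u i + ?h a) (u j - ?h b) (u k + ?h c) s"])
          fix f :: "(nat \<Rightarrow> real) \<Rightarrow> real" assume f: "f \<in> borel_measurable U_measure"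
          show "Measurable.pred U_measure (\<lambda>u. hits_closed K (lo u i + ?h a) (u j - ?h b) (u k + ?h c) (f u))"
            using d by (intro pc mc f borel_measurable_add borel_measurable_diff borel_measurable_const) auto
        next
          fix u :: "nat \<Rightarrow> real" and s t :: real assume "s \<le> t" "hits_closed K (lo u i + ?h a) (u j - ?h b) (u k + ?h c) s"
          then show "hits_closed K (lo u i + ?h a) (u j - ?h b) (u k + ?h c) t" by (rule hits_closed_mono(4))
        qed (use False d in \<open>auto simp: hi_def lo_def\<close>)
        then show ?thesis using False by (simp add: hi_def)
      qed
    qed
    have pos: "0 < ?h n" for n by simp
    have strict: "hits_open K \<alpha> \<beta> \<gamma> \<delta>" if cl: "hits_closed K (\<alpha> + ?h a) (\<beta> - ?h b) (\<gamma> + ?h c) (\<delta> - ?h e)" for \<alpha> \<beta> \<gamma> \<delta> a b c e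
    proof -
      obtain x y where xy: "(x, y) \<in> K" "\<alpha> + ?h a \<le> x" "x \<le> \<beta> - ?h b" "\<gamma> + ?h c \<le> y" "y \<le> \<delta> - ?h e"
        using cl unfolding hits_closed_def by blast
      then have "\<alpha> < x \<and> x < \<beta> \<and> \<gamma> < y \<and> y < \<delta>" using pos[of a] pos[of b] pos[of c] pos[of e] by linarith
      then show ?thesis unfolding hits_open_def using xy(1) by blast
    qed
    from 1 2 3 4 show ?thesis
    proof eventually_elim
      case (elim u)
      then show ?case using strict by meson
    qed
  qed
  note ae = this
  have "AE u in U_measure. lo u i < u (Suc j) \<and> u (Suc j) < u (Suc k) \<and> u (Suc k) < hi u l \<and>
    hits_closed K (lo u i) (u (Suc j)) (u (Suc k)) (hi u l) \<longrightarrow> hits_open K (lo u i) (u (Suc j)) (u (Suc k)) (hi u l)" for i j k l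
  proof (cases "i \<noteq> Suc j \<and> i \<noteq> Suc k \<and> Suc j \<noteq> Suc k \<and> l \<noteq> Suc j \<and> l \<noteq> Suc k \<and> (i = 0 \<or> i \<noteq> l)")
    case True
    then have "AE u in U_measure. hits_closed K (lo u i) (u (Suc j)) (u (Suc k)) (hi u l) \<longrightarrow> hits_open K (lo u i) (u (Suc j)) (u (Suc k)) (hi u l)"
      by (intro ae) auto
    then show ?thesis by eventually_elim blast
  next
    case False
    \<comment> \<open>Coinciding labels contradict the strict order of the four sides, so the
      implication holds vacuously.\<close>
    then have "\<not> (lo u i < u (Suc j) \<and> u (Suc j) < u (Suc k) \<and> u (Suc k) < hi u l)" for u
      by (auto simp: lo_def hi_def)
    then show ?thesis by blast
  qed
  then show ?thesis unfolding good_iff AE_all_countable by blast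
qed

section \<open>The sampled process of a compact set is an erased-interval process\<close>

section \<open>Exchangeability\<close>

definition swap_ix :: "nat \<Rightarrow> nat \<Rightarrow> nat \<Rightarrow> nat" where
  "swap_ix a b i = (if i = a then b else if i = b then a else i)"

definition sw :: "nat \<Rightarrow> nat \<Rightarrow> (nat \<Rightarrow> real) \<Rightarrow> nat \<Rightarrow> real" where
  "sw a b u = (\<lambda>i\<in>{1..}. u (swap_ix a b i))"

lemma swap_ix_invol [simp]: "swap_ix a b (swap_ix a b i) = i"
  by (simp add: swap_ix_def)

lemma swap_ix_in: "a \<in> A \<Longrightarrow> b \<in> A \<Longrightarrow> i \<in> A \<Longrightarrow> swap_ix a b i \<in> A"
  by (simp add: swap_ix_def)

lemma sw_in_space: "sw a b u \<in> space U_measure"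
  by (simp add: space_U_measure sw_def)

lemma distr_sw:
  assumes "1 \<le> a" "1 \<le> b"
  shows "distr U_measure U_measure (sw a b) = U_measure"
proof -
  have "inj_on (swap_ix a b) {1..}" by (metis inj_onI swap_ix_invol)
  moreover have "swap_ix a b \<in> {1..} \<rightarrow> {1..}" using assms by (auto simp: swap_ix_def)
  ultimately show ?thesis
    using distr_PiM_reindex[of "{1..}" "\<lambda>_. unif" "swap_ix a b" "{1..}"] prob_space_unif
    unfolding U_measure_def sw_def[abs_def] by simp
qed

lemma measurable_sw:
  assumes "1 \<le> a" "1 \<le> b"
  shows "sw a b \<in> U_measure \<rightarrow>\<^sub>M U_measure"
  unfolding U_measure_def sw_def[abs_def] using assms
  by (intro measurable_restrict measurable_component_singleton) (auto simp: swap_ix_def)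

lemma cnt_sw:
  assumes "a \<in> {1..m}" "b \<in> {1..m}"
  shows "cnt (sw a b u) m x = cnt u m x"
proof -
  have sw: "sw a b u j = u (swap_ix a b j)" if "j \<in> {1..m}" for j using that by (simp add: sw_def)
  have "bij_betw (swap_ix a b) {j \<in> {1..m}. sw a b u j \<le> x} {j \<in> {1..m}. u j \<le> x}"
  proof (rule bij_betw_byWitness[where f'="swap_ix a b"])
    show "swap_ix a b ` {j \<in> {1..m}. sw a b u j \<le> x} \<subseteq> {j \<in> {1..m}. u j \<le> x}"
    proof
      fix i assume "i \<in> swap_ix a b ` {j \<in> {1..m}. sw a b u j \<le> x}"
      then obtain j where j: "i = swap_ix a b j" "j \<in> {1..m}" "sw a b u j \<le> x" by blast
      then show "i \<in> {j \<in> {1..m}. u j \<le> x}" using swap_ix_in[OF assms j(2)] sw[OF j(2)] by simp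
    qed
    show "swap_ix a b ` {j \<in> {1..m}. u j \<le> x} \<subseteq> {j \<in> {1..m}. sw a b u j \<le> x}"
    proof
      fix i assume "i \<in> swap_ix a b ` {j \<in> {1..m}. u j \<le> x}"
      then obtain j where j: "i = swap_ix a b j" "j \<in> {1..m}" "u j \<le> x" by blast
      then show "i \<in> {j \<in> {1..m}. sw a b u j \<le> x}" using swap_ix_in[OF assms j(2)] sw[OF swap_ix_in[OF assms j(2)]] by simp
    qed
  qed auto
  then show ?thesis unfolding cnt_def by (rule bij_betw_same_card)
qed

lemma image_sw:
  assumes "a \<in> {1..m}" "b \<in> {1..m}"
  shows "sw a b u ` {1..m} = u ` {1..m}"
proof -
  have "swap_ix a b ` {1..m} = {1..m}"
  proof
    show "swap_ix a b ` {1..m} \<subseteq> {1..m}" using swap_ix_in[OF assms] by blast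
    show "{1..m} \<subseteq> swap_ix a b ` {1..m}"
    proof
      fix i assume "i \<in> {1..m}"
      then have "swap_ix a b i \<in> {1..m}" by (rule swap_ix_in[OF assms])
      then show "i \<in> swap_ix a b ` {1..m}" by (metis image_eqI swap_ix_invol)
    qed
  qed
  moreover have "sw a b u ` {1..m} = u ` swap_ix a b ` {1..m}"
    unfolding image_image by (rule image_cong) (auto simp: sw_def)
  ultimately show ?thesis by simp
qed

lemma phi_inf_sw:
  assumes "K \<in> InSy_inf" "a \<in> {1..m}" "b \<in> {1..m}"
  shows "phi_inf m K (order_stat (sw a b u) m) = phi_inf m K (order_stat u m)"
  unfolding phi_inf_cut[OF assms(1)] cnt_sw[OF assms(2,3)] image_sw[OF assms(2,3)] ..

lemma eraser_of_U_sw: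
  assumes "a \<in> {1..m}" "b \<in> {1..m}"
  shows "eraser_of_U (sw a b u) m = eraser_of_U u m"
proof -
  have "sw a b u (Suc m) = u (Suc m)" using assms by (auto simp: sw_def swap_ix_def)
  moreover have "cnt (sw a b u) (Suc m) x = cnt u (Suc m) x" for x using assms by (intro cnt_sw) auto
  ultimately show ?thesis unfolding eraser_of_U_eq by simp
qed

lemma sets_future_field:
  "sets (future_field M I \<eta> n) = sigma_sets (space M)
    {{\<omega> \<in> space M. (I m \<omega>, \<eta> m \<omega>) \<in> B} | m B. n \<le> m}"
proof -
  have "(\<Union>m\<in>{n..}. sets (vimage_algebra (space M) (\<lambda>\<omega>. (I m \<omega>, \<eta> m \<omega>)) (count_space UNIV))) =
      {{\<omega> \<in> space M. (I m \<omega>, \<eta> m \<omega>) \<in> B} | m B. n \<le> m}"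
    by (auto simp: sets_vimage_algebra2 vimage_def Int_def conj_commute)
  then show ?thesis unfolding future_field_def by (simp only:) (rule sets_measure_of, auto)
qed

lemma space_future_field: "space (future_field M I \<eta> n) = space M"
  unfolding future_field_def by (rule space_measure_of) (auto simp: sets_vimage_algebra2)

lemma future_field_genI: "n \<le> m \<Longrightarrow> {\<omega> \<in> space M. (I m \<omega>, \<eta> m \<omega>) \<in> B} \<in> sets (future_field M I \<eta> n)"
  unfolding sets_future_field by (rule sigma_sets.Basic) blast

abbreviation IK :: "(real \<times> real) set \<Rightarrow> nat \<Rightarrow> (nat \<Rightarrow> real) \<Rightarrow> nat set set" where
  "IK K \<equiv> (\<lambda>n u. phi_inf n K (order_stat u n))"

abbreviation EU :: "nat \<Rightarrow> (nat \<Rightarrow> real) \<Rightarrow> nat" where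
  "EU \<equiv> (\<lambda>n u. eraser_of_U u n)"

text \<open>At a level \<open>m \<ge> n\<close> the interval system depends on the first
  \<open>m\<close> points symmetrically, and the eraser is the rank of point \<open>m + 1\<close>
  among the first \<open>m + 1\<close>. Swapping two of the first \<open>n\<close> points changes
  neither, and this invariance passes from the generators to the sigma-field.\<close>

lemma future_sw:
  assumes K: "K \<in> InSy_inf" and ab: "a \<in> {1..n}" "b \<in> {1..n}"
    and A: "A \<in> sets (future_field U_measure (IK K) EU n)"
  shows "\<forall>u\<in>space U_measure. sw a b u \<in> A \<longleftrightarrow> u \<in> A"
  using A unfolding sets_future_field
proof (induction rule: sigma_sets.induct)
  case (Basic C)
  then obtain m B where C: "C = {u \<in> space U_measure. (phi_inf m K (order_stat u m), eraser_of_U u m) \<in> B}" "n \<le> m" by blast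
  have ab: "a \<in> {1..m}" "b \<in> {1..m}" using ab C by auto
  show ?case unfolding C(1) by (simp add: phi_inf_sw[OF K ab] eraser_of_U_sw[OF ab] sw_in_space)
next
  case (Compl C)
  then show ?case by (simp add: sw_in_space)
qed auto

text \<open>The rank of \<open>U\<^sub>n\<^sub>+\<^sub>1\<close> among the first \<open>n + 1\<close> points may be replaced by the rank of any
  \<open>U\<^sub>j\<close>, \<open>j \<le> n + 1\<close>, without changing the probability; exactly one of these ranks equals \<open>r\<close>.\<close>

lemma eraser_uniform:
  assumes K: "K \<in> InSy_inf" and A: "A \<in> sets (future_field U_measure (IK K) EU (Suc n))"
    and A': "A \<in> sets U_measure" and r: "r \<in> {1..Suc n}"
  shows "UM.prob {u \<in> A. eraser_of_U u n = r} = UM.prob A / real (Suc n)"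
proof -
  define E where "E j = {u \<in> A. cnt u (Suc n) (u j) = r}" for j
  have Asub: "A \<subseteq> space U_measure" using A' by (rule sets.sets_into_space)
  have mE: "E j \<in> sets U_measure" if "j \<in> {1..Suc n}" for j
  proof -
    have [measurable]: "(\<lambda>u. cnt u (Suc n) (u j)) \<in> U_measure \<rightarrow>\<^sub>M count_space UNIV"
      using that by (intro measurable_cnt measurable_U_coord) auto
    have "E j = A \<inter> {u \<in> space U_measure. cnt u (Suc n) (u j) = r}" using Asub by (auto simp: E_def)
    also have "\<dots> \<in> sets U_measure" using A' by measurable
    finally show ?thesis .
  qed
  have "UM.prob (E j) = UM.prob (E (Suc n))" if j: "j \<in> {1..Suc n}" for j
  proof -
    let ?s = "sw j (Suc n)"
    have m: "?s \<in> U_measure \<rightarrow>\<^sub>M U_measure" using j by (intro measurable_sw) auto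
    have "UM.prob (E (Suc n)) = measure (distr U_measure U_measure ?s) (E (Suc n))"
      using j by (subst distr_sw) auto
    also have "\<dots> = UM.prob (?s -` E (Suc n) \<inter> space U_measure)"
      using m mE[of "Suc n"] by (intro measure_distr) auto
    also have "?s -` E (Suc n) \<inter> space U_measure = E j"
    proof -
      have "?s u (Suc n) = u j" for u by (simp add: sw_def swap_ix_def)
      then have "?s u \<in> E (Suc n) \<longleftrightarrow> u \<in> E j" if "u \<in> space U_measure" for u
        using future_sw[OF K j _ A, of "Suc n"] cnt_sw[OF j, of "Suc n"] that by (simp add: E_def)
      then show ?thesis using Asub by (auto simp: E_def)
    qed
    finally show ?thesis by simp
  qed
  then have "(\<Sum>j\<in>{1..Suc n}. UM.prob (E j)) = (\<Sum>j\<in>{1..Suc n}. UM.prob (E (Suc n)))" by (rule sum.cong[OF refl])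
  then have eq: "(\<Sum>j\<in>{1..Suc n}. UM.prob (E j)) = real (Suc n) * UM.prob (E (Suc n))" by (simp only: sum_constant card_atLeastAtMost) simp
  let ?G = "{u \<in> space U_measure. generic u}"
  have mG: "?G \<in> sets U_measure"
    using pred_generic[of "\<lambda>u. u" U_measure, OF measurable_U_coord] by (simp add: pred_def)
  have aeG: "AE u in U_measure. u \<in> ?G" using AE_nice AE_space by eventually_elim (simp add: nice_def)
  have "UM.prob A = UM.prob (A \<inter> ?G)"
    using aeG A' mG by (intro UM.finite_measure_eq_AE) auto
  also have "A \<inter> ?G = (\<Union>j\<in>{1..Suc n}. E j \<inter> ?G)"
  proof -
    have "\<exists>j\<in>{1..Suc n}. cnt u (Suc n) (u j) = r" if "generic u" for u
      using cnt_self_surj[OF that, of "Suc n"] r by (metis imageE)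
    then show ?thesis using Asub by (auto simp: E_def)
  qed
  also have "UM.prob \<dots> = (\<Sum>j\<in>{1..Suc n}. UM.prob (E j \<inter> ?G))"
  proof (rule UM.finite_measure_finite_Union)
    show "(\<lambda>j. E j \<inter> ?G) ` {1..Suc n} \<subseteq> sets U_measure" using mE mG by auto
    show "disjoint_family_on (\<lambda>j. E j \<inter> ?G) {1..Suc n}"
      unfolding disjoint_family_on_def
    proof (intro ballI impI)
      fix i j assume ij: "i \<in> {1..Suc n}" "j \<in> {1..Suc n}" "i \<noteq> j"
      have False if "cnt u (Suc n) (u i) = r" "cnt u (Suc n) (u j) = r" "generic u" for u
        using cnt_self_inj[OF that(3) ij(1,2)] that(1,2) ij(3) by simp
      then show "E i \<inter> ?G \<inter> (E j \<inter> ?G) = {}" by (auto simp: E_def)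
    qed
  qed simp
  also have "\<dots> = (\<Sum>j\<in>{1..Suc n}. UM.prob (E j))"
  proof (rule sum.cong[OF refl])
    fix j assume j: "j \<in> {1..Suc n}"
    show "UM.prob (E j \<inter> ?G) = UM.prob (E j)"
      using aeG mE[OF j] mG by (intro UM.finite_measure_eq_AE) auto
  qed
  finally have "UM.prob A = real (Suc n) * UM.prob (E (Suc n))" unfolding eq .
  moreover have "{u \<in> A. eraser_of_U u n = r} = E (Suc n)" by (simp add: E_def eraser_of_U_eq)
  ultimately show ?thesis by (simp del: of_nat_Suc)
qed

lemma sets_future_field_sub:
  assumes I: "\<And>m. n \<le> m \<Longrightarrow> I m \<in> M \<rightarrow>\<^sub>M count_space UNIV" and \<eta>: "\<And>m. n \<le> m \<Longrightarrow> \<eta> m \<in> M \<rightarrow>\<^sub>M count_space UNIV"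
  shows "sets (future_field M I \<eta> n) \<subseteq> sets M"
  unfolding sets_future_field
proof (rule sets.sigma_sets_subset, safe)
  fix m :: nat and B :: "(nat set set \<times> nat) set" assume m: "n \<le> m"
  \<comment> \<open>The event is sliced along the countably many values of \<open>\<eta> m\<close>,
    because measurability into an uncountable discrete space does not pass to pairs.\<close>
  have "{\<omega> \<in> space M. (I m \<omega>, \<eta> m \<omega>) \<in> B} = (\<Union>k. (\<eta> m -` {k} \<inter> space M) \<inter> (I m -` {J. (J, k) \<in> B} \<inter> space M))"
    by auto
  also have "\<dots> \<in> sets M"
    by (intro sets.countable_UN image_subsetI sets.Int measurable_sets[OF I[OF m]] measurable_sets[OF \<eta>[OF m]]) simp_all
  finally show "{\<omega> \<in> space M. (I m \<omega>, \<eta> m \<omega>) \<in> B} \<in> sets M" .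
qed

lemma measurable_IK: "K \<in> InSy_inf \<Longrightarrow> IK K n \<in> U_measure \<rightarrow>\<^sub>M count_space UNIV"
proof -
  assume "K \<in> InSy_inf"
  then have "(\<lambda>_. K) \<in> U_measure \<rightarrow>\<^sub>M BIS" by (simp add: space_BIS)
  from measurable_phi_inf[OF this, of "\<lambda>u. u", OF measurable_U_coord] show ?thesis by simp
qed

lemma measurable_EU: "EU n \<in> U_measure \<rightarrow>\<^sub>M count_space UNIV"
  by (rule measurable_eraser_of_U) (rule measurable_U_coord)

text \<open>With the full event for \<open>A\<close> this is the uniform law of the eraser;
  comparing that case with a general \<open>A\<close> gives independence from the future.\<close>

lemma eraser_uniform_set:
  assumes K: "K \<in> InSy_inf" and A: "A \<in> sets (future_field U_measure (IK K) EU (Suc n))"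
  shows "UM.prob ({u \<in> space U_measure. eraser_of_U u n \<in> R} \<inter> A) = UM.prob A * (real (card (R \<inter> {1..Suc n})) / real (Suc n))"
proof -
  have A': "A \<in> sets U_measure"
    by (rule subsetD[OF _ A], rule sets_future_field_sub, rule measurable_IK[OF K], rule measurable_EU)
  have Asub: "A \<subseteq> space U_measure" using A' by (rule sets.sets_into_space)
  have m: "{u \<in> A. eraser_of_U u n = r} \<in> sets U_measure" for r
  proof -
    have "{u \<in> A. eraser_of_U u n = r} = (EU n -` {r} \<inter> space U_measure) \<inter> A" using Asub by auto
    then show ?thesis using measurable_sets[OF measurable_EU, of "{r}" n] A' by auto
  qed
  have "{u \<in> space U_measure. eraser_of_U u n \<in> R} \<inter> A = (\<Union>r\<in>R \<inter> {1..Suc n}. {u \<in> A. eraser_of_U u n = r})"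
    using Asub eraser_of_U_range[of _ n] by blast
  then have "UM.prob ({u \<in> space U_measure. eraser_of_U u n \<in> R} \<inter> A) = (\<Sum>r\<in>R \<inter> {1..Suc n}. UM.prob {u \<in> A. eraser_of_U u n = r})"
    using m by (simp only:) (rule UM.finite_measure_finite_Union, auto simp: disjoint_family_on_def)
  also have "\<dots> = (\<Sum>r\<in>R \<inter> {1..Suc n}. UM.prob A / real (Suc n))"
    by (intro sum.cong refl eraser_uniform[OF K A A']) auto
  finally show ?thesis by simp
qed

lemma eip_U_measure:
  assumes K: "K \<in> InSy_inf"
  shows "erased_interval_process U_measure (IK K) EU"
  unfolding erased_interval_process_def
proof (intro conjI allI impI)
  show "prob_space U_measure" by (rule prob_space_U_measure)
  fix n :: nat assume n: "1 \<le> n"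
  show "IK K n \<in> U_measure \<rightarrow>\<^sub>M count_space UNIV" by (rule measurable_IK[OF K])
  show "EU n \<in> U_measure \<rightarrow>\<^sub>M count_space UNIV" by (rule measurable_EU)
  show "AE u in U_measure. (IK K n u, EU n u) \<in> InSy n \<times> {1..n + 1}"
    using phi_inf_in_InSy eraser_of_U_range by simp
  have sp: "space U_measure \<in> sets (future_field U_measure (IK K) EU (Suc n))"
    using sets.top[of "future_field U_measure (IK K) EU (Suc n)"] by (simp add: space_future_field)
  have pr: "UM.prob {u \<in> space U_measure. eraser_of_U u n \<in> R} = real (card (R \<inter> {1..Suc n})) / real (Suc n)" for R
    using eraser_uniform_set[OF K sp, of R] by (simp add: UM.prob_space Int_absorb2)
  show "distr U_measure (count_space UNIV) (EU n) = measure_pmf (pmf_of_set {1..n + 1})"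
  proof (rule measure_eqI)
    fix R :: "nat set"
    have "emeasure (distr U_measure (count_space UNIV) (EU n)) R = emeasure U_measure (EU n -` R \<inter> space U_measure)"
      by (rule emeasure_distr[OF measurable_EU]) simp
    also have "EU n -` R \<inter> space U_measure = {u \<in> space U_measure. eraser_of_U u n \<in> R}" by auto
    also have "emeasure U_measure \<dots> = ennreal (real (card (R \<inter> {1..Suc n})) / real (Suc n))"
      using pr by (simp add: UM.emeasure_eq_measure)
    also have "\<dots> = emeasure (measure_pmf (pmf_of_set {1..n + 1})) R"
      by (subst emeasure_pmf_of_set) (auto simp: Int_commute)
    finally show "emeasure (distr U_measure (count_space UNIV) (EU n)) R = emeasure (measure_pmf (pmf_of_set {1..n + 1})) R" .
  qed simp
  show "UM.indep_set (sets (vimage_algebra (space U_measure) (EU n) (count_space UNIV)))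
       (sets (future_field U_measure (IK K) EU (n + 1)))"
  proof (rule UM.indep_setI)
    show "sets (vimage_algebra (space U_measure) (EU n) (count_space UNIV)) \<subseteq> UM.events"
      using measurable_sets[OF measurable_EU] by (auto simp: sets_vimage_algebra2)
    show "sets (future_field U_measure (IK K) EU (n + 1)) \<subseteq> UM.events"
      by (rule sets_future_field_sub, rule measurable_IK[OF K], rule measurable_EU)
    fix a A assume a: "a \<in> sets (vimage_algebra (space U_measure) (EU n) (count_space UNIV))"
      and A: "A \<in> sets (future_field U_measure (IK K) EU (n + 1))"
    obtain R where R: "a = {u \<in> space U_measure. eraser_of_U u n \<in> R}"
      using a by (auto simp: sets_vimage_algebra2 vimage_def Int_def conj_commute)
    show "UM.prob (a \<inter> A) = UM.prob a * UM.prob A"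
      using eraser_uniform_set[OF K, of A n R] A pr[of R] unfolding R by simp
  qed
  show "AE u in U_measure. IK K n u = phi (IK K (n + 1) u) (EU n u)"
    using AE_good[OF K] AE_nice
  proof eventually_elim
    case (elim u)
    then show ?case using phi_phi_inf[OF K _ elim(1), of n] by (simp add: nice_def)
  qed
qed

section \<open>Representation of an arbitrary erased-interval process\<close>

section \<open>General erased-interval processes\<close>

abbreviation EM :: "(nat \<Rightarrow> nat) measure" where
  "EM \<equiv> \<Pi>\<^sub>M n\<in>{1..}. count_space UNIV"

locale eip = prob_space M for M :: "'a measure" +
  fixes I :: "nat \<Rightarrow> 'a \<Rightarrow> nat set set" and \<eta> :: "nat \<Rightarrow> 'a \<Rightarrow> nat"
  assumes eip: "erased_interval_process M I \<eta>"
begin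

abbreviation F :: "nat \<Rightarrow> 'a measure" where "F \<equiv> future_field M I \<eta>"
abbreviation T :: "'a measure" where "T \<equiv> terminal_field M I \<eta>"

lemma eipD:
  assumes "1 \<le> n"
  shows "I n \<in> M \<rightarrow>\<^sub>M count_space UNIV" "\<eta> n \<in> M \<rightarrow>\<^sub>M count_space UNIV"
    "AE \<omega> in M. I n \<omega> \<in> InSy n \<and> \<eta> n \<omega> \<in> {1..n + 1}"
    "distr M (count_space UNIV) (\<eta> n) = measure_pmf (pmf_of_set {1..n + 1})"
    "indep_set (sets (vimage_algebra (space M) (\<eta> n) (count_space UNIV))) (sets (F (n + 1)))"
    "AE \<omega> in M. I n \<omega> = phi (I (n + 1) \<omega>) (\<eta> n \<omega>)"
  using eip assms unfolding erased_interval_process_def by auto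

lemma F_sub: "1 \<le> n \<Longrightarrow> sets (F n) \<subseteq> sets M"
  by (intro sets_future_field_sub eipD) auto

text \<open>An intersection of sigma-fields is already a sigma-field.\<close>

lemma sets_T: "sets T = (\<Inter>n\<in>{1..}. sets (F n))"
proof -
  let ?X = "\<Inter>n\<in>{1..}. sets (F n)"
  have "?X \<subseteq> Pow (space M)"
    using sets.space_closed[of "F 1"] by (auto simp: space_future_field)
  then have eq: "sets T = sigma_sets (space M) ?X" unfolding terminal_field_def by (rule sets_measure_of)
  have "sigma_sets (space M) ?X \<subseteq> sets (F n)" if "n \<in> {1..}" for n
    using sets.sigma_sets_subset[of ?X "F n"] that by (auto simp: space_future_field)
  then have "sigma_sets (space M) ?X \<subseteq> ?X" by blast
  moreover have "?X \<subseteq> sigma_sets (space M) ?X" by (auto intro: sigma_sets.Basic)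
  ultimately show ?thesis unfolding eq by (rule equalityI)
qed

lemma space_T: "space T = space M"
proof -
  have "(\<Inter>n\<in>{1..}. sets (F n)) \<subseteq> Pow (space M)"
    using sets.space_closed[of "F 1"] by (auto simp: space_future_field)
  then show ?thesis unfolding terminal_field_def by (rule space_measure_of)
qed

lemma T_sub_F: "1 \<le> n \<Longrightarrow> sets T \<subseteq> sets (F n)"
  unfolding sets_T by blast

lemma T_sub: "sets T \<subseteq> sets M"
  using T_sub_F[of 1] F_sub[of 1] by auto

lemma eraser_in_F: "n \<le> m \<Longrightarrow> \<eta> m -` B \<inter> space M \<in> sets (F n)"
proof -
  assume "n \<le> m"
  from future_field_genI[OF this, of M I \<eta> "UNIV \<times> B"] show ?thesis by (simp add: vimage_def Int_def conj_commute)
qed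

lemma I_in_F: "n \<le> m \<Longrightarrow> I m -` B \<inter> space M \<in> sets (F n)"
proof -
  assume "n \<le> m"
  from future_field_genI[OF this, of M I \<eta> "B \<times> UNIV"] show ?thesis by (simp add: vimage_def Int_def conj_commute)
qed

text \<open>The smallest index \<open>b\<close> is split off: the terminal event and the erasers
  with larger indices all belong to \<open>F (b + 1)\<close>, from which \<open>\<eta> b\<close> is
  independent.\<close>

lemma chain_indep:
  assumes A: "A \<in> sets T" and J: "finite J" "J \<subseteq> {1..}"
  shows "prob (A \<inter> (\<Inter>k\<in>J. \<eta> k -` B k \<inter> space M)) = prob A * (\<Prod>k\<in>J. prob (\<eta> k -` B k \<inter> space M))"
  using J
proof (induction rule: finite_linorder_min_induct)
  case (insert b J)
  let ?C = "A \<inter> (\<Inter>k\<in>J. \<eta> k -` B k \<inter> space M)"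
  have b: "1 \<le> b" using insert.prems by auto
  have "?C \<in> sets (F (b + 1))"
  proof (cases "J = {}")
    case True
    then show ?thesis using A T_sub_F[of "b + 1"] by auto
  next
    case False
    have "(\<Inter>k\<in>J. \<eta> k -` B k \<inter> space M) \<in> sets (F (b + 1))"
      using insert.hyps False by (intro sets.finite_INT eraser_in_F) (auto simp: Suc_le_eq)
    moreover have "A \<in> sets (F (b + 1))" using A T_sub_F[of "b + 1"] by auto
    ultimately show ?thesis by (intro sets.Int)
  qed
  moreover have "\<eta> b -` B b \<inter> space M \<in> sets (vimage_algebra (space M) (\<eta> b) (count_space UNIV))"
    by (auto simp: sets_vimage_algebra2)
  ultimately have "prob ((\<eta> b -` B b \<inter> space M) \<inter> ?C) = prob (\<eta> b -` B b \<inter> space M) * prob ?C"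
    by (intro indep_setD[OF eipD(5)[OF b]])
  moreover have "A \<inter> (\<Inter>k\<in>insert b J. \<eta> k -` B k \<inter> space M) = (\<eta> b -` B b \<inter> space M) \<inter> ?C" by auto
  moreover have "b \<notin> J" using insert.hyps by blast
  ultimately show ?case using insert by (simp add: mult_ac)
qed simp

definition E :: "'a \<Rightarrow> nat \<Rightarrow> nat" where "E \<omega> = (\<lambda>n\<in>{1..}. \<eta> n \<omega>)"

lemma measurable_E: "E \<in> M \<rightarrow>\<^sub>M EM"
  unfolding E_def[abs_def] by (rule measurable_restrict) (auto intro: eipD)

lemma eraser_law: "distr M EM E = (\<Pi>\<^sub>M n\<in>{1..}. measure_pmf (pmf_of_set {1..n + 1}))"
proof -
  have spT: "space M \<in> sets T" using sets.top[of T] by (simp add: space_T)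
  have ind: "indep_vars (\<lambda>_. count_space UNIV) \<eta> {1..}"
    unfolding indep_vars_def2
  proof (intro conjI ballI)
    show "indep_sets (\<lambda>i. {\<eta> i -` A \<inter> space M |A. A \<in> sets (count_space UNIV)}) {1..}"
    proof (rule indep_setsI)
      show "{\<eta> i -` A \<inter> space M |A. A \<in> sets (count_space UNIV)} \<subseteq> events" if "i \<in> {1..}" for i
        using that measurable_sets[OF eipD(2)] by auto
      fix A J assume J: "J \<noteq> {}" "J \<subseteq> {1..}" "finite J"
        and A: "\<forall>j\<in>J. A j \<in> {\<eta> j -` A \<inter> space M |A. A \<in> sets (count_space UNIV)}"
      then obtain B where B: "\<And>j. j \<in> J \<Longrightarrow> A j = \<eta> j -` B j \<inter> space M" by simp metis
      have "(\<Inter>j\<in>J. A j) = space M \<inter> (\<Inter>k\<in>J. \<eta> k -` B k \<inter> space M)" using B J(1) by auto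
      then show "prob (\<Inter>j\<in>J. A j) = (\<Prod>j\<in>J. prob (A j))"
        using chain_indep[OF spT J(3,2), of B] B by (simp add: prob_space)
    qed
  qed (auto intro: eipD)
  have "distr M EM E = (\<Pi>\<^sub>M n\<in>{1..}. distr M (count_space UNIV) (\<eta> n))"
    using ind unfolding E_def[abs_def] by (subst (asm) indep_vars_iff_distr_eq_PiM') (auto intro: eipD)
  also have "\<dots> = (\<Pi>\<^sub>M n\<in>{1..}. measure_pmf (pmf_of_set {1..n + 1}))"
    by (intro PiM_cong) (auto simp: eipD(4))
  finally show ?thesis .
qed

text \<open>\<open>chain_indep\<close> gives independence on the finite-dimensional eraser events,
  an intersection-stable family that generates the events of the whole sequence.\<close>

lemma indep_T_E: "indep_set (sets T) {E -` A \<inter> space M | A. A \<in> sets EM}"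
proof -
  \<comment> \<open>The intersection with \<open>space M\<close> matters for empty \<open>J\<close>,
    where the intersection over \<open>J\<close> is the universe.\<close>
  define G where "G = {(\<Inter>k\<in>J. \<eta> k -` B k \<inter> space M) \<inter> space M | J B. finite J \<and> J \<subseteq> {1..}}"
  have G: "G \<subseteq> events"
    unfolding G_def
  proof safe
    fix J :: "nat set" and B assume J: "finite J" "J \<subseteq> {1..}"
    show "(\<Inter>k\<in>J. \<eta> k -` B k \<inter> space M) \<inter> space M \<in> events"
    proof (cases "J = {}")
      case False
      then have "(\<Inter>k\<in>J. \<eta> k -` B k \<inter> space M) \<in> events"
        using J by (intro sets.finite_INT measurable_sets[OF eipD(2)]) auto
      then show ?thesis by (rule sets.Int) (rule sets.top)
    qed simp
  qed
  have G_int: "Int_stable G"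
  proof (rule Int_stableI)
    fix a b assume "a \<in> G" "b \<in> G"
    then obtain J B J' B' where a: "a = (\<Inter>k\<in>J. \<eta> k -` B k \<inter> space M) \<inter> space M" "finite J" "J \<subseteq> {1..}"
      and b: "b = (\<Inter>k\<in>J'. \<eta> k -` B' k \<inter> space M) \<inter> space M" "finite J'" "J' \<subseteq> {1..}" unfolding G_def by blast
    define C where "C k = (if k \<in> J then B k else UNIV) \<inter> (if k \<in> J' then B' k else UNIV)" for k
    have "a \<inter> b = (\<Inter>k\<in>J \<union> J'. \<eta> k -` C k \<inter> space M) \<inter> space M"
      unfolding a b C_def by (auto split: if_splits)
    then show "a \<inter> b \<in> G" unfolding G_def using a b by (intro CollectI exI[of _ "J \<union> J'"] exI[of _ C]) auto
  qed
  have "indep_set (sets T) G"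
  proof (rule indep_setI[OF T_sub G])
    fix A b assume A: "A \<in> sets T" and "b \<in> G"
    then obtain J B where b: "b = (\<Inter>k\<in>J. \<eta> k -` B k \<inter> space M) \<inter> space M" "finite J" "J \<subseteq> {1..}" unfolding G_def by blast
    have spT: "space M \<in> sets T" using sets.top[of T] by (simp add: space_T)
    have "A \<subseteq> space M" using sets.sets_into_space[OF A] by (simp add: space_T)
    then have "A \<inter> b = A \<inter> (\<Inter>k\<in>J. \<eta> k -` B k \<inter> space M)" "b = space M \<inter> (\<Inter>k\<in>J. \<eta> k -` B k \<inter> space M)" using b(1) by auto
    then show "prob (A \<inter> b) = prob A * prob b"
      using chain_indep[OF A b(2,3), of B] chain_indep[OF spT b(2,3), of B] by (simp add: prob_space)
  qed
  then have "indep_set (sigma_sets (space M) (sets T)) (sigma_sets (space M) G)"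
    by (rule indep_set_sigma_sets[OF _ sets.Int_stable G_int])
  then have ind: "indep_set (sets T) (sigma_sets (space M) G)"
    using sets.sigma_sets_eq[of T] by (simp add: space_T)
  have Gs: "G \<subseteq> Pow (space M)" unfolding G_def by auto
  have "\<eta> n \<in> sigma (space M) G \<rightarrow>\<^sub>M count_space UNIV" if n: "n \<in> {1..}" for n
  proof (rule measurableI)
    fix A :: "nat set"
    have "\<eta> n -` A \<inter> space M = (\<Inter>k\<in>{n}. \<eta> k -` A \<inter> space M) \<inter> space M" by auto
    also have "\<dots> \<in> G" unfolding G_def using n by (intro CollectI exI[of _ "{n}"] exI[of _ "\<lambda>_. A"]) auto
    finally show "\<eta> n -` A \<inter> space (sigma (space M) G) \<in> sets (sigma (space M) G)"
      using Gs by (simp add: space_measure_of sets_measure_of)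
  qed simp
  then have mE: "E \<in> sigma (space M) G \<rightarrow>\<^sub>M EM"
    unfolding E_def[abs_def] by (intro measurable_restrict) auto
  have "E -` A \<inter> space M \<in> sigma_sets (space M) G" if "A \<in> sets EM" for A
    using measurable_sets[OF mE that] Gs by (simp add: space_measure_of sets_measure_of)
  then have "{E -` A \<inter> space M | A. A \<in> sets EM} \<subseteq> sigma_sets (space M) G" by blast
  then show ?thesis using ind indep_setD[OF ind] indep_setD_ev1[OF ind] indep_setD_ev2[OF ind]
    by (intro indep_setI) auto
qed

end

lemma eip_locale: "erased_interval_process M I \<eta> \<Longrightarrow> eip M I \<eta>"
  by (simp add: eip_def eip_axioms_def erased_interval_process_def)

section \<open>The points recovered from an eraser process\<close>

definition VE :: "(nat \<Rightarrow> nat) \<Rightarrow> nat \<Rightarrow> real" where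
  "VE e = (\<lambda>i\<in>{1..}. U_of_eraser e i)"

lemma measurable_EM_coord: "1 \<le> n \<Longrightarrow> (\<lambda>e. e n) \<in> EM \<rightarrow>\<^sub>M count_space UNIV"
  by (rule measurable_component_singleton) simp

text \<open>Lists of naturals form a countable type, so the recursion may be split along the values
  of the list and of the eraser.\<close>

lemma measurable_eraser_perm: "(\<lambda>e. eraser_perm e n) \<in> EM \<rightarrow>\<^sub>M count_space UNIV"
proof (induction n)
  case (Suc n)
  show ?case
  proof (cases "n = 0")
    case False
    then have m: "(\<lambda>e. e n) \<in> EM \<rightarrow>\<^sub>M count_space UNIV" by (intro measurable_EM_coord) simp
    have "(\<lambda>e. (\<lambda>k e. (\<lambda>L e. take (k - 1) L @ [Suc n] @ drop (k - 1) L) (eraser_perm e n) e) (e n) e) \<in> EM \<rightarrow>\<^sub>M count_space UNIV"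
      by (rule measurable_compose_countable[OF measurable_compose_countable[OF _ Suc] m]) simp
    then show ?thesis by simp
  qed simp
qed simp

lemma measurable_VE: "VE \<in> EM \<rightarrow>\<^sub>M U_measure"
proof -
  have "(\<lambda>e. U_of_eraser e i) \<in> borel_measurable EM" for i
    unfolding U_of_eraser_def
  proof (rule borel_measurable_lim_metric)
    fix n
    have "(\<lambda>L. real (THE j. j \<in> {1..n} \<and> L ! (j - 1) = i) / real n) \<in> count_space UNIV \<rightarrow>\<^sub>M borel" by simp
    from measurable_compose[OF measurable_eraser_perm this]
    show "(\<lambda>e. real (eraser_perm_inv e n i) / real n) \<in> borel_measurable EM" by (simp add: eraser_perm_inv_def)
  qed
  then have "VE \<in> EM \<rightarrow>\<^sub>M (\<Pi>\<^sub>M i\<in>{1..}. borel)"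
    unfolding VE_def[abs_def] by (intro measurable_restrict)
  then show ?thesis by (simp add: measurable_cong_sets[OF refl sets_U_measure])
qed

text \<open>A property of the eraser sequence alone, so that its probability depends only on the law
  of that sequence.\<close>

definition recover :: "(nat \<Rightarrow> nat) \<Rightarrow> bool" where
  "recover e \<longleftrightarrow> nice (VE e) \<and> (\<forall>n. 1 \<le> n \<longrightarrow> e n = eraser_of_U (VE e) n)"

lemma pred_recover: "Measurable.pred EM recover"
proof -
  have V: "(\<lambda>e. VE e i) \<in> borel_measurable EM" if "1 \<le> i" for i
    using measurable_compose[OF measurable_VE measurable_U_coord[OF that]] .
  have 1: "Measurable.pred EM (\<lambda>e. nice (VE e))" by (rule pred_nice) (rule V)
  have 2: "Measurable.pred EM (\<lambda>e. 1 \<le> n \<longrightarrow> e n = eraser_of_U (VE e) n)" for n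
  proof (cases "1 \<le> n")
    case True
    note [measurable] = measurable_EM_coord[OF True] measurable_eraser_of_U[where u=VE and M=EM, OF V]
    show ?thesis by measurable
  qed simp
  show ?thesis unfolding recover_def[abs_def] using 1 2 by (intro pred_intros_logic(3) pred_intros_countable(1))
qed

lemma VE_eraser_of_U:
  assumes u: "nice u" "u \<in> extensional {1..}"
  shows "VE (\<lambda>n\<in>{1..}. eraser_of_U u n) = u"
proof
  fix i
  show "VE (\<lambda>n\<in>{1..}. eraser_of_U u n) i = u i"
  proof (cases "1 \<le> i")
    case True
    have "U_of_eraser (\<lambda>n\<in>{1..}. eraser_of_U u n) i = U_of_eraser (eraser_of_U u) i"
      by (rule U_of_eraser_cong) simp
    then show ?thesis using U_of_eraser_of_U[OF u(1) True] True by (simp add: VE_def)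
  next
    case False
    then show ?thesis using u(2) by (simp add: VE_def extensional_def)
  qed
qed

text \<open>A reference process on the space of uniform points, from which the law of the eraser
  sequence is taken; \<open>diag\<close> is one concrete choice of compact set.\<close>

interpretation EUM: eip U_measure "IK diag" EU
  by (intro eip_locale eip_U_measure diag_in_InSy_inf)

lemma EUM_E: "EUM.E u = (\<lambda>n\<in>{1..}. eraser_of_U u n)"
  by (simp add: EUM.E_def)

context eip
begin

text \<open>By \<open>eraser_law\<close> the eraser sequences of all erased-interval processes have
  the same law. For the reference process the erasers are the ranks of given points, which
  \<open>VE_eraser_of_U\<close> recovers.\<close>

lemma AE_recover: "AE \<omega> in M. recover (E \<omega>)"
proof -
  have "AE u in U_measure. recover (EUM.E u)"
    using AE_nice AE_space
  proof eventually_elim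
    case (elim u)
    then have "VE (EUM.E u) = u" unfolding EUM_E by (intro VE_eraser_of_U) (auto simp: space_U_measure)
    then show ?case unfolding recover_def using elim by (simp add: EUM_E)
  qed
  then have "AE e in distr U_measure EM EUM.E. recover e"
    using pred_recover by (subst AE_distr_iff[OF EUM.measurable_E]) (auto simp: pred_def)
  then have "AE e in distr M EM E. recover e" unfolding eraser_law EUM.eraser_law .
  then show ?thesis by (rule AE_distrD[OF measurable_E])
qed

definition U :: "'a \<Rightarrow> nat \<Rightarrow> real" where "U \<omega> = VE (E \<omega>)"

lemma measurable_U: "U \<in> M \<rightarrow>\<^sub>M U_measure"
  unfolding U_def[abs_def] by (rule measurable_compose[OF measurable_E measurable_VE])

lemma U_eq: "U \<omega> = (\<lambda>i\<in>{1..}. U_of_eraser (\<lambda>n. \<eta> n \<omega>) i)"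
proof -
  have "U_of_eraser (E \<omega>) i = U_of_eraser (\<lambda>n. \<eta> n \<omega>) i" for i
    by (rule U_of_eraser_cong) (simp add: E_def)
  then show ?thesis by (simp add: U_def VE_def)
qed

lemma distr_U: "distr M U_measure U = U_measure"
proof -
  have "distr M U_measure U = distr (distr M EM E) U_measure VE"
    unfolding U_def[abs_def] by (subst distr_distr[OF measurable_VE measurable_E]) (simp add: comp_def)
  also have "\<dots> = distr (distr U_measure EM EUM.E) U_measure VE" unfolding eraser_law EUM.eraser_law ..
  also have "\<dots> = distr U_measure U_measure (\<lambda>u. VE (EUM.E u))"
    by (subst distr_distr[OF measurable_VE EUM.measurable_E]) (simp add: comp_def)
  also have "\<dots> = distr U_measure U_measure (\<lambda>u. u)"
  proof (rule distr_cong_AE)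
    show "AE u in U_measure. VE (EUM.E u) = u"
      using AE_nice AE_space
    proof eventually_elim
      case (elim u)
      then show ?case unfolding EUM_E by (intro VE_eraser_of_U) (auto simp: space_U_measure)
    qed
    show "(\<lambda>u. VE (EUM.E u)) \<in> U_measure \<rightarrow>\<^sub>M U_measure"
      by (rule measurable_compose[OF EUM.measurable_E measurable_VE])
  qed auto
  also have "\<dots> = U_measure" by (rule distr_id)
  finally show ?thesis .
qed

lemma indep_T_U: "indep_set (sets T) {U -` A \<inter> space M | A. A \<in> sets U_measure}"
proof -
  have *: "U -` A \<inter> space M \<in> {E -` A \<inter> space M | A. A \<in> sets EM}" if "A \<in> sets U_measure" for A
  proof -
    have "VE -` A \<inter> space EM \<in> sets EM" by (rule measurable_sets[OF measurable_VE that])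
    moreover have "U -` A \<inter> space M = E -` (VE -` A \<inter> space EM) \<inter> space M"
      using measurable_space[OF measurable_E] by (auto simp: U_def)
    ultimately show ?thesis by blast
  qed
  show ?thesis
  proof (rule indep_setI[OF T_sub])
    show "{U -` A \<inter> space M | A. A \<in> sets U_measure} \<subseteq> events"
      using measurable_sets[OF measurable_U] by blast
    fix a b assume a: "a \<in> sets T" and "b \<in> {U -` A \<inter> space M | A. A \<in> sets U_measure}"
    then have "b \<in> {E -` A \<inter> space M | A. A \<in> sets EM}" using * by blast
    then show "prob (a \<inter> b) = prob a * prob b" by (rule indep_setD[OF indep_T_E a])
  qed
qed

end

section \<open>The limit of the rescaled interval systems\<close>

context eip
begin

text \<open>The type of \<open>I\<close> is uncountable, so that measurability into \<open>count_space UNIV\<close> does not pass to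
  pairs; replacing \<open>I n\<close> outside \<^term>\<open>InSy n\<close> leaves finitely many values and removes this obstacle.\<close>

definition R :: "nat \<Rightarrow> 'a \<Rightarrow> (real \<times> real) set" where
  "R n \<omega> = (if 1 \<le> n \<and> I n \<omega> \<in> InSy n then rescale n (I n \<omega>) else diag)"

lemma R_mem: "R n \<omega> \<in> InSy_inf"
  using rescale_in_InSy_inf diag_in_InSy_inf by (auto simp: R_def)

lemma R_range: "R n \<omega> \<in> insert diag (rescale n ` InSy n)"
  by (auto simp: R_def)

lemma R_in_F: "m \<le> n \<Longrightarrow> {\<omega> \<in> space M. R n \<omega> \<in> S} \<in> sets (F m)"
proof -
  assume "m \<le> n"
  from I_in_F[OF this, of "{J. (if 1 \<le> n \<and> J \<in> InSy n then rescale n J else diag) \<in> S}"]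
  have "{\<omega> \<in> space M. (if 1 \<le> n \<and> I n \<omega> \<in> InSy n then rescale n (I n \<omega>) else diag) \<in> S} \<in> sets (F m)"
    by (simp only: vimage_def Int_def mem_Collect_eq conj_commute)
  then show ?thesis by (simp only: R_def)
qed

text \<open>\<open>R n\<close> takes finitely many values, so the joint condition splits into
  finitely many conditions on \<open>R n'\<close>.\<close>

lemma R_pair_in_F:
  assumes "m \<le> n" "m \<le> n'"
  shows "{\<omega> \<in> space M. P (R n \<omega>) (R n' \<omega>)} \<in> sets (F m)"
proof -
  have "{\<omega> \<in> space M. P (R n \<omega>) (R n' \<omega>)} =
      (\<Union>L\<in>insert diag (rescale n ` InSy n). {\<omega> \<in> space M. R n \<omega> \<in> {L}} \<inter> {\<omega> \<in> space M. R n' \<omega> \<in> {L'. P L L'}})"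
    (is "?A = (\<Union>L\<in>_. ?B L)")
  proof (intro equalityI subsetI)
    fix \<omega> assume "\<omega> \<in> ?A"
    then have "\<omega> \<in> ?B (R n \<omega>)" by simp
    then show "\<omega> \<in> (\<Union>L\<in>insert diag (rescale n ` InSy n). ?B L)" using R_range[of n \<omega>] by (rule UN_I[rotated])
  qed auto
  also have "\<dots> \<in> sets (F m)"
  proof (rule sets.finite_UN)
    show "finite (insert diag (rescale n ` InSy n))" by (simp add: finite_InSy)
    show "{\<omega> \<in> space M. R n \<omega> \<in> {L}} \<inter> {\<omega> \<in> space M. R n' \<omega> \<in> {L'. P L L'}} \<in> sets (F m)" for L
      by (rule sets.Int) (rule R_in_F[OF assms(1)], rule R_in_F[OF assms(2)])
  qed
  finally show ?thesis .
qed

definition conv :: "'a set" where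
  "conv = {\<omega> \<in> space M. IS.MCauchy (\<lambda>n. R n \<omega>)}"

text \<open>A fixed value off the Cauchy event makes the limit measurable for the terminal field
  exactly, and not only up to null events.\<close>

definition I_inf :: "'a \<Rightarrow> (real \<times> real) set" where
  "I_inf \<omega> = (if IS.MCauchy (\<lambda>n. R n \<omega>) then (SOME K. limitin InSy_inf_topology (\<lambda>n. R n \<omega>) K sequentially) else diag)"

lemma I_inf_limit:
  assumes "IS.MCauchy (\<lambda>n. R n \<omega>)"
  shows "limitin InSy_inf_topology (\<lambda>n. R n \<omega>) (I_inf \<omega>) sequentially"
proof -
  have "\<exists>K. limitin InSy_inf_topology (\<lambda>n. R n \<omega>) K sequentially"
    using IS_mcomplete assms unfolding IS.mcomplete_def by blast
  from someI_ex[OF this] show ?thesis using assms by (simp add: I_inf_def)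
qed

lemma I_inf_mem: "I_inf \<omega> \<in> InSy_inf"
  using I_inf_limit[of \<omega>] diag_in_InSy_inf by (cases "IS.MCauchy (\<lambda>n. R n \<omega>)") (auto simp: limitin_IS_iff I_inf_def)

lemma I_inf_eqI:
  assumes lim: "limitin InSy_inf_topology (\<lambda>n. rescale n (I n \<omega>)) K sequentially" and I: "\<And>n. 1 \<le> n \<Longrightarrow> I n \<omega> \<in> InSy n"
  shows "I_inf \<omega> = K" "limitin InSy_inf_topology (\<lambda>n. rescale n (I n \<omega>)) (I_inf \<omega>) sequentially"
proof -
  have R: "R n \<omega> = rescale n (I n \<omega>)" if "1 \<le> n" for n using I that by (simp add: R_def)
  have "limitin InSy_inf_topology (\<lambda>n. R n \<omega>) K sequentially"
    unfolding limitin_IS_iff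
  proof (intro conjI allI impI)
    show "K \<in> InSy_inf" using lim by (simp add: limitin_IS_iff)
    fix e :: real assume "0 < e"
    then obtain N where N: "\<forall>n\<ge>N. rescale n (I n \<omega>) \<in> InSy_inf \<and> d_haus (rescale n (I n \<omega>)) K < e"
      using lim unfolding limitin_IS_iff by blast
    have "R n \<omega> \<in> InSy_inf \<and> d_haus (R n \<omega>) K < e" if "max 1 N \<le> n" for n using N R[of n] that by auto
    then show "\<exists>N. \<forall>n\<ge>N. R n \<omega> \<in> InSy_inf \<and> d_haus (R n \<omega>) K < e" by blast
  qed
  moreover from this have "IS.MCauchy (\<lambda>n. R n \<omega>)" by (intro IS.convergent_imp_MCauchy) (use R_mem in auto)
  ultimately show "I_inf \<omega> = K"
    using I_inf_limit IS.limitin_metric_unique trivial_limit_sequentially by blast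
  with lim show "limitin InSy_inf_topology (\<lambda>n. rescale n (I n \<omega>)) (I_inf \<omega>) sequentially" by simp
qed

text \<open>The Cauchy property concerns late indices only. In the criterion all indices are at
  least \<open>m\<close>, so it is an event of \<open>F m\<close>, whatever \<open>m\<close>
  is.\<close>

lemma conv_in_F: "conv \<in> sets (F m)"
proof -
  have "conv = {\<omega> \<in> space M. \<forall>k. \<exists>N. \<forall>n n'. d_haus (R (m + N + n) \<omega>) (R (m + N + n') \<omega>) < inverse (real (Suc k))}"
  proof -
    have "IS.MCauchy (\<lambda>n. R n \<omega>) \<longleftrightarrow> (\<forall>k. \<exists>N. \<forall>n n'. d_haus (R (m + N + n) \<omega>) (R (m + N + n') \<omega>) < inverse (real (Suc k)))" for \<omega>
    proof
      assume "IS.MCauchy (\<lambda>n. R n \<omega>)"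
      then have C: "\<exists>N. \<forall>n n'. N \<le> n \<longrightarrow> N \<le> n' \<longrightarrow> d_haus (R n \<omega>) (R n' \<omega>) < e" if "0 < e" for e
        using that unfolding IS.MCauchy_def by blast
      show "\<forall>k. \<exists>N. \<forall>n n'. d_haus (R (m + N + n) \<omega>) (R (m + N + n') \<omega>) < inverse (real (Suc k))"
      proof
        fix k
        obtain N where "\<forall>n n'. N \<le> n \<longrightarrow> N \<le> n' \<longrightarrow> d_haus (R n \<omega>) (R n' \<omega>) < inverse (real (Suc k))"
          using C[of "inverse (real (Suc k))"] by auto
        then have "\<forall>n n'. d_haus (R (m + N + n) \<omega>) (R (m + N + n') \<omega>) < inverse (real (Suc k))" by simp
        then show "\<exists>N. \<forall>n n'. d_haus (R (m + N + n) \<omega>) (R (m + N + n') \<omega>) < inverse (real (Suc k))" by blast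
      qed
    next
      assume H: "\<forall>k. \<exists>N. \<forall>n n'. d_haus (R (m + N + n) \<omega>) (R (m + N + n') \<omega>) < inverse (real (Suc k))"
      show "IS.MCauchy (\<lambda>n. R n \<omega>)"
        unfolding IS.MCauchy_def
      proof (intro conjI allI impI)
        show "range (\<lambda>n. R n \<omega>) \<subseteq> InSy_inf" using R_mem by blast
        fix e :: real assume "0 < e"
        then obtain k where k: "inverse (real (Suc k)) < e" using reals_Archimedean by blast
        obtain N where N: "\<forall>n n'. d_haus (R (m + N + n) \<omega>) (R (m + N + n') \<omega>) < inverse (real (Suc k))" using H by blast
        have "d_haus (R n \<omega>) (R n' \<omega>) < e" if n: "m + N \<le> n" "m + N \<le> n'" for n n'
        proof -
          have "m + N + (n - (m + N)) = n" "m + N + (n' - (m + N)) = n'" using n by auto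
          then show ?thesis using N k by (metis order_less_trans)
        qed
        then show "\<exists>N. \<forall>n n'. N \<le> n \<longrightarrow> N \<le> n' \<longrightarrow> d_haus (R n \<omega>) (R n' \<omega>) < e" by blast
      qed
    qed
    then show ?thesis unfolding conv_def by simp
  qed
  also have "\<dots> \<in> sets (F m)"
    by (subst (1) space_future_field[of M I \<eta> m, symmetric],
        intro sets.sets_Collect_countable_All sets.sets_Collect_countable_Ex,
        subst space_future_field, rule R_pair_in_F) auto
  finally show ?thesis .
qed

text \<open>The limit lies in the open set \<open>W\<close> exactly when balls of one common radius
  around all late \<open>R n\<close> stay inside \<open>W\<close>; the sets \<open>B j\<close>
  record the radius. Since the indices may start beyond any \<open>m\<close>, this is a terminal
  event.\<close>

lemma measurable_I_inf: "I_inf \<in> T \<rightarrow>\<^sub>M BIS"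
proof (rule measurable_sigma_sets[OF sets_borel_of])
  show "{U. openin InSy_inf_topology U} \<subseteq> Pow (topspace InSy_inf_topology)" using openin_subset by blast
  show "I_inf \<in> space T \<rightarrow> topspace InSy_inf_topology" using I_inf_mem by simp
  fix W assume "W \<in> {U. openin InSy_inf_topology U}"
  then have W: "openin InSy_inf_topology W" by simp
  define B where "B j = {K \<in> InSy_inf. IS.mball K (inverse (real (Suc j))) \<subseteq> W}" for j
  have *: "I_inf \<omega> \<in> W \<longleftrightarrow> (\<exists>j N. \<forall>n. R (m + N + n) \<omega> \<in> B j)" if "\<omega> \<in> conv" for \<omega> m
  proof -
    have lim: "limitin InSy_inf_topology (\<lambda>n. R n \<omega>) (I_inf \<omega>) sequentially" using that I_inf_limit by (simp add: conv_def)
    show ?thesis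
    proof
      assume "I_inf \<omega> \<in> W"
      then obtain r where r: "0 < r" "IS.mball (I_inf \<omega>) r \<subseteq> W" using W unfolding IS.openin_mtopology by blast
      \<comment> \<open>Half of \<open>r\<close> is reserved for the distance between
        \<open>R n\<close> and the limit.\<close>
      obtain j where j: "inverse (real (Suc j)) < r / 2" using reals_Archimedean[of "r/2"] r(1) by auto
      obtain N where N: "\<forall>n\<ge>N. R n \<omega> \<in> InSy_inf \<and> d_haus (R n \<omega>) (I_inf \<omega>) < r / 2"
        using lim half_gt_zero[OF r(1)] unfolding limitin_IS_iff by blast
      have "R n \<omega> \<in> B j" if n: "N \<le> n" for n
      proof -
        have "IS.mball (R n \<omega>) (inverse (real (Suc j))) \<subseteq> IS.mball (I_inf \<omega>) r"
        proof
          fix L assume "L \<in> IS.mball (R n \<omega>) (inverse (real (Suc j)))"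
          then have L: "L \<in> InSy_inf" "d_haus (R n \<omega>) L < r / 2" using j by auto
          have "d_haus (I_inf \<omega>) L \<le> d_haus (I_inf \<omega>) (R n \<omega>) + d_haus (R n \<omega>) L"
            by (rule IS.triangle[OF I_inf_mem R_mem L(1)])
          also have "\<dots> < r" using N n L(2) d_haus_sym[of "I_inf \<omega>"] by fastforce
          finally show "L \<in> IS.mball (I_inf \<omega>) r" using L I_inf_mem by simp
        qed
        then show ?thesis using r(2) R_mem unfolding B_def by blast
      qed
      then have "\<forall>n. R (m + N + n) \<omega> \<in> B j" by simp
      then show "\<exists>j N. \<forall>n. R (m + N + n) \<omega> \<in> B j" by blast
    next
      assume "\<exists>j N. \<forall>n. R (m + N + n) \<omega> \<in> B j"
      then obtain j N where jN: "\<And>n. R (m + N + n) \<omega> \<in> B j" by blast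
      have "0 < inverse (real (Suc j))" by simp
      then obtain N' where N': "\<forall>n\<ge>N'. R n \<omega> \<in> InSy_inf \<and> d_haus (R n \<omega>) (I_inf \<omega>) < inverse (real (Suc j))"
        using lim unfolding limitin_IS_iff by blast
      have "I_inf \<omega> \<in> IS.mball (R (m + N + N') \<omega>) (inverse (real (Suc j)))" using N' I_inf_mem R_mem by simp
      then show "I_inf \<omega> \<in> W" using jN[of N'] unfolding B_def by blast
    qed
  qed
  have "I_inf -` W \<inter> space T \<in> sets (F m)" for m
  proof -
    let ?A = "{\<omega> \<in> space M. \<exists>j N. \<forall>n. R (m + N + n) \<omega> \<in> B j}"
    have A: "?A \<in> sets (F m)"
      by (subst (1) space_future_field[of M I \<eta> m, symmetric],
        intro sets.sets_Collect_countable_All sets.sets_Collect_countable_Ex,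
        subst space_future_field, rule R_in_F) auto
    have "I_inf -` W \<inter> space T = (conv \<inter> ?A) \<union> (if diag \<in> W then space M - conv else {})"
    proof (rule set_eqI)
      fix \<omega>
      show "\<omega> \<in> I_inf -` W \<inter> space T \<longleftrightarrow> \<omega> \<in> (conv \<inter> ?A) \<union> (if diag \<in> W then space M - conv else {})"
      proof (cases "\<omega> \<in> conv")
        case True
        then have "\<omega> \<in> space M" by (simp add: conv_def)
        then show ?thesis using True *[OF True, of m] by (simp add: space_T)
      next
        case False
        then have "\<omega> \<in> space M \<Longrightarrow> I_inf \<omega> = diag" by (simp add: conv_def I_inf_def)
        then show ?thesis using False by (auto simp: space_T)
      qed
    qed
    moreover have "space M - conv \<in> sets (F m)"
      using sets.compl_sets[OF conv_in_F[of m]] by (simp add: space_future_field)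
    ultimately show ?thesis using A conv_in_F[of m] by auto
  qed
  then show "I_inf -` W \<inter> space T \<in> sets T" unfolding sets_T by blast
qed

lemma id_T: "(\<lambda>\<omega>. \<omega>) \<in> M \<rightarrow>\<^sub>M T"
proof (rule measurableI)
  fix A assume "A \<in> sets T"
  then show "(\<lambda>\<omega>. \<omega>) -` A \<inter> space M \<in> sets M" using T_sub by (auto simp: vimage_def)
qed (simp add: space_T)

lemma measurable_I_inf_M: "I_inf \<in> M \<rightarrow>\<^sub>M BIS"
  using measurable_compose[OF id_T measurable_I_inf] .

section \<open>Independence of the limit and the points\<close>

lemma measurable_TU: "(\<lambda>\<omega>. (\<omega>, U \<omega>)) \<in> M \<rightarrow>\<^sub>M T \<Otimes>\<^sub>M U_measure"
  by (rule measurable_Pair[OF id_T measurable_U])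

text \<open>The first component is the sample point seen through the terminal field instead of the
  limit, so that Fubini applies to every terminal event and every terminal parameter.\<close>

lemma joint_law: "distr M (T \<Otimes>\<^sub>M U_measure) (\<lambda>\<omega>. (\<omega>, U \<omega>)) = distr M T (\<lambda>\<omega>. \<omega>) \<Otimes>\<^sub>M U_measure"
proof (rule pair_measure_eqI[symmetric])
  interpret D: prob_space "distr M T (\<lambda>\<omega>. \<omega>)" by (rule prob_space_distr[OF id_T])
  show "sigma_finite_measure (distr M T (\<lambda>\<omega>. \<omega>))" "sigma_finite_measure U_measure" by unfold_locales
  show "sets (distr M T (\<lambda>\<omega>. \<omega>) \<Otimes>\<^sub>M U_measure) = sets (distr M (T \<Otimes>\<^sub>M U_measure) (\<lambda>\<omega>. (\<omega>, U \<omega>)))"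
    unfolding sets_distr by (rule sets_pair_measure_cong) auto
  fix A B assume "A \<in> sets (distr M T (\<lambda>\<omega>. \<omega>))" and B: "B \<in> sets U_measure"
  then have A: "A \<in> sets T" by simp
  have AM: "A \<inter> space M = A" using sets.sets_into_space[OF A] by (auto simp: space_T)
  have mB: "U -` B \<inter> space M \<in> sets M" by (rule measurable_sets[OF measurable_U B])
  have "emeasure U_measure B = emeasure M (U -` B \<inter> space M)"
    using emeasure_distr[OF measurable_U B] unfolding distr_U .
  moreover have "emeasure (distr M T (\<lambda>\<omega>. \<omega>)) A = emeasure M A"
    using emeasure_distr[OF id_T A] AM by (simp add: vimage_def)
  moreover have "emeasure (distr M (T \<Otimes>\<^sub>M U_measure) (\<lambda>\<omega>. (\<omega>, U \<omega>))) (A \<times> B) = emeasure M (A \<inter> (U -` B \<inter> space M))"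
    using emeasure_distr[OF measurable_TU pair_measureI[OF A B]] by (simp add: vimage_def Int_def conj_ac)
  moreover have "prob (A \<inter> (U -` B \<inter> space M)) = prob A * prob (U -` B \<inter> space M)"
    using B by (intro indep_setD[OF indep_T_U A]) blast
  ultimately show "emeasure (distr M T (\<lambda>\<omega>. \<omega>)) A * emeasure U_measure B =
      emeasure (distr M (T \<Otimes>\<^sub>M U_measure) (\<lambda>\<omega>. (\<omega>, U \<omega>))) (A \<times> B)"
    by (simp add: emeasure_eq_measure ennreal_mult')
qed

text \<open>Since the joint law is a product, a terminal parameter may be frozen while the points
  vary. Goodness for fixed compact sets reaches the random limit in this way.\<close>

lemma AE_joint:
  assumes P: "{x \<in> space (T \<Otimes>\<^sub>M U_measure). P (fst x) (snd x)} \<in> sets (T \<Otimes>\<^sub>M U_measure)"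
    and ae: "\<And>\<omega>. \<omega> \<in> space M \<Longrightarrow> AE u in U_measure. P \<omega> u"
  shows "AE \<omega> in M. P \<omega> (U \<omega>)"
proof -
  interpret D: prob_space "distr M T (\<lambda>\<omega>. \<omega>)" by (rule prob_space_distr[OF id_T])
  interpret pair_sigma_finite "distr M T (\<lambda>\<omega>. \<omega>)" U_measure ..
  have sets_eq: "sets (distr M T (\<lambda>\<omega>. \<omega>) \<Otimes>\<^sub>M U_measure) = sets (T \<Otimes>\<^sub>M U_measure)"
    by (rule sets_pair_measure_cong) auto
  have "AE x in distr M T (\<lambda>\<omega>. \<omega>) \<Otimes>\<^sub>M U_measure. P (fst x) (snd x)"
  proof (rule AE_pair_measure)
    show "{x \<in> space (distr M T (\<lambda>\<omega>. \<omega>) \<Otimes>\<^sub>M U_measure). P (fst x) (snd x)} \<in> sets (distr M T (\<lambda>\<omega>. \<omega>) \<Otimes>\<^sub>M U_measure)"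
      using P unfolding sets_eq sets_eq_imp_space_eq[OF sets_eq] .
    show "AE x in distr M T (\<lambda>\<omega>. \<omega>). AE y in U_measure. P (fst (x, y)) (snd (x, y))"
      by (rule AE_I2) (simp add: ae space_T)
  qed
  then have "AE x in distr M (T \<Otimes>\<^sub>M U_measure) (\<lambda>\<omega>. (\<omega>, U \<omega>)). P (fst x) (snd x)" unfolding joint_law .
  from AE_distrD[OF measurable_TU this] show ?thesis by simp
qed

lemma comp_fst_I_inf: "(\<lambda>x. I_inf (fst x)) \<in> T \<Otimes>\<^sub>M U_measure \<rightarrow>\<^sub>M BIS"
  by (rule measurable_compose[OF measurable_fst measurable_I_inf])

lemma comp_snd_U: "1 \<le> i \<Longrightarrow> (\<lambda>x. snd x i) \<in> borel_measurable (T \<Otimes>\<^sub>M U_measure)"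
  by (rule measurable_compose[OF measurable_snd measurable_U_coord])

lemma AE_good_I_inf: "AE \<omega> in M. good (I_inf \<omega>) (U \<omega>)"
proof (rule AE_joint)
  show "{x \<in> space (T \<Otimes>\<^sub>M U_measure). good (I_inf (fst x)) (snd x)} \<in> sets (T \<Otimes>\<^sub>M U_measure)"
    using pred_good[OF comp_fst_I_inf, of snd, OF comp_snd_U] by (simp add: pred_def)
  show "AE u in U_measure. good (I_inf \<omega>) u" for \<omega> by (rule AE_good[OF I_inf_mem])
qed

lemma AE_chain: "AE \<omega> in M. nice (U \<omega>) \<and> eraser_chain (U \<omega>) (\<lambda>n. I n \<omega>) \<and> (\<forall>n\<ge>1. \<eta> n \<omega> = eraser_of_U (U \<omega>) n)"
proof -
  have "AE \<omega> in M. 1 \<le> n \<longrightarrow> I n \<omega> \<in> InSy n \<and> I n \<omega> = phi (I (n + 1) \<omega>) (\<eta> n \<omega>)" for n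
    using eipD(3)[of n] eipD(6)[of n] by (cases "1 \<le> n") auto
  then have "AE \<omega> in M. \<forall>n. 1 \<le> n \<longrightarrow> I n \<omega> \<in> InSy n \<and> I n \<omega> = phi (I (n + 1) \<omega>) (\<eta> n \<omega>)"
    unfolding AE_all_countable by blast
  with AE_recover show ?thesis
  proof eventually_elim
    case (elim \<omega>)
    have eq: "\<eta> n \<omega> = eraser_of_U (U \<omega>) n" if "1 \<le> n" for n
      using elim(1) that unfolding recover_def U_def by (simp add: E_def)
    have "eraser_chain (U \<omega>) (\<lambda>n. I n \<omega>)"
      unfolding eraser_chain_def
    proof (intro allI impI)
      fix n :: nat assume n: "1 \<le> n"
      have a: "I n \<omega> \<in> InSy n" "I n \<omega> = phi (I (n + 1) \<omega>) (\<eta> n \<omega>)" using elim(2) n by blast+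
      have "I n \<omega> = phi (I (Suc n) \<omega>) (eraser_of_U (U \<omega>) n)" using a(2) unfolding eq[OF n] Suc_eq_plus1 .
      with a(1) show "I n \<omega> \<in> InSy n \<and> I n \<omega> = phi (I (Suc n) \<omega>) (eraser_of_U (U \<omega>) n)" by blast
    qed
    then show ?case using elim(1) eq unfolding recover_def U_def by blast
  qed
qed

lemma AE_limit: "AE \<omega> in M. limitin InSy_inf_topology (\<lambda>n. rescale n (I n \<omega>)) (I_inf \<omega>) sequentially"
  using AE_chain
proof eventually_elim
  case (elim \<omega>)
  obtain K where "limitin InSy_inf_topology (\<lambda>n. rescale n (I n \<omega>)) K sequentially"
    using rescale_chain_converges[of "U \<omega>" "\<lambda>n. I n \<omega>"] elim by blast
  then show ?case by (rule I_inf_eqI(2)) (rule eraser_chainD(1)[of "U \<omega>" "\<lambda>n. I n \<omega>"], use elim in auto)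
qed

lemma AE_path: "AE \<omega> in M. process_path I \<eta> \<omega> = Phi (I_inf \<omega>) (U \<omega>)"
  using AE_chain AE_limit AE_good_I_inf
proof eventually_elim
  case (elim \<omega>)
  have "I n \<omega> = phi_inf n (I_inf \<omega>) (order_stat (U \<omega>) n)" if "1 \<le> n" for n
    using chain_eq_phi_inf[of "U \<omega>" "\<lambda>n. I n \<omega>" "I_inf \<omega>" n] elim that by blast
  then show ?case unfolding process_path_def Phi_def using elim(1) by (intro restrict_ext) auto
qed

section \<open>The conditional law given the terminal field\<close>

text \<open>The event on which the path is a genuine element of the path space; complements of path
  events are taken relative to it.\<close>

definition \<Omega>0 :: "'a set" where "\<Omega>0 = {\<omega> \<in> space M. process_path I \<eta> \<omega> \<in> paths}"

lemma \<Omega>0_in_F: "\<Omega>0 \<in> sets (F 1)"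
proof -
  have "\<Omega>0 = {\<omega> \<in> space (F 1). \<forall>n. 1 \<le> n \<longrightarrow> (I n \<omega>, \<eta> n \<omega>) \<in> InSy n \<times> {1..n + 1}}"
    by (auto simp: \<Omega>0_def process_path_def paths_def PiE_iff space_future_field)
  also have "\<dots> \<in> sets (F 1)"
  proof (rule sets.sets_Collect_countable_All)
    fix n :: nat
    show "{\<omega> \<in> space (F 1). 1 \<le> n \<longrightarrow> (I n \<omega>, \<eta> n \<omega>) \<in> InSy n \<times> {1..n + 1}} \<in> sets (F 1)"
      using future_field_genI[of 1 n M I \<eta> "InSy n \<times> {1..n + 1}"] unfolding space_future_field
      by (cases "1 \<le> n") (auto simp: space_future_field[of M I \<eta> 1, symmetric])
  qed
  finally show ?thesis .
qed

lemma path_vimage: "A \<in> sets path_space \<Longrightarrow> process_path I \<eta> -` A \<inter> space M \<in> sets (F 1)"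
  unfolding sets_path_space
proof (induction rule: sigma_sets.induct)
  case (Basic C)
  then consider "C = {}" | n g where "C = cyl n g" unfolding cyls_def by blast
  then show ?case
  proof cases
    case 2
    have "process_path I \<eta> -` C \<inter> space M = \<Omega>0 \<inter> {\<omega> \<in> space (F 1). \<forall>i\<in>{1..n}. (I i \<omega>, \<eta> i \<omega>) \<in> {g i}}"
      by (auto simp: 2 cyl_def \<Omega>0_def process_path_def space_future_field)
    also have "\<dots> \<in> sets (F 1)"
    proof (intro sets.Int \<Omega>0_in_F sets.sets_Collect_finite_All)
      fix i assume "i \<in> {1..n}"
      then show "{\<omega> \<in> space (F 1). (I i \<omega>, \<eta> i \<omega>) \<in> {g i}} \<in> sets (F 1)"
        using future_field_genI[of 1 i M I \<eta> "{g i}"] by (simp add: space_future_field)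
    qed simp
    finally show ?thesis .
  qed simp
next
  case (Compl C)
  have "process_path I \<eta> -` (paths - C) \<inter> space M = \<Omega>0 - process_path I \<eta> -` C \<inter> space M" by (auto simp: \<Omega>0_def)
  then show ?case using Compl \<Omega>0_in_F by auto
next
  case (Union C)
  have eq: "process_path I \<eta> -` (\<Union>i. C i) \<inter> space M = (\<Union>i. process_path I \<eta> -` C i \<inter> space M)" by auto
  show ?case unfolding eq by (rule sets.countable_UN) (use Union.IH in blast)
qed simp

text \<open>On \<open>\<Omega>0\<close>, which has full probability, every event of
  \<open>F 1\<close> is an event about the path. This is what lets the conditional law of the path
  evaluate terminal events.\<close>

lemma F_path:
  assumes "A \<in> sets (F 1)"
  shows "\<exists>A'\<in>sets path_space. A \<inter> \<Omega>0 = process_path I \<eta> -` A' \<inter> space M"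
  using assms unfolding sets_future_field
proof (induction rule: sigma_sets.induct)
  case (Basic C)
  then obtain m B where C: "C = {\<omega> \<in> space M. (I m \<omega>, \<eta> m \<omega>) \<in> B}" "1 \<le> m" by blast
  have "{f \<in> paths. f m \<in> B} \<in> sets path_space" by (rule openin_sets_borel_of[OF openin_path_coord[OF C(2)]])
  moreover have "C \<inter> \<Omega>0 = process_path I \<eta> -` {f \<in> paths. f m \<in> B} \<inter> space M"
    using C(2) by (auto simp: C(1) \<Omega>0_def process_path_def)
  ultimately show ?case by blast
next
  case Empty
  then show ?case by (intro bexI[of _ "{}"]) auto
next
  case (Compl C)
  then obtain A' where A': "A' \<in> sets path_space" "C \<inter> \<Omega>0 = process_path I \<eta> -` A' \<inter> space M" by blast
  have "paths - A' \<in> sets path_space" using sets.compl_sets[OF A'(1)] by (simp add: space_path_space)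
  moreover have "(space M - C) \<inter> \<Omega>0 = process_path I \<eta> -` (paths - A') \<inter> space M" using A'(2) unfolding \<Omega>0_def by blast
  ultimately show ?case by blast
next
  case (Union C)
  then obtain A' where A': "\<And>i. A' i \<in> sets path_space" "\<And>i. C i \<inter> \<Omega>0 = process_path I \<eta> -` A' i \<inter> space M" by metis
  have "(\<Union>i. C i) \<inter> \<Omega>0 = process_path I \<eta> -` (\<Union>i. A' i) \<inter> space M" using A'(2) by blast
  moreover have "(\<Union>i. A' i) \<in> sets path_space" using A'(1) by auto
  ultimately show ?case by blast
qed

lemma AE_\<Omega>0: "AE \<omega> in M. \<omega> \<in> \<Omega>0"
  using AE_path AE_space by eventually_elim (simp add: \<Omega>0_def Phi_in_paths)

definition \<kappa>0 :: "'a \<Rightarrow> path measure" where "\<kappa>0 \<omega> = Law (I_inf \<omega>)"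

lemma measurable_Phi_joint: "(\<lambda>x. Phi (I_inf (fst x)) (snd x)) \<in> T \<Otimes>\<^sub>M U_measure \<rightarrow>\<^sub>M path_space"
  by (rule measurable_Phi[OF comp_fst_I_inf comp_snd_U])

text \<open>\<open>\<kappa>0\<close> is the image of the constant kernel \<open>U_measure\<close>
  under a jointly measurable map.\<close>

lemma measurable_\<kappa>0: "\<kappa>0 \<in> T \<rightarrow>\<^sub>M prob_algebra path_space"
proof -
  have "(\<lambda>\<omega>. U_measure) \<in> T \<rightarrow>\<^sub>M prob_algebra U_measure"
    by (rule measurable_const) (simp add: space_prob_algebra prob_space_U_measure)
  from measurable_distr_prob_space2[OF this, of "\<lambda>\<omega> u. Phi (I_inf \<omega>) u" path_space]
  show ?thesis using measurable_Phi_joint unfolding \<kappa>0_def[abs_def] Law_eq_distr case_prod_beta by simp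
qed

lemma measurable_\<kappa>0_emeasure: "A \<in> sets path_space \<Longrightarrow> (\<lambda>\<omega>. emeasure (\<kappa>0 \<omega>) A) \<in> borel_measurable T"
  using measurable_compose[OF measurable_prob_algebraD[OF measurable_\<kappa>0] measurable_emeasure_subprob_algebra] .

lemma prob_space_\<kappa>0: "prob_space (\<kappa>0 \<omega>)"
  unfolding \<kappa>0_def by (rule prob_space_Law[OF I_inf_mem])

lemma measurable_\<kappa>0_measure: "A \<in> sets path_space \<Longrightarrow> (\<lambda>\<omega>. measure (\<kappa>0 \<omega>) A) \<in> borel_measurable T"
  unfolding measure_def by (intro borel_measurable_enn2real measurable_\<kappa>0_emeasure)

text \<open>Almost surely the path is a function of the limit and the points, and the points are
  independent of the terminal field. Integrating over the points with the limit frozen leaves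
  \<open>Law\<close> of the limit.\<close>

lemma emeasure_joint:
  assumes B: "B \<in> sets T" and A: "A \<in> sets path_space"
  shows "emeasure M (B \<inter> (process_path I \<eta> -` A \<inter> space M)) = (\<integral>\<^sup>+\<omega>. indicator B \<omega> * emeasure (\<kappa>0 \<omega>) A \<partial>M)"
proof -
  interpret D: prob_space "distr M T (\<lambda>\<omega>. \<omega>)" by (rule prob_space_distr[OF id_T])
  let ?S = "{x \<in> space (T \<Otimes>\<^sub>M U_measure). fst x \<in> B \<and> Phi (I_inf (fst x)) (snd x) \<in> A}"
  have BM: "B \<subseteq> space M" using sets.sets_into_space[OF B] by (simp add: space_T)
  have sets_eq: "sets (distr M T (\<lambda>\<omega>. \<omega>) \<Otimes>\<^sub>M U_measure) = sets (T \<Otimes>\<^sub>M U_measure)"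
    by (rule sets_pair_measure_cong) auto
  have S: "?S \<in> sets (T \<Otimes>\<^sub>M U_measure)"
  proof -
    have "?S = (fst -` B \<inter> space (T \<Otimes>\<^sub>M U_measure)) \<inter> ((\<lambda>x. Phi (I_inf (fst x)) (snd x)) -` A \<inter> space (T \<Otimes>\<^sub>M U_measure))" by auto
    then show ?thesis using measurable_sets[OF measurable_fst B] measurable_sets[OF measurable_Phi_joint A] by auto
  qed
  have vS: "(\<lambda>\<omega>. (\<omega>, U \<omega>)) -` ?S \<inter> space M \<in> sets M" by (rule measurable_sets[OF measurable_TU S])
  have "emeasure M (B \<inter> (process_path I \<eta> -` A \<inter> space M)) = emeasure M ((\<lambda>\<omega>. (\<omega>, U \<omega>)) -` ?S \<inter> space M)"
  proof (rule emeasure_eq_AE)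
    show "AE \<omega> in M. \<omega> \<in> B \<inter> (process_path I \<eta> -` A \<inter> space M) \<longleftrightarrow> \<omega> \<in> (\<lambda>\<omega>. (\<omega>, U \<omega>)) -` ?S \<inter> space M"
      using AE_path AE_space
    proof eventually_elim
      case (elim \<omega>)
      then show ?case using measurable_space[OF measurable_TU, of \<omega>] by auto
    qed
    show "B \<inter> (process_path I \<eta> -` A \<inter> space M) \<in> sets M"
      using B T_sub path_vimage[OF A] F_sub[of 1] by auto
  qed (rule vS)
  also have "\<dots> = emeasure (distr M (T \<Otimes>\<^sub>M U_measure) (\<lambda>\<omega>. (\<omega>, U \<omega>))) ?S"
    by (rule emeasure_distr[symmetric, OF measurable_TU S])
  also have "\<dots> = emeasure (distr M T (\<lambda>\<omega>. \<omega>) \<Otimes>\<^sub>M U_measure) ?S" unfolding joint_law ..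
  also have "\<dots> = (\<integral>\<^sup>+\<omega>. emeasure U_measure (Pair \<omega> -` ?S) \<partial>distr M T (\<lambda>\<omega>. \<omega>))"
    by (rule UM.emeasure_pair_measure_alt) (use S sets_eq in simp)
  also have "\<dots> = (\<integral>\<^sup>+\<omega>. emeasure U_measure (Pair \<omega> -` ?S) \<partial>M)"
    by (rule nn_integral_distr[OF id_T]) (simp only: measurable_distr_eq1 UM.measurable_emeasure_Pair[OF S])
  also have "\<dots> = (\<integral>\<^sup>+\<omega>. indicator B \<omega> * emeasure (\<kappa>0 \<omega>) A \<partial>M)"
  proof (rule nn_integral_cong)
    fix \<omega> assume \<omega>: "\<omega> \<in> space M"
    show "emeasure U_measure (Pair \<omega> -` ?S) = indicator B \<omega> * emeasure (\<kappa>0 \<omega>) A"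
    proof (cases "\<omega> \<in> B")
      case True
      then have "Pair \<omega> -` ?S = Phi (I_inf \<omega>) -` A \<inter> space U_measure"
        using \<omega> by (auto simp: space_pair_measure space_T)
      then show ?thesis using True emeasure_distr[OF measurable_Phi_U[OF I_inf_mem] A] by (simp add: \<kappa>0_def Law_eq_distr)
    qed simp
  qed
  finally show ?thesis .
qed

lemma subalgebra_T: "subalgebra M T"
  by (simp add: subalgebra_def space_T T_sub)

lemma sigma_finite_subalgebra_T: "sigma_finite_subalgebra M T"
proof -
  interpret finite_measure_subalgebra M T by unfold_locales (rule subalgebra_T)
  show ?thesis by (rule sigma_finite_subalgebra_axioms)
qed

lemma cond_exp_path:
  assumes A: "A \<in> sets path_space"
  shows "AE \<omega> in M. real_cond_exp M T (indicator (process_path I \<eta> -` A \<inter> space M)) \<omega> = measure (\<kappa>0 \<omega>) A"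
proof (rule sigma_finite_subalgebra.real_cond_exp_charact[OF sigma_finite_subalgebra_T])
  have ev: "process_path I \<eta> -` A \<inter> space M \<in> sets M" using path_vimage[OF A] F_sub[of 1] by auto
  show "integrable M (indicator (process_path I \<eta> -` A \<inter> space M) :: 'a \<Rightarrow> real)"
    using ev by (intro integrable_real_indicator) (auto simp: less_top[symmetric])
  have mk: "(\<lambda>\<omega>. measure (\<kappa>0 \<omega>) A) \<in> borel_measurable M"
    using measurable_compose[OF id_T measurable_\<kappa>0_measure[OF A]] .
  have le1: "measure (\<kappa>0 \<omega>) A \<le> 1" for \<omega> using prob_space.prob_le_1[OF prob_space_\<kappa>0] .
  show "integrable M (\<lambda>\<omega>. measure (\<kappa>0 \<omega>) A)"
    by (rule integrable_const_bound[of _ 1]) (use le1 mk in auto)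
  show "(\<lambda>\<omega>. measure (\<kappa>0 \<omega>) A) \<in> borel_measurable T" by (rule measurable_\<kappa>0_measure[OF A])
  fix B assume B: "B \<in> sets T"
  have BM: "B \<in> sets M" using B T_sub by blast
  have em: "emeasure (\<kappa>0 \<omega>) A = ennreal (measure (\<kappa>0 \<omega>) A)" for \<omega>
  proof -
    interpret k: prob_space "\<kappa>0 \<omega>" by (rule prob_space_\<kappa>0)
    show ?thesis by (rule k.emeasure_eq_measure)
  qed
  have "(\<integral>\<omega>\<in>B. indicator (process_path I \<eta> -` A \<inter> space M) \<omega> \<partial>M) = measure M (B \<inter> (process_path I \<eta> -` A \<inter> space M))"
    unfolding set_lebesgue_integral_def using ev BM by (simp add: indicator_inter_arith[symmetric])
  also have "\<dots> = enn2real (\<integral>\<^sup>+\<omega>. indicator B \<omega> * emeasure (\<kappa>0 \<omega>) A \<partial>M)"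
    unfolding emeasure_joint[OF B A, symmetric] measure_def ..
  also have "(\<integral>\<^sup>+\<omega>. indicator B \<omega> * emeasure (\<kappa>0 \<omega>) A \<partial>M) = (\<integral>\<^sup>+\<omega>. ennreal (indicator B \<omega> * measure (\<kappa>0 \<omega>) A) \<partial>M)"
    by (rule nn_integral_cong) (simp add: em ennreal_mult' split: split_indicator)
  also have "enn2real \<dots> = (\<integral>\<omega>. indicator B \<omega> * measure (\<kappa>0 \<omega>) A \<partial>M)"
    by (rule integral_eq_nn_integral[symmetric]) (use mk BM in auto)
  also have "\<dots> = (\<integral>\<omega>\<in>B. measure (\<kappa>0 \<omega>) A \<partial>M)" unfolding set_lebesgue_integral_def by simp
  finally show "(\<integral>\<omega>\<in>B. indicator (process_path I \<eta> -` A \<inter> space M) \<omega> \<partial>M) = (\<integral>\<omega>\<in>B. measure (\<kappa>0 \<omega>) A \<partial>M)" .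
qed

lemma conditional_law_\<kappa>0: "conditional_law M T path_space (process_path I \<eta>) \<kappa>0"
  unfolding conditional_law_def using measurable_\<kappa>0 cond_exp_path by blast

text \<open>Two versions agree almost surely on each cylinder, hence simultaneously on all of the
  countably many cylinders, and these determine a probability measure.\<close>

lemma conditional_law_unique:
  assumes "conditional_law M T path_space (process_path I \<eta>) \<kappa>"
  shows "AE \<omega> in M. \<kappa> \<omega> = Law (I_inf \<omega>)"
proof -
  have \<kappa>: "\<kappa> \<in> T \<rightarrow>\<^sub>M prob_algebra path_space"
    and ce: "\<And>A. A \<in> sets path_space \<Longrightarrow> AE \<omega> in M. real_cond_exp M T (indicator (process_path I \<eta> -` A \<inter> space M)) \<omega> = measure (\<kappa> \<omega>) A"
    using assms unfolding conditional_law_def by blast+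
  have cs: "cyls \<subseteq> sets path_space" unfolding sets_path_space by (auto intro: sigma_sets.Basic)
  have "AE \<omega> in M. measure (\<kappa> \<omega>) A = measure (\<kappa>0 \<omega>) A" if "A \<in> cyls" for A
    using ce[OF subsetD[OF cs that]] cond_exp_path[OF subsetD[OF cs that]] by eventually_elim simp
  then have "AE \<omega> in M. \<forall>A\<in>cyls. measure (\<kappa> \<omega>) A = measure (\<kappa>0 \<omega>) A"
    by (subst AE_ball_countable[OF countable_cyls]) blast
  then show ?thesis using AE_space
  proof eventually_elim
    case (elim \<omega>)
    have sp: "sets (\<kappa> \<omega>) = sets path_space" "prob_space (\<kappa> \<omega>)"
      using measurable_space[OF \<kappa>, of \<omega>] elim(2) by (auto simp: space_prob_algebra space_T)
    interpret k: prob_space "\<kappa> \<omega>" by (rule sp(2))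
    interpret k0: prob_space "\<kappa>0 \<omega>" by (rule prob_space_\<kappa>0)
    have "paths \<in> cyls"
    proof -
      have "cyl 0 (\<lambda>_. undefined) = paths" by (auto simp: cyl_def)
      moreover have "cyl 0 (\<lambda>_. undefined) \<in> cyls" unfolding cyls_def by (auto intro!: exI[of _ 0] exI[of _ "\<lambda>_. undefined"])
      ultimately show ?thesis by simp
    qed
    have "\<kappa> \<omega> = \<kappa>0 \<omega>"
    proof (rule measure_eqI_generator_eq[OF Int_stable_cyls cyls_subset, where A="\<lambda>_. paths"])
      show "emeasure (\<kappa> \<omega>) A = emeasure (\<kappa>0 \<omega>) A" if "A \<in> cyls" for A
        using elim(1) that by (simp add: k.emeasure_eq_measure k0.emeasure_eq_measure)
      show "sets (\<kappa> \<omega>) = sigma_sets paths cyls" "sets (\<kappa>0 \<omega>) = sigma_sets paths cyls"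
        using sp(1) by (simp_all add: sets_path_space[symmetric] \<kappa>0_def sets_Law)
      show "range (\<lambda>_. paths) \<subseteq> cyls" using \<open>paths \<in> cyls\<close> by auto
    qed auto
    then show ?case by (simp add: \<kappa>0_def)
  qed
qed

text \<open>A terminal event equals its own conditional probability. As an event about the path, its
  conditional probability is a value of \<open>Law\<close> of the limit.\<close>

lemma terminal_indicator:
  assumes A: "A \<in> sets T"
  obtains A' where "A' \<in> sets path_space" "AE \<omega> in M. indicator A \<omega> = measure (Law (I_inf \<omega>)) A'"
proof -
  obtain A' where A': "A' \<in> sets path_space" "A \<inter> \<Omega>0 = process_path I \<eta> -` A' \<inter> space M"
    using F_path[of A] A T_sub_F[of 1] by auto
  have AM: "A \<in> sets M" using A T_sub by blast
  have ev: "process_path I \<eta> -` A' \<inter> space M \<in> sets M" using path_vimage[OF A'(1)] F_sub[of 1] by auto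
  have "AE \<omega> in M. (indicator A \<omega> :: real) = indicator (process_path I \<eta> -` A' \<inter> space M) \<omega>"
    using AE_\<Omega>0
  proof eventually_elim
    case (elim \<omega>)
    then have "\<omega> \<in> A \<longleftrightarrow> \<omega> \<in> process_path I \<eta> -` A' \<inter> space M" using A'(2) by blast
    then show ?case by (auto simp: indicator_def)
  qed
  then have "AE \<omega> in M. real_cond_exp M T (indicator A) \<omega> = real_cond_exp M T (indicator (process_path I \<eta> -` A' \<inter> space M)) \<omega>"
    using AM ev by (intro sigma_finite_subalgebra.real_cond_exp_cong[OF sigma_finite_subalgebra_T]) auto
  moreover have "AE \<omega> in M. real_cond_exp M T (indicator A) \<omega> = indicator A \<omega>"
    using A AM by (intro sigma_finite_subalgebra.real_cond_exp_F_meas[OF sigma_finite_subalgebra_T]) (auto simp: less_top[symmetric])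
  ultimately have "AE \<omega> in M. (indicator A \<omega> :: real) = measure (Law (I_inf \<omega>)) A'"
    using cond_exp_path[OF A'(1)] by eventually_elim (simp add: \<kappa>0_def)
  with A'(1) show ?thesis by (rule that)
qed

text \<open>By \<open>terminal_indicator\<close> the value of \<open>Law (I_inf \<omega>)\<close> on
  \<open>A'\<close> is almost surely 0 or 1. The event that it is 1 is an event about the limit and
  differs from \<open>A\<close> by a null event.\<close>

lemma terminal_generated:
  "equal_mod_null M (sets (vimage_algebra (space M) I_inf BIS)) (sets T)"
  unfolding equal_mod_null_def
proof (intro conjI ballI)
  have sv: "sets (vimage_algebra (space M) I_inf BIS) = {I_inf -` A \<inter> space M | A. A \<in> sets BIS}"
    by (rule sets_vimage_algebra2) (use I_inf_mem in \<open>auto simp: space_BIS\<close>)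
  fix A assume "A \<in> sets (vimage_algebra (space M) I_inf BIS)"
  then have "A \<in> sets T" using measurable_sets[OF measurable_I_inf] unfolding sv by (auto simp: space_T)
  then show "\<exists>B\<in>sets T. sym_diff A B \<in> null_sets M" by (intro bexI[of _ A]) auto
next
  have sv: "sets (vimage_algebra (space M) I_inf BIS) = {I_inf -` A \<inter> space M | A. A \<in> sets BIS}"
    by (rule sets_vimage_algebra2) (use I_inf_mem in \<open>auto simp: space_BIS\<close>)
  fix A assume A: "A \<in> sets T"
  obtain A' where A': "A' \<in> sets path_space" "AE \<omega> in M. indicator A \<omega> = measure (Law (I_inf \<omega>)) A'"
    by (rule terminal_indicator[OF A])
  have LawM: "Law \<in> BIS \<rightarrow>\<^sub>M prob_algebra path_space"
  proof -
    have "(\<lambda>K. U_measure) \<in> BIS \<rightarrow>\<^sub>M prob_algebra U_measure"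
      by (rule measurable_const) (simp add: space_prob_algebra prob_space_U_measure)
    moreover have "(\<lambda>x. Phi (fst x) (snd x)) \<in> BIS \<Otimes>\<^sub>M U_measure \<rightarrow>\<^sub>M path_space"
      by (rule measurable_Phi[OF measurable_fst measurable_compose[OF measurable_snd measurable_U_coord]])
    ultimately show ?thesis
      using measurable_distr_prob_space2[of "\<lambda>K. U_measure" BIS U_measure Phi path_space]
      unfolding Law_eq_distr[abs_def] case_prod_beta by simp
  qed
  have "(\<lambda>K. emeasure (Law K) A') \<in> borel_measurable BIS"
    using measurable_compose[OF measurable_prob_algebraD[OF LawM] measurable_emeasure_subprob_algebra[OF A'(1)]] .
  then have "(\<lambda>K. measure (Law K) A') \<in> borel_measurable BIS" unfolding measure_def by (rule borel_measurable_enn2real)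
  then have C: "(\<lambda>K. measure (Law K) A') -` {1} \<inter> space BIS \<in> sets BIS" by (rule measurable_sets) simp
  define B where "B = I_inf -` ((\<lambda>K. measure (Law K) A') -` {1} \<inter> space BIS) \<inter> space M"
  have "B \<in> sets (vimage_algebra (space M) I_inf BIS)" unfolding sv B_def using C by blast
  moreover have "sym_diff B A \<in> null_sets M"
  proof (rule AE_iff_null_sets[THEN iffD2])
    have "B \<in> sets M" unfolding B_def by (rule measurable_sets[OF measurable_I_inf_M C])
    then show "sym_diff B A \<in> sets M" using A T_sub by auto
    show "AE \<omega> in M. \<omega> \<notin> sym_diff B A"
      using A'(2) AE_space
    proof eventually_elim
      case (elim \<omega>)
      then show ?case using I_inf_mem[of \<omega>] by (auto simp: B_def space_BIS indicator_def split: if_splits)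
    qed
  qed
  ultimately show "\<exists>B\<in>sets (vimage_algebra (space M) I_inf BIS). sym_diff B A \<in> null_sets M" by blast
qed

end

context eip
begin

lemma representation_theorem:
  "\<exists>I_inf \<in> M \<rightarrow>\<^sub>M borel_of InSy_inf_topology.
        (AE \<omega> in M. limitin InSy_inf_topology (\<lambda>n. rescale n (I n \<omega>)) (I_inf \<omega>) sequentially) \<and>
        (let U = (\<lambda>i \<omega>. U_of_eraser (\<lambda>n. \<eta> n \<omega>) i) in
          indep_set
            (sets (vimage_algebra (space M) I_inf (borel_of InSy_inf_topology)))
            (sets (vimage_algebra (space M) (\<lambda>\<omega>. \<lambda>i\<in>{1..}. U i \<omega>) (\<Pi>\<^sub>M i\<in>{1..}. borel))) \<and>
          (AE \<omega> in M. \<forall>n\<ge>1. (I n \<omega>, \<eta> n \<omega>) =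
            (phi_inf n (I_inf \<omega>) (order_stat (\<lambda>i. U i \<omega>) n), \<eta> n \<omega>))) \<and>
        (\<exists>\<kappa>. conditional_law M (terminal_field M I \<eta>) path_space (process_path I \<eta>) \<kappa>) \<and>
        (\<forall>\<kappa>. conditional_law M (terminal_field M I \<eta>) path_space (process_path I \<eta>) \<kappa> \<longrightarrow>
          (AE \<omega> in M. \<kappa> \<omega> = Law (I_inf \<omega>))) \<and>
        equal_mod_null M (sets (vimage_algebra (space M) I_inf (borel_of InSy_inf_topology)))
          (sets (terminal_field M I \<eta>))"
  unfolding Let_def
proof (intro bexI[of _ I_inf] conjI)
  show "I_inf \<in> M \<rightarrow>\<^sub>M BIS" by (rule measurable_I_inf_M)
  show "AE \<omega> in M. limitin InSy_inf_topology (\<lambda>n. rescale n (I n \<omega>)) (I_inf \<omega>) sequentially" by (rule AE_limit)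
  have Ueq: "(\<lambda>\<omega>. \<lambda>i\<in>{1..}. U_of_eraser (\<lambda>n. \<eta> n \<omega>) i) = U" by (rule ext) (simp only: U_eq)
  have v1: "sets (vimage_algebra (space M) I_inf BIS) \<subseteq> sets T"
  proof -
    have "sets (vimage_algebra (space M) I_inf BIS) = {I_inf -` A \<inter> space M | A. A \<in> sets BIS}"
      by (rule sets_vimage_algebra2) (use I_inf_mem in \<open>auto simp: space_BIS\<close>)
    then show ?thesis using measurable_sets[OF measurable_I_inf] by (auto simp: space_T)
  qed
  have v2: "sets (vimage_algebra (space M) U (\<Pi>\<^sub>M i\<in>{1..}. borel)) = {U -` A \<inter> space M | A. A \<in> sets U_measure}"
    unfolding sets_U_measure
    by (rule sets_vimage_algebra2) (auto simp: space_PiM PiE_UNIV_domain U_eq)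
  show "indep_set (sets (vimage_algebra (space M) I_inf BIS))
      (sets (vimage_algebra (space M) (\<lambda>\<omega>. \<lambda>i\<in>{1..}. U_of_eraser (\<lambda>n. \<eta> n \<omega>) i) (\<Pi>\<^sub>M i\<in>{1..}. borel)))"
    unfolding Ueq v2
  proof (rule indep_setI)
    show "sets (vimage_algebra (space M) I_inf BIS) \<subseteq> events" using v1 T_sub by blast
    show "{U -` A \<inter> space M | A. A \<in> sets U_measure} \<subseteq> events" by (rule indep_setD_ev2[OF indep_T_U])
    fix a b assume "a \<in> sets (vimage_algebra (space M) I_inf BIS)" and b: "b \<in> {U -` A \<inter> space M | A. A \<in> sets U_measure}"
    then have "a \<in> sets T" using v1 by blast
    then show "prob (a \<inter> b) = prob a * prob b" using b by (rule indep_setD[OF indep_T_U])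
  qed
  show "AE \<omega> in M. \<forall>n\<ge>1. (I n \<omega>, \<eta> n \<omega>) =
            (phi_inf n (I_inf \<omega>) (order_stat (\<lambda>i. U_of_eraser (\<lambda>n. \<eta> n \<omega>) i) n), \<eta> n \<omega>)"
    using AE_path
  proof eventually_elim
    case (elim \<omega>)
    show ?case
    proof (intro allI impI)
      fix n :: nat assume n: "1 \<le> n"
      have "fst (process_path I \<eta> \<omega> n) = fst (Phi (I_inf \<omega>) (U \<omega>) n)" using elim by simp
      then have "I n \<omega> = phi_inf n (I_inf \<omega>) (order_stat (U \<omega>) n)" using n by (simp add: process_path_def Phi_def)
      moreover have "order_stat (U \<omega>) n = order_stat (\<lambda>i. U_of_eraser (\<lambda>n. \<eta> n \<omega>) i) n"
        by (rule order_stat_cong) (simp add: U_eq)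
      ultimately show "(I n \<omega>, \<eta> n \<omega>) =
            (phi_inf n (I_inf \<omega>) (order_stat (\<lambda>i. U_of_eraser (\<lambda>n. \<eta> n \<omega>) i) n), \<eta> n \<omega>)" by simp
    qed
  qed
  show "\<exists>\<kappa>. conditional_law M T path_space (process_path I \<eta>) \<kappa>" using conditional_law_\<kappa>0 by blast
  show "\<forall>\<kappa>. conditional_law M T path_space (process_path I \<eta>) \<kappa> \<longrightarrow> (AE \<omega> in M. \<kappa> \<omega> = Law (I_inf \<omega>))"
    using conditional_law_unique by blast
  show "equal_mod_null M (sets (vimage_algebra (space M) I_inf BIS)) (sets T)" by (rule terminal_generated)
qed

end

section \<open>Ergodic laws and the homeomorphism\<close>

section \<open>The laws of the compact sets are ergodic\<close>

abbreviation CI :: "nat \<Rightarrow> path \<Rightarrow> nat set set" where "CI \<equiv> (\<lambda>n f. fst (f n))"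
abbreviation CE :: "nat \<Rightarrow> path \<Rightarrow> nat" where "CE \<equiv> (\<lambda>n f. snd (f n))"

lemma path_coord_set: "1 \<le> n \<Longrightarrow> {f \<in> paths. f n \<in> A} \<in> sets path_space"
  by (rule openin_sets_borel_of[OF openin_path_coord])

lemma path_step_set:
  assumes n: "1 \<le> n"
  shows "{f \<in> paths. P (f n) (f (Suc n))} \<in> sets path_space"
proof -
  have "{f \<in> paths. P (f n) (f (Suc n))} =
      (\<Union>a\<in>InSy n \<times> {1..n + 1}. {f \<in> paths. f n \<in> {a}} \<inter> {f \<in> paths. f (Suc n) \<in> {b. P a b}})"
    (is "?L = (\<Union>a\<in>?X. ?B a)")
  proof (intro equalityI subsetI)
    fix f assume f: "f \<in> ?L"
    then have "f n \<in> ?X" using n unfolding paths_def by (auto dest: PiE_mem)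
    moreover have "f \<in> ?B (f n)" using f by simp
    ultimately show "f \<in> (\<Union>a\<in>?X. ?B a)" by (rule UN_I)
  qed auto
  also have "\<dots> \<in> sets path_space"
    by (intro sets.finite_UN sets.Int path_coord_set) (use n in \<open>auto simp: finite_InSy\<close>)
  finally show ?thesis .
qed

lemma Phi_nth: "1 \<le> n \<Longrightarrow> Phi K u n = (phi_inf n K (order_stat u n), eraser_of_U u n)"
  by (simp add: Phi_def)

lemma AE_LawI:
  assumes K: "K \<in> InSy_inf" and P: "{f \<in> paths. P f} \<in> sets path_space" and ae: "AE u in U_measure. P (Phi K u)"
  shows "AE f in Law K. P f"
  unfolding Law_eq_distr using AE_distr_iff[OF measurable_Phi_U[OF K], of P] P ae by (simp add: space_path_space)

lemma measure_Law:
  assumes K: "K \<in> InSy_inf" and A: "A \<in> sets path_space"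
  shows "measure (Law K) A = UM.prob (Phi K -` A \<inter> space U_measure)"
  unfolding Law_eq_distr by (rule measure_distr[OF measurable_Phi_U[OF K] A])

text \<open>Membership in \<open>erg_ErInPr\<close> asks for a sample space of paths, so the
  properties of the sampled process are carried along \<open>Phi K\<close> to the coordinate process
  under \<open>Law K\<close>.\<close>

lemma eip_Law:
  assumes K: "K \<in> InSy_inf"
  shows "erased_interval_process (Law K) CI CE"
  unfolding erased_interval_process_def
proof (intro conjI allI impI)
  interpret L: prob_space "Law K" by (rule prob_space_Law[OF K])
  show "prob_space (Law K)" by (rule prob_space_Law[OF K])
  fix n :: nat assume n: "1 \<le> n"
  have cI: "CI m \<in> path_space \<rightarrow>\<^sub>M count_space UNIV" and cE: "CE m \<in> path_space \<rightarrow>\<^sub>M count_space UNIV" if "1 \<le> m" for m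
    by (rule measurable_compose[OF measurable_path_coord[OF that]], simp)+
  have LI: "CI m \<in> Law K \<rightarrow>\<^sub>M count_space UNIV" and LE: "CE m \<in> Law K \<rightarrow>\<^sub>M count_space UNIV" if "1 \<le> m" for m
    using cI[OF that] cE[OF that] by (simp_all add: measurable_cong_sets[OF sets_Law refl])
  show "CI n \<in> Law K \<rightarrow>\<^sub>M count_space UNIV" "CE n \<in> Law K \<rightarrow>\<^sub>M count_space UNIV" by (rule LI[OF n], rule LE[OF n])
  have e: "CE n (Phi K u) = EU n u" "CI n (Phi K u) = IK K n u" for u using n by (simp_all add: Phi_nth)
  show "AE f in Law K. (CI n f, CE n f) \<in> InSy n \<times> {1..n + 1}"
  proof (rule AE_I2)
    fix f assume "f \<in> space (Law K)"
    then have "f n \<in> InSy n \<times> {1..n + 1}" using n by (auto simp: space_Law paths_def dest: PiE_mem)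
    then show "(CI n f, CE n f) \<in> InSy n \<times> {1..n + 1}" by simp
  qed
  note eu = eip_U_measure[OF K, unfolded erased_interval_process_def, THEN conjunct2, rule_format, OF n]
  have "distr (Law K) (count_space UNIV) (CE n) = distr U_measure (count_space UNIV) (\<lambda>u. CE n (Phi K u))"
    unfolding Law_eq_distr by (subst distr_distr[OF cE[OF n] measurable_Phi_U[OF K]]) (simp add: comp_def)
  also have "\<dots> = measure_pmf (pmf_of_set {1..n + 1})" unfolding e using eu by blast
  finally show "distr (Law K) (count_space UNIV) (CE n) = measure_pmf (pmf_of_set {1..n + 1})" .
  show "AE f in Law K. CI n f = phi (CI (n + 1) f) (CE n f)"
  proof (rule AE_LawI[OF K])
    show "{f \<in> paths. CI n f = phi (CI (n + 1) f) (CE n f)} \<in> sets path_space"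
      using path_step_set[OF n, of "\<lambda>a b. fst a = phi (fst b) (snd a)"] by simp
    have "AE u in U_measure. IK K n u = phi (IK K (n + 1) u) (EU n u)" using eu by blast
    then show "AE u in U_measure. CI n (Phi K u) = phi (CI (n + 1) (Phi K u)) (CE n (Phi K u))"
      using n by (simp add: Phi_nth)
  qed
  have subF: "sets (future_field (Law K) CI CE (n + 1)) \<subseteq> sets path_space"
    using sets_future_field_sub[of "n + 1" CI "Law K" CE] LI LE by (simp add: sets_Law)
  \<comment> \<open>Future events of the coordinate process pull back to future events of the
    sampled process, where independence is known.\<close>
  have mF: "Phi K \<in> future_field U_measure (IK K) EU (n + 1) \<rightarrow>\<^sub>M future_field (Law K) CI CE (n + 1)"
  proof (rule measurable_sigma_sets[OF sets_future_field])
    show "{{\<omega> \<in> space (Law K). (CI m \<omega>, CE m \<omega>) \<in> B} |m B. n + 1 \<le> m} \<subseteq> Pow (space (Law K))" by auto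
    show "Phi K \<in> space (future_field U_measure (IK K) EU (n + 1)) \<rightarrow> space (Law K)"
      using Phi_in_paths by (simp add: space_Law)
    fix y assume "y \<in> {{\<omega> \<in> space (Law K). (CI m \<omega>, CE m \<omega>) \<in> B} |m B. n + 1 \<le> m}"
    then obtain m B where y: "y = {\<omega> \<in> space (Law K). (CI m \<omega>, CE m \<omega>) \<in> B}" "n + 1 \<le> m" by blast
    have "Phi K -` y \<inter> space (future_field U_measure (IK K) EU (n + 1)) = {u \<in> space U_measure. (IK K m u, EU m u) \<in> B}"
      using y(2) by (auto simp: y(1) space_future_field space_Law Phi_in_paths Phi_nth)
    then show "Phi K -` y \<inter> space (future_field U_measure (IK K) EU (n + 1)) \<in> sets (future_field U_measure (IK K) EU (n + 1))"
      using future_field_genI[OF y(2)] by simp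
  qed
  show "L.indep_set (sets (vimage_algebra (space (Law K)) (CE n) (count_space UNIV))) (sets (future_field (Law K) CI CE (n + 1)))"
  proof (rule L.indep_setI)
    have va: "sets (vimage_algebra (space (Law K)) (CE n) (count_space UNIV)) = {CE n -` A \<inter> space (Law K) | A. A \<in> sets (count_space UNIV)}"
      by (rule sets_vimage_algebra2) simp
    show "sets (vimage_algebra (space (Law K)) (CE n) (count_space UNIV)) \<subseteq> L.events"
      unfolding va using measurable_sets[OF LE[OF n]] by blast
    show "sets (future_field (Law K) CI CE (n + 1)) \<subseteq> L.events" using subF by (simp add: sets_Law)
    fix a b assume a: "a \<in> sets (vimage_algebra (space (Law K)) (CE n) (count_space UNIV))"
      and b: "b \<in> sets (future_field (Law K) CI CE (n + 1))"
    obtain S where S: "a = CE n -` S \<inter> space (Law K)" using a unfolding va by blast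
    have ap: "a \<in> sets path_space" using measurable_sets[OF LE[OF n], of S] by (simp add: S sets_Law)
    have bp: "b \<in> sets path_space" using b subF by blast
    have a': "Phi K -` a \<inter> space U_measure = EU n -` S \<inter> space U_measure"
      using Phi_in_paths n by (auto simp: S space_Law Phi_nth)
    have pa: "Phi K -` a \<inter> space U_measure \<in> sets (vimage_algebra (space U_measure) (EU n) (count_space UNIV))"
      unfolding a' by (rule in_vimage_algebra) simp
    have pb: "Phi K -` b \<inter> space U_measure \<in> sets (future_field U_measure (IK K) EU (n + 1))"
      using measurable_sets[OF mF b] by (simp add: space_future_field)
    have ind: "UM.indep_set (sets (vimage_algebra (space U_measure) (EU n) (count_space UNIV))) (sets (future_field U_measure (IK K) EU (n + 1)))"
      using eu by blast
    have "UM.prob ((Phi K -` a \<inter> space U_measure) \<inter> (Phi K -` b \<inter> space U_measure)) =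
        UM.prob (Phi K -` a \<inter> space U_measure) * UM.prob (Phi K -` b \<inter> space U_measure)"
      by (rule UM.indep_setD[OF ind pa pb])
    moreover have "(Phi K -` a \<inter> space U_measure) \<inter> (Phi K -` b \<inter> space U_measure) = Phi K -` (a \<inter> b) \<inter> space U_measure" by auto
    ultimately show "L.prob (a \<inter> b) = L.prob a * L.prob b"
      using measure_Law[OF K ap] measure_Law[OF K bp] measure_Law[OF K sets.Int[OF ap bp]] by simp
  qed
qed

lemma process_law_coord: "process_law (Law K) CI CE = Law K"
proof -
  have "process_law (Law K) CI CE = distr (Law K) (Law K) (\<lambda>f. f)"
    unfolding process_law_def
  proof (rule distr_cong)
    fix f assume "f \<in> space (Law K)"
    then have "f \<in> extensional {1..}" by (simp add: space_Law paths_def PiE_def)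
    then show "process_path CI CE f = f" by (auto simp: process_path_def extensional_def fun_eq_iff)
  qed (simp_all add: sets_Law)
  then show ?thesis by simp
qed

lemma rescale_phi_inf_tendsto:
  assumes K: "K \<in> InSy_inf" and u: "nice u" and g: "good K u"
  shows "limitin InSy_inf_topology (\<lambda>n. rescale n (CI n (Phi K u))) K sequentially"
  unfolding limitin_IS_iff
proof (intro conjI allI impI K)
  fix e :: real assume e: "0 < e"
  obtain N where N: "1 \<le> N" "\<And>n. N \<le> n \<Longrightarrow> disc u n (e/4)" using nice_disc[OF u, of "e/4"] e by auto
  obtain N' where N': "0 < N'" "inverse (real N') < e/4" using e by (metis ex_inverse_of_nat_less divide_pos_pos zero_less_numeral)
  have "rescale n (CI n (Phi K u)) \<in> InSy_inf \<and> d_haus (rescale n (CI n (Phi K u))) K < e" if n: "max N N' \<le> n" for n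
  proof -
    have n1: "1 \<le> n" using n N by simp
    have c: "CI n (Phi K u) = phi_inf n K (order_stat u n)" using n1 by (simp add: Phi_nth)
    have "d_haus K (rescale n (phi_inf n K (order_stat u n))) \<le> 2 * (e/4) + 1 / real n"
      using u n by (intro d_haus_rescale_phi_inf[OF K _ g n1 N(2)]) (auto simp: nice_def)
    moreover have "1 / real n \<le> inverse (real N')" using N' n by (simp add: divide_simps)
    ultimately have "d_haus K (rescale n (phi_inf n K (order_stat u n))) < e" using N'(2) e by linarith
    then show ?thesis unfolding c using rescale_in_InSy_inf[OF phi_inf_in_InSy n1] d_haus_sym[of K] by simp
  qed
  then show "\<exists>N. \<forall>n\<ge>N. rescale n (CI n (Phi K u)) \<in> InSy_inf \<and> d_haus (rescale n (CI n (Phi K u))) K < e" by blast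
qed

lemma singleton_BIS:
  assumes "K \<in> InSy_inf"
  shows "{K} \<in> sets BIS"
proof -
  have "closedin InSy_inf_topology {K}"
    using Hausdorff_imp_t1_space[OF IS.Hausdorff_space_mtopology] assms unfolding t1_space_closedin_singleton by simp
  then have "InSy_inf - {K} \<in> sets BIS" by (intro openin_sets_borel_of) (auto simp: closedin_def)
  then have "space BIS - (InSy_inf - {K}) \<in> sets BIS" by (rule sets.compl_sets)
  moreover have "space BIS - (InSy_inf - {K}) = {K}" using assms by (auto simp: space_BIS)
  ultimately show ?thesis by simp
qed

text \<open>Under \<open>Law K\<close> the limit is almost surely \<open>K\<close> itself, so
  \<open>terminal_indicator\<close> makes the indicator of every terminal event almost surely
  constant.\<close>

lemma Law_in_erg:
  assumes K: "K \<in> InSy_inf"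
  shows "Law K \<in> erg_ErInPr"
proof -
  interpret c: eip "Law K" CI CE by (rule eip_locale[OF eip_Law[OF K]])
  have ae: "AE f in Law K. c.I_inf f = K"
  proof (rule AE_LawI[OF K])
    have "c.I_inf -` {K} \<inter> space (Law K) \<in> sets (Law K)" by (rule measurable_sets[OF c.measurable_I_inf_M singleton_BIS[OF K]])
    moreover have "c.I_inf -` {K} \<inter> space (Law K) = {f \<in> paths. c.I_inf f = K}" by (auto simp: space_Law)
    ultimately show "{f \<in> paths. c.I_inf f = K} \<in> sets path_space" by (simp add: sets_Law)
    show "AE u in U_measure. c.I_inf (Phi K u) = K"
      using AE_nice AE_good[OF K]
    proof eventually_elim
      case (elim u)
      show ?case
        by (rule c.I_inf_eqI(1)[OF rescale_phi_inf_tendsto[OF K elim]]) (simp add: Phi_nth phi_inf_in_InSy)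
    qed
  qed
  have "c.prob A = 0 \<or> c.prob A = 1" if A: "A \<in> sets (terminal_field (Law K) CI CE)" for A
  proof -
    obtain A' where A': "A' \<in> sets path_space" "AE f in Law K. indicator A f = measure (Law (c.I_inf f)) A'"
      by (rule c.terminal_indicator[OF A])
    have ev: "A \<in> c.events" using A c.T_sub by blast
    have i: "AE f in Law K. indicator A f = measure (Law K) A'" using A'(2) ae by eventually_elim simp
    show ?thesis
    proof (cases "measure (Law K) A' = 1")
      case True
      have "AE f in Law K. f \<in> A" using i by eventually_elim (use True in \<open>auto simp: indicator_def split: if_splits\<close>)
      then show ?thesis using c.prob_eq_1[OF ev] by simp
    next
      case False
      have "AE f in Law K. f \<notin> A" using i by eventually_elim (use False in \<open>auto simp: indicator_def split: if_splits\<close>)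
      then show ?thesis using c.prob_eq_0[OF ev] by simp
    qed
  qed
  then show ?thesis unfolding erg_ErInPr_def using process_law_coord[of K] eip_Law[OF K] by force
qed

lemma (in prob_space) AE_obtain:
  assumes "AE \<omega> in M. P \<omega>"
  obtains \<omega> where "P \<omega>"
proof (rule ccontr)
  assume no: "\<not> thesis"
  from assms have "AE \<omega> in M. \<omega> \<notin> space M" by eventually_elim (use that no in blast)
  then have "prob (space M) = 0" by (subst prob_eq_0) auto
  then show False by (simp add: prob_space)
qed

context eip
begin

text \<open>Each of the countably many events that \<open>I_inf\<close> hits a given rational rectangle is trivial, and
  these events determine \<open>I_inf\<close>.\<close>

lemma trivial_imp_constant:
  assumes triv: "\<And>A. A \<in> sets T \<Longrightarrow> prob A = 0 \<or> prob A = 1"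
  obtains K where "K \<in> InSy_inf" "AE \<omega> in M. I_inf \<omega> = K"
proof -
  let ?Q = "\<lambda>q1 q2 r1 r2 :: rat. {of_rat q1<..<of_rat q2 :: real} \<times> {of_rat r1<..<of_rat r2 :: real}"
  define A where "A q1 q2 r1 r2 = {\<omega> \<in> space M. I_inf \<omega> \<inter> ?Q q1 q2 r1 r2 \<noteq> {}}" for q1 q2 r1 r2
  have A: "A q1 q2 r1 r2 \<in> sets T" for q1 q2 r1 r2
  proof -
    have "I_inf -` {K \<in> InSy_inf. K \<inter> ?Q q1 q2 r1 r2 \<noteq> {}} \<inter> space T \<in> sets T"
      by (intro measurable_sets[OF measurable_I_inf] measurable_hit open_Times open_greaterThanLessThan)
    moreover have "I_inf -` {K \<in> InSy_inf. K \<inter> ?Q q1 q2 r1 r2 \<noteq> {}} \<inter> space T = A q1 q2 r1 r2"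
      using I_inf_mem by (auto simp: A_def space_T)
    ultimately show ?thesis by simp
  qed
  have "AE \<omega> in M. I_inf \<omega> \<inter> ?Q q1 q2 r1 r2 = {} \<longleftrightarrow> prob (A q1 q2 r1 r2) = 0" for q1 q2 r1 r2
  proof -
    have ev: "A q1 q2 r1 r2 \<in> events" using A T_sub by blast
    from triv[OF A] show ?thesis
    proof
      assume p: "prob (A q1 q2 r1 r2) = 0"
      then have "AE \<omega> in M. \<omega> \<notin> A q1 q2 r1 r2" using prob_eq_0[OF ev] by simp
      then show ?thesis unfolding p using AE_space by eventually_elim (simp add: A_def)
    next
      assume p: "prob (A q1 q2 r1 r2) = 1"
      then have "AE \<omega> in M. \<omega> \<in> A q1 q2 r1 r2" using prob_eq_1[OF ev] by simp
      then show ?thesis unfolding p by eventually_elim (simp add: A_def)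
    qed
  qed
  then have ae: "AE \<omega> in M. \<forall>q1 q2 r1 r2. I_inf \<omega> \<inter> ?Q q1 q2 r1 r2 = {} \<longleftrightarrow> prob (A q1 q2 r1 r2) = 0"
    unfolding AE_all_countable by blast
  obtain \<omega>0 where \<omega>0: "\<forall>q1 q2 r1 r2. I_inf \<omega>0 \<inter> ?Q q1 q2 r1 r2 = {} \<longleftrightarrow> prob (A q1 q2 r1 r2) = 0"
    by (rule AE_obtain[OF ae])
  have "AE \<omega> in M. I_inf \<omega> = I_inf \<omega>0"
    using ae
  proof eventually_elim
    case (elim \<omega>)
    show ?case by (rule InSy_inf_eqI[OF I_inf_mem I_inf_mem]) (simp only: elim \<omega>0)
  qed
  with I_inf_mem show ?thesis by (rule that)
qed

lemma process_law_constant: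
  assumes K: "K \<in> InSy_inf" and ae: "AE \<omega> in M. I_inf \<omega> = K"
  shows "process_law M I \<eta> = Law K"
proof -
  have mU: "(\<lambda>\<omega>. Phi K (U \<omega>)) \<in> M \<rightarrow>\<^sub>M path_space" by (rule measurable_compose[OF measurable_U measurable_Phi_U[OF K]])
  \<comment> \<open>The path may leave the path space on a null event, so the two image measures are
    compared directly through their preimages.\<close>
  have "process_law M I \<eta> = distr M path_space (\<lambda>\<omega>. Phi K (U \<omega>))"
    unfolding process_law_def distr_def
  proof (rule measure_of_eq)
    show "sets path_space \<subseteq> Pow (space path_space)" by (rule sets.space_closed)
    fix A assume "A \<in> sigma_sets (space path_space) (sets path_space)"
    then have A: "A \<in> sets path_space" by (simp add: sets.sigma_sets_eq)
    show "emeasure M (process_path I \<eta> -` A \<inter> space M) = emeasure M ((\<lambda>\<omega>. Phi K (U \<omega>)) -` A \<inter> space M)"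
    proof (rule emeasure_eq_AE)
      show "AE \<omega> in M. \<omega> \<in> process_path I \<eta> -` A \<inter> space M \<longleftrightarrow> \<omega> \<in> (\<lambda>\<omega>. Phi K (U \<omega>)) -` A \<inter> space M"
        using AE_path ae by eventually_elim simp
      show "process_path I \<eta> -` A \<inter> space M \<in> events" using path_vimage[OF A] F_sub[of 1] by auto
      show "(\<lambda>\<omega>. Phi K (U \<omega>)) -` A \<inter> space M \<in> events" by (rule measurable_sets[OF mU A])
    qed
  qed
  also have "\<dots> = distr (distr M U_measure U) path_space (Phi K)"
    by (subst distr_distr[OF measurable_Phi_U[OF K] measurable_U]) (simp add: comp_def)
  finally show ?thesis by (simp add: distr_U Law_eq_distr)
qed

end

lemma erg_ErInPr_eq: "erg_ErInPr = Law ` InSy_inf"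
proof (intro equalityI subsetI)
  fix P assume "P \<in> erg_ErInPr"
  then obtain M :: "path measure" and I \<eta> where P: "P = process_law M I \<eta>" "erased_interval_process M I \<eta>"
    and triv: "\<forall>A\<in>sets (terminal_field M I \<eta>). measure M A = 0 \<or> measure M A = 1"
    unfolding erg_ErInPr_def by blast
  interpret eip M I \<eta> by (rule eip_locale[OF P(2)])
  obtain K where "K \<in> InSy_inf" "AE \<omega> in M. I_inf \<omega> = K" using trivial_imp_constant triv by blast
  then show "P \<in> Law ` InSy_inf" using process_law_constant P(1) by blast
qed (use Law_in_erg in blast)

section \<open>The map \<open>K \<mapsto> Law K\<close> is continuous\<close>

lemma continuous_imp_measurable_path:
  assumes "continuous_map path_topology euclideanreal f"
  shows "f \<in> borel_measurable path_space"
proof (rule borel_measurableI)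
  fix S :: "real set" assume "open S"
  then have "openin path_topology {p \<in> topspace path_topology. f p \<in> S}"
    using openin_continuous_map_preimage[OF assms, of S] by simp
  moreover have "{p \<in> topspace path_topology. f p \<in> S} = f -` S \<inter> space path_space"
    by (auto simp: space_borel_of)
  ultimately show "f -` S \<inter> space path_space \<in> sets path_space" using openin_sets_borel_of by metis
qed

lemma integral_Law:
  fixes f :: "path \<Rightarrow> real"
  assumes "K \<in> InSy_inf" "f \<in> borel_measurable path_space"
  shows "(\<integral>p. f p \<partial>Law K) = (\<integral>u. f (Phi K u) \<partial>U_measure)"
  unfolding Law_eq_distr by (rule integral_distr[OF measurable_Phi_U[OF assms(1)] assms(2)])

text \<open>For a fixed good sequence of points, \<open>phi_inf_stable\<close> makes each level
  eventually equal to its limit, and the erasers do not involve the compact set. The paths thus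
  converge in the product topology, and dominated convergence applies.\<close>

lemma integral_Law_tendsto:
  assumes f: "continuous_map path_topology euclideanreal f" and bdd: "bounded (f ` topspace path_topology)"
    and \<sigma>: "\<And>m. \<sigma> m \<in> InSy_inf" and lim: "limitin InSy_inf_topology \<sigma> K sequentially"
  shows "(\<lambda>m. \<integral>p. f p \<partial>Law (\<sigma> m)) \<longlonglongrightarrow> (\<integral>p. f p \<partial>Law K)"
proof -
  have K: "K \<in> InSy_inf" using lim by (simp add: limitin_IS_iff)
  have fm: "f \<in> borel_measurable path_space" by (rule continuous_imp_measurable_path[OF f])
  obtain B where B: "\<And>p. p \<in> paths \<Longrightarrow> \<bar>f p\<bar> \<le> B"
    using bdd unfolding bounded_iff topspace_path_topology by auto
  have "(\<lambda>m. \<integral>u. f (Phi (\<sigma> m) u) \<partial>U_measure) \<longlonglongrightarrow> (\<integral>u. f (Phi K u) \<partial>U_measure)"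
  proof (rule integral_dominated_convergence[where w="\<lambda>_. B"])
    show "(\<lambda>u. f (Phi K u)) \<in> borel_measurable U_measure" by (rule measurable_compose[OF measurable_Phi_U[OF K] fm])
    show "(\<lambda>u. f (Phi (\<sigma> m) u)) \<in> borel_measurable U_measure" for m by (rule measurable_compose[OF measurable_Phi_U[OF \<sigma>] fm])
    show "AE u in U_measure. norm (f (Phi (\<sigma> m) u)) \<le> B" for m using B Phi_in_paths by simp
    show "AE u in U_measure. (\<lambda>m. f (Phi (\<sigma> m) u)) \<longlonglongrightarrow> f (Phi K u)"
      using AE_nice AE_good[OF K]
    proof eventually_elim
      case (elim u)
      have gen: "generic u" using elim by (simp add: nice_def)
      show ?case
      proof (rule topological_tendstoI)
        fix S :: "real set" assume S: "open S" "f (Phi K u) \<in> S"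
        have W: "openin path_topology {p \<in> topspace path_topology. f p \<in> S}"
          using openin_continuous_map_preimage[OF f, of S] S by simp
        have "Phi K u \<in> {p \<in> topspace path_topology. f p \<in> S}" using S Phi_in_paths by (simp add: topspace_path_topology)
        then obtain n where n: "cyl n (Phi K u) \<subseteq> {p \<in> topspace path_topology. f p \<in> S}" by (rule open_paths_cyl[OF W])
        have "\<forall>\<^sub>F m in sequentially. phi_inf i (\<sigma> m) (order_stat u i) = phi_inf i K (order_stat u i)" for i
        proof -
          obtain e where e: "0 < e" "\<And>L. L \<in> InSy_inf \<Longrightarrow> d_haus K L < e \<Longrightarrow> phi_inf i L (order_stat u i) = phi_inf i K (order_stat u i)"
            using phi_inf_stable[OF K gen elim(2), of i] by blast
          obtain N where N: "\<forall>m\<ge>N. \<sigma> m \<in> InSy_inf \<and> d_haus (\<sigma> m) K < e" using lim e(1) unfolding limitin_IS_iff by blast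
          have "phi_inf i (\<sigma> m) (order_stat u i) = phi_inf i K (order_stat u i)" if "N \<le> m" for m
            using e(2)[of "\<sigma> m"] N that d_haus_sym[of K "\<sigma> m"] by simp
          then show ?thesis unfolding eventually_sequentially by blast
        qed
        then have "\<forall>\<^sub>F m in sequentially. \<forall>i\<in>{1..n}. phi_inf i (\<sigma> m) (order_stat u i) = phi_inf i K (order_stat u i)"
          by (intro eventually_ball_finite) auto
        then show "\<forall>\<^sub>F m in sequentially. f (Phi (\<sigma> m) u) \<in> S"
        proof eventually_elim
          case (elim m)
          then have "Phi (\<sigma> m) u \<in> cyl n (Phi K u)" using Phi_in_paths by (simp add: cyl_def Phi_nth)
          then show ?case using n by blast
        qed
      qed
    qed
  qed simp
  then show ?thesis using integral_Law[OF _ fm] K \<sigma> by simp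
qed

lemma Law_in_prob_algebra: "K \<in> InSy_inf \<Longrightarrow> Law K \<in> space (prob_algebra path_space)"
  by (simp add: space_prob_algebra sets_Law prob_space_Law)

lemma openin_weak_topology:
  assumes "continuous_map path_topology euclideanreal f" "bounded (f ` topspace path_topology)" "open V"
  shows "openin (weak_topology path_topology) {P \<in> space (prob_algebra path_space). (\<integral>x. f x \<partial>P) \<in> V}"
  unfolding weak_topology_def by (rule topology_generated_by_Basis) (use assms in blast)

lemma topspace_weak_topology: "topspace (weak_topology path_topology) = space (prob_algebra path_space)"
proof
  show "topspace (weak_topology path_topology) \<subseteq> space (prob_algebra path_space)"
    unfolding weak_topology_def topology_generated_by_topspace by blast
  \<comment> \<open>The constant function 0 with the target \<open>UNIV\<close> makes the set of all
    probability measures one of the generating sets.\<close>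
  have "openin (weak_topology path_topology) {P \<in> space (prob_algebra path_space). (\<integral>x. (\<lambda>_. 0 :: real) x \<partial>P) \<in> UNIV}"
    by (rule openin_weak_topology) (auto simp: bounded_iff)
  then show "space (prob_algebra path_space) \<subseteq> topspace (weak_topology path_topology)"
    by (auto dest: openin_subset)
qed

text \<open>Continuity is tested on generating sets. The limit space being metric, a failure at
  \<open>K\<close> would give a sequence converging to \<open>K\<close> that contradicts
  \<open>integral_Law_tendsto\<close>.\<close>

lemma continuous_Law: "continuous_map InSy_inf_topology (weak_topology path_topology) Law"
  unfolding weak_topology_def continuous_on_generated_topo_iff
proof (intro conjI allI impI)
  show "Law ` topspace InSy_inf_topology \<subseteq> \<Union>{{P \<in> space (prob_algebra path_space). (\<integral>x. f x \<partial>P) \<in> V} | f V.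
        continuous_map path_topology euclideanreal f \<and> bounded (f ` topspace path_topology) \<and> open V}"
    unfolding topspace_weak_topology[unfolded weak_topology_def topology_generated_by_topspace]
    using Law_in_prob_algebra by auto
  fix W assume "W \<in> {{P \<in> space (prob_algebra path_space). (\<integral>x. f x \<partial>P) \<in> V} | f V.
        continuous_map path_topology euclideanreal f \<and> bounded (f ` topspace path_topology) \<and> open V}"
  then obtain f V where W: "W = {P \<in> space (prob_algebra path_space). (\<integral>x. f x \<partial>P) \<in> V}"
    and f: "continuous_map path_topology euclideanreal f" "bounded (f ` topspace path_topology)" and V: "open V" by blast
  have eq: "Law -` W \<inter> topspace InSy_inf_topology = {K \<in> InSy_inf. (\<integral>x. f x \<partial>Law K) \<in> V}"
    using Law_in_prob_algebra by (auto simp: W)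
  show "openin InSy_inf_topology (Law -` W \<inter> topspace InSy_inf_topology)"
    unfolding eq IS.openin_mtopology
  proof (intro conjI allI impI)
    fix K assume "K \<in> {K \<in> InSy_inf. (\<integral>x. f x \<partial>Law K) \<in> V}"
    then have K: "K \<in> InSy_inf" "(\<integral>x. f x \<partial>Law K) \<in> V" by auto
    show "\<exists>r>0. IS.mball K r \<subseteq> {K \<in> InSy_inf. (\<integral>x. f x \<partial>Law K) \<in> V}"
    proof (rule ccontr)
      assume "\<not> ?thesis"
      then have ex: "\<exists>L. L \<in> IS.mball K r \<and> (\<integral>x. f x \<partial>Law L) \<notin> V" if "0 < r" for r using that by fastforce
      have "\<exists>L. L \<in> IS.mball K (inverse (real (Suc m))) \<and> (\<integral>x. f x \<partial>Law L) \<notin> V" for m by (rule ex) simp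
      then obtain \<sigma> where \<sigma>: "\<And>m. \<sigma> m \<in> IS.mball K (inverse (real (Suc m)))" "\<And>m. (\<integral>x. f x \<partial>Law (\<sigma> m)) \<notin> V" by metis
      have s: "\<sigma> m \<in> InSy_inf" "d_haus K (\<sigma> m) < inverse (real (Suc m))" for m using \<sigma>(1)[of m] by auto
      have "limitin InSy_inf_topology \<sigma> K sequentially"
        unfolding limitin_IS_iff
      proof (intro conjI allI impI K(1))
        fix e :: real assume "0 < e"
        then obtain N where N: "inverse (real (Suc N)) < e" using reals_Archimedean by blast
        have "\<sigma> m \<in> InSy_inf \<and> d_haus (\<sigma> m) K < e" if "N \<le> m" for m
        proof -
          have "inverse (real (Suc m)) \<le> inverse (real (Suc N))" using that by (intro le_imp_inverse_le) auto
          then have "d_haus K (\<sigma> m) < e" using s(2)[of m] N by linarith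
          then show ?thesis using s(1)[of m] d_haus_sym[of K "\<sigma> m"] by simp
        qed
        then show "\<exists>N. \<forall>n\<ge>N. \<sigma> n \<in> InSy_inf \<and> d_haus (\<sigma> n) K < e" by blast
      qed
      from integral_Law_tendsto[OF f s(1) this]
      have "\<forall>\<^sub>F m in sequentially. (\<integral>x. f x \<partial>Law (\<sigma> m)) \<in> V" using V K(2) by (rule topological_tendstoD)
      then show False using \<sigma>(2) by (auto simp: eventually_sequentially)
    qed
  qed blast
qed

section \<open>The inverse map is continuous\<close>

text \<open>An Egorov-type step: almost surely the grid deviations stay small from some index on, so
  a common index works outside an event of probability below 1/4.\<close>

lemma uniform_disc:
  assumes e: "0 < e"
  obtains H N where "H \<in> sets U_measure" "3/4 < UM.prob H" "\<And>u n. u \<in> H \<Longrightarrow> N \<le> n \<Longrightarrow> disc u n e"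
proof -
  obtain k where k0: "0 < k" and ke: "1 / real k < e / 2" by (rule fine_grid[OF e])
  let ?g = "\<lambda>j::nat. real j / real k"
  define H where "H N = {u \<in> space U_measure. \<forall>n. N \<le> n \<longrightarrow> (\<forall>j\<in>{..k}. \<bar>real (cnt u n (?g j)) / real n - ?g j\<bar> < e / 2)}" for N
  have mH: "H N \<in> sets U_measure" for N
  proof -
    have [measurable]: "(\<lambda>u. cnt u n (?g j)) \<in> U_measure \<rightarrow>\<^sub>M count_space UNIV" for n j
      by (rule measurable_cnt) (auto intro: measurable_U_coord)
    show ?thesis unfolding H_def by measurable
  qed
  have "incseq H" unfolding H_def by (intro incseq_SucI) auto
  then have lim: "(\<lambda>N. UM.prob (H N)) \<longlonglongrightarrow> UM.prob (\<Union>N. H N)"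
    using mH by (intro UM.finite_Lim_measure_incseq) auto
  have "AE u in U_measure. u \<in> (\<Union>N. H N)"
    using AE_nice AE_space
  proof eventually_elim
    case (elim u)
    obtain N where N: "\<And>n. N \<le> n \<Longrightarrow> disc u n (e/4)" using nice_disc[OF elim(1), of "e/4"] e by auto
    have "\<bar>real (cnt u n (?g j)) / real n - ?g j\<bar> < e / 2" if "N \<le> n" "j \<in> {..k}" for n j
    proof -
      have "?g j \<in> {0..1}" using that k0 by (auto simp: divide_le_eq_1)
      from discD[OF N[OF that(1)] this] show ?thesis using e by linarith
    qed
    then have "u \<in> H N" using elim(2) by (auto simp: H_def)
    then show ?case by blast
  qed
  then have "UM.prob (\<Union>N. H N) = 1" using mH by (subst UM.prob_eq_1) auto
  then have "\<forall>\<^sub>F N in sequentially. 3/4 < UM.prob (H N)" using lim by (intro order_tendstoD) auto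
  then obtain N where "3/4 < UM.prob (H N)" by (auto simp: eventually_sequentially)
  moreover have "disc u n e" if "u \<in> H N" "N \<le> n" for u n
    using that k0 ke by (intro disc_of_grid[OF k0 ke]) (auto simp: H_def)
  ultimately show ?thesis using mH that by blast
qed

text \<open>The bound on the probability is uniform in \<open>K\<close>: it only involves the discrepancy of the points.\<close>

lemma Law_concentrated:
  assumes e: "0 < e"
  obtains n where "1 \<le> n" "\<And>K. K \<in> InSy_inf \<Longrightarrow> 3/4 < measure (Law K) {p \<in> paths. d_haus K (rescale n (CI n p)) \<le> e}"
proof -
  have "0 < e / 4" using e by simp
  then obtain H N where H: "H \<in> sets U_measure" "3/4 < UM.prob H" "\<And>u n. u \<in> H \<Longrightarrow> N \<le> n \<Longrightarrow> disc u n (e/4)"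
    by (rule uniform_disc) blast
  obtain N' where N': "0 < N'" "inverse (real N') < e/4" using \<open>0 < e / 4\<close> ex_inverse_of_nat_less by blast
  define n where "n = max N N'"
  have n: "1 \<le> n" "N \<le> n" "N' \<le> n" using N' by (auto simp: n_def)
  have in1: "1 / real n \<le> inverse (real N')" using N' n by (simp add: divide_simps)
  have "3/4 < measure (Law K) {p \<in> paths. d_haus K (rescale n (CI n p)) \<le> e}" if K: "K \<in> InSy_inf" for K
  proof -
    let ?S = "{p \<in> paths. d_haus K (rescale n (CI n p)) \<le> e}"
    have S: "?S \<in> sets path_space" using path_coord_set[OF n(1), of "{a. d_haus K (rescale n (fst a)) \<le> e}"] by simp
    have "UM.prob H \<le> UM.prob (Phi K -` ?S \<inter> space U_measure)"
    proof (rule UM.finite_measure_mono_AE)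
      show "AE u in U_measure. u \<in> H \<longrightarrow> u \<in> Phi K -` ?S \<inter> space U_measure"
        using AE_nice AE_good[OF K] AE_space
      proof eventually_elim
        case (elim u)
        show ?case
        proof
          assume u: "u \<in> H"
          have "d_haus K (rescale n (phi_inf n K (order_stat u n))) \<le> 2 * (e/4) + 1 / real n"
            using elim by (intro d_haus_rescale_phi_inf[OF K _ elim(2) n(1) H(3)[OF u n(2)]]) (simp add: nice_def)
          also have "\<dots> \<le> e" using in1 N'(2) e by linarith
          finally show "u \<in> Phi K -` ?S \<inter> space U_measure" using elim(3) n(1) Phi_in_paths by (simp add: Phi_nth)
        qed
      qed
      show "Phi K -` ?S \<inter> space U_measure \<in> UM.events" by (rule measurable_sets[OF measurable_Phi_U[OF K] S])
    qed
    then show ?thesis using H(2) measure_Law[OF K S] by simp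
  qed
  with n(1) show ?thesis by (rule that)
qed

text \<open>The event depends on one coordinate with values in a discrete space, so it is both open
  and closed.\<close>

lemma indicator_coord_continuous:
  assumes n: "1 \<le> n"
  shows "continuous_map path_topology euclideanreal (indicator {p \<in> paths. p n \<in> A} :: path \<Rightarrow> real)"
    (is "continuous_map _ _ (indicator ?S)")
  unfolding continuous_map_def
proof (intro conjI allI impI)
  fix V :: "real set"
  have eq: "{p \<in> topspace path_topology. indicator ?S p \<in> V} = {p \<in> paths. p n \<in> {a. (if a \<in> A then 1 else 0 :: real) \<in> V}}"
    by (auto simp: topspace_path_topology indicator_def)
  show "openin path_topology {p \<in> topspace path_topology. indicator ?S p \<in> V}"
    unfolding eq by (rule openin_path_coord[OF n])
qed simp

text \<open>Two laws whose level-\<open>n\<close> marginals overlap in total variation come from nearby compact sets,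
  since both are concentrated on interval systems close to their compact set.\<close>

lemma Law_separation:
  assumes e: "0 < e" and K: "K \<in> InSy_inf"
  obtains V where "openin (weak_topology path_topology) V" "Law K \<in> V"
    "\<And>L. L \<in> InSy_inf \<Longrightarrow> Law L \<in> V \<Longrightarrow> d_haus K L \<le> 2 * e"
proof -
  obtain n where n: "1 \<le> n" and conc: "\<And>K. K \<in> InSy_inf \<Longrightarrow> 3/4 < measure (Law K) {p \<in> paths. d_haus K (rescale n (CI n p)) \<le> e}"
    using Law_concentrated[OF e] by blast
  let ?S = "\<lambda>K. {p \<in> paths. d_haus K (rescale n (CI n p)) \<le> e}"
  have S: "?S K \<in> sets path_space" for K using path_coord_set[OF n, of "{a. d_haus K (rescale n (fst a)) \<le> e}"] by simp
  define f where "f = (indicator (?S K) :: path \<Rightarrow> real)"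
  have fc: "continuous_map path_topology euclideanreal f"
    using indicator_coord_continuous[OF n, of "{a. d_haus K (rescale n (fst a)) \<le> e}"] unfolding f_def mem_Collect_eq .
  have fb: "bounded (f ` topspace path_topology)"
    unfolding bounded_iff f_def by (intro exI[of _ 1]) (auto simp: indicator_def)
  have fi: "(\<integral>p. f p \<partial>Law L) = measure (Law L) (?S K)" for L
  proof -
    have "?S K \<inter> space (Law L) = ?S K" by (auto simp: space_Law)
    then show ?thesis using S[of K] by (simp add: f_def sets_Law)
  qed
  \<comment> \<open>The threshold 1/2 lies below the 3/4 reached by \<open>Law K\<close>, and
    \<open>1/2 + 3/4 > 1\<close> forces the two concentration events to meet under
    \<open>Law L\<close>.\<close>
  define V where "V = {P \<in> space (prob_algebra path_space). (\<integral>x. f x \<partial>P) \<in> {1/2<..}}"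
  have V: "openin (weak_topology path_topology) V"
    unfolding V_def by (rule openin_weak_topology[OF fc fb]) simp
  have KV: "Law K \<in> V" unfolding V_def using fi[of K] conc[OF K] Law_in_prob_algebra[OF K] by simp
  have "d_haus K L \<le> 2 * e" if L: "L \<in> InSy_inf" and LV: "Law L \<in> V" for L
  proof -
    interpret L: prob_space "Law L" by (rule prob_space_Law[OF L])
    have a: "1/2 < L.prob (?S K)" using LV fi[of L] by (simp add: V_def)
    have b: "3/4 < L.prob (?S L)" by (rule conc[OF L])
    have "?S K \<inter> ?S L \<noteq> {}"
    proof
      assume dis: "?S K \<inter> ?S L = {}"
      have "L.prob (?S K \<union> ?S L) = L.prob (?S K) + L.prob (?S L)"
        by (rule L.finite_measure_Union[OF _ _ dis]) (use S in \<open>simp_all add: sets_Law\<close>)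
      then show False using a b L.prob_le_1[of "?S K \<union> ?S L"] by linarith
    qed
    then obtain p where p: "p \<in> paths" "d_haus K (rescale n (CI n p)) \<le> e" "d_haus L (rescale n (CI n p)) \<le> e" by blast
    have "p n \<in> InSy n \<times> {1..n + 1}" using p(1) n unfolding paths_def by (auto dest: PiE_mem)
    then have r: "rescale n (CI n p) \<in> InSy_inf" using n by (intro rescale_in_InSy_inf) auto
    have "d_haus K L \<le> d_haus K (rescale n (CI n p)) + d_haus (rescale n (CI n p)) L" by (rule IS.triangle[OF K r L])
    then show ?thesis using p d_haus_sym[of L] by simp
  qed
  with V KV show ?thesis by (rule that)
qed

text \<open>Equal laws share all neighbourhoods, so \<open>Law_separation\<close> bounds the
  distance of the compact sets by every positive number.\<close>

lemma Law_inj: "inj_on Law InSy_inf"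
proof (rule inj_onI)
  fix K L assume K: "K \<in> InSy_inf" and L: "L \<in> InSy_inf" and eq: "Law K = Law L"
  have "d_haus K L \<le> 0 + e" if e: "0 < e" for e
  proof -
    have h: "0 < e / 2" using e by simp
    obtain V where "Law K \<in> V" "\<And>L. L \<in> InSy_inf \<Longrightarrow> Law L \<in> V \<Longrightarrow> d_haus K L \<le> 2 * (e/2)"
      by (rule Law_separation[OF h K]) blast
    then show ?thesis using L eq by simp
  qed
  then have "d_haus K L \<le> 0" by (rule field_le_epsilon)
  then show "K = L" using IS.zero[OF K L] IS.nonneg[of K L] by simp
qed

lemma Law_homeomorphic:
  "homeomorphic_map InSy_inf_topology (subtopology (weak_topology path_topology) erg_ErInPr) Law"
proof (rule bijective_open_imp_homeomorphic_map)
  have "erg_ErInPr \<subseteq> topspace (weak_topology path_topology)"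
    unfolding topspace_weak_topology erg_ErInPr_eq using Law_in_prob_algebra by blast
  then show "Law ` topspace InSy_inf_topology = topspace (subtopology (weak_topology path_topology) erg_ErInPr)"
    by (simp add: erg_ErInPr_eq Int_absorb1)
  show "inj_on Law (topspace InSy_inf_topology)" using Law_inj by simp
  show "continuous_map InSy_inf_topology (subtopology (weak_topology path_topology) erg_ErInPr) Law"
    unfolding continuous_map_in_subtopology using continuous_Law by (simp add: erg_ErInPr_eq)
  show "open_map InSy_inf_topology (subtopology (weak_topology path_topology) erg_ErInPr) Law"
    unfolding open_map_def
  proof (intro allI impI)
    fix W assume W: "openin InSy_inf_topology W"
    show "openin (subtopology (weak_topology path_topology) erg_ErInPr) (Law ` W)"
    proof (subst openin_subopen, intro ballI)
      fix P assume "P \<in> Law ` W"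
      then obtain K where K: "K \<in> W" "P = Law K" by blast
      have KI: "K \<in> InSy_inf" using W K(1) openin_subset by fastforce
      obtain r where r: "0 < r" "IS.mball K r \<subseteq> W" using W K(1) unfolding IS.openin_mtopology by blast
      \<comment> \<open>\<open>Law_separation\<close> then gives a distance of at most
        \<open>2 * (r / 3)\<close>, which is below \<open>r\<close>.\<close>
      have r3: "0 < r / 3" using r by simp
      obtain V where V: "openin (weak_topology path_topology) V" "Law K \<in> V"
        "\<And>L. L \<in> InSy_inf \<Longrightarrow> Law L \<in> V \<Longrightarrow> d_haus K L \<le> 2 * (r / 3)" by (rule Law_separation[OF r3 KI]) blast
      have "V \<inter> erg_ErInPr \<subseteq> Law ` W"
      proof
        fix Q assume "Q \<in> V \<inter> erg_ErInPr"
        then obtain L where L: "L \<in> InSy_inf" "Q = Law L" "Law L \<in> V" unfolding erg_ErInPr_eq by blast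
        then have "d_haus K L < r" using V(3)[OF L(1,3)] r(1) by linarith
        then have "L \<in> W" using r(2) L(1) KI by auto
        then show "Q \<in> Law ` W" using L(2) by blast
      qed
      moreover have "openin (subtopology (weak_topology path_topology) erg_ErInPr) (V \<inter> erg_ErInPr)"
        using V(1) by (rule openin_subtopology_Int)
      moreover have "P \<in> V \<inter> erg_ErInPr" using V(2) K(2) Law_in_erg[OF KI] by simp
      ultimately show "\<exists>T. openin (subtopology (weak_topology path_topology) erg_ErInPr) T \<and> P \<in> T \<and> T \<subseteq> Law ` W" by blast
    qed
  qed
qed

theorem theorem2p4:
  shows "(\<forall>K\<in>InSy_inf. Law K \<in> erg_ErInPr) \<and>
    homeomorphic_map InSy_inf_topology
      (subtopology (weak_topology path_topology) erg_ErInPr) Law \<and>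
    (\<forall>(M :: 'a measure) I \<eta>. erased_interval_process M I \<eta> \<longrightarrow>
      (\<exists>I_inf \<in> M \<rightarrow>\<^sub>M borel_of InSy_inf_topology.
        (AE \<omega> in M. limitin InSy_inf_topology (\<lambda>n. rescale n (I n \<omega>)) (I_inf \<omega>) sequentially) \<and>
        (let U = (\<lambda>i \<omega>. U_of_eraser (\<lambda>n. \<eta> n \<omega>) i) in
          prob_space.indep_set M
            (sets (vimage_algebra (space M) I_inf (borel_of InSy_inf_topology)))
            (sets (vimage_algebra (space M) (\<lambda>\<omega>. \<lambda>i\<in>{1..}. U i \<omega>) (\<Pi>\<^sub>M i\<in>{1..}. borel))) \<and>
          (AE \<omega> in M. \<forall>n\<ge>1. (I n \<omega>, \<eta> n \<omega>) =
            (phi_inf n (I_inf \<omega>) (order_stat (\<lambda>i. U i \<omega>) n), \<eta> n \<omega>))) \<and>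
        (\<exists>\<kappa>. conditional_law M (terminal_field M I \<eta>) path_space (process_path I \<eta>) \<kappa>) \<and>
        (\<forall>\<kappa>. conditional_law M (terminal_field M I \<eta>) path_space (process_path I \<eta>) \<kappa> \<longrightarrow>
          (AE \<omega> in M. \<kappa> \<omega> = Law (I_inf \<omega>))) \<and>
        equal_mod_null M (sets (vimage_algebra (space M) I_inf (borel_of InSy_inf_topology)))
          (sets (terminal_field M I \<eta>))))"
proof (intro conjI ballI allI impI)
  show "Law K \<in> erg_ErInPr" if "K \<in> InSy_inf" for K by (rule Law_in_erg[OF that])
qed (rule Law_homeomorphic, rule eip.representation_theorem[OF eip_locale], assumption)

end
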